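(* Let $T>0$, $I=[0,T]$, and let $H$ be a real Hilbert space. Let $f:I\times H\times H\to H$ be a map such that for every $(x,u)\in H\times H$ the map $t\mapsto f(t,x,u)$ is measurable on $I$, and such that: (i) for every $\eta>0$ there exists a non-negative function $k_\eta\in \mathbf{L}^1_{\mathbb{R}}(I)$ such that for all $t\in I$ and all $x,y,u,v\in\overline{\mathbf{B}}(0,\eta)$, $$\|f(t,x,u)-f(t,y,v)\|\le k_\eta(t)\big(\|x-y\|+\|u-v\|\big);$$ (ii) there is a non-negative function $c\in \mathbf{L}^1_{\mathbb{R}}(I)$ such that $$\|f(t,x,u)\|\le c(t)\big(1+\|x\|+\|u\|\big)\quad\text{for all }(t,x,u)\in I\times H\times H.$$ Let $r>0$ and let $K:I\rightrightarrows H$ be a set-valued map whose values $K(t)$, $t\in I$, are nonempty, closed and $r$-prox-regular. Assume that there exists an absolutely continuous function $a:I\to\mathbb{R}$ such that for all $t,s\in I$ and all $u\in H$, $$|d(u,K(t))-d(u,K(s))|\le|a(t)-a(s)|.$$ Let $x_0\in H$ and $u_0\in K(0)$. Then the differential inclusion $$\begin{cases}-\ddot{x}(t)\in N_{K(t)}(\dot{x}(t))+f(t,x(t),\dot{x}(t)) & \text{for a.e. }t\in I,\\ \dot{x}(t)\in K(t) & \text{for all }t\in I,\\ x(0)=x_0,\quad \dot{x}(0)=u_0\end{cases}$$ has an absolutely continuous solution $x(\cdot)\in\mathbf{C}^1_H(I)$.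
   Context: $\overline{\mathbf{B}}(0,\eta)$ is the closed ball in $H$ of center $0$ and radius $\eta$; $\mathbb{B}$ is the closed unit ball of $H$; $d(x,A)=\inf_{y\in A}\|x-y\|$. $\mathbf{L}^1_{\mathbb{R}}(I)$ is the space of Lebesgue integrable real functions on $I$, and $\mathbf{L}^1_H(I)$ is the space of Lebesgue–Bochner integrable maps $I\to H$; measurability of $H$-valued maps on $I$ is understood with respect to the Lebesgue $\sigma$-algebra, in the Bochner (strong) sense. $\mathbf{C}^1_H(I)$ is the space of continuous maps $I\to H$ having a continuous derivative. Absolute continuity: a map $u:I\to H$ is absolutely continuous if there is $v\in\mathbf{L}^1_H(I)$ with $u(t)=u(0)+\int_0^t v(s)\,ds$ for all $t\in I$; then $v=\dot u$ a.e. Proximal normal cone: for a closed set $S\subset H$ and $\bar x\in S$, $N^P(S,\bar x)$ is the set of $\xi\in H$ for which there is $\alpha>0$ such that $\bar x$ is a nearest point of $S$ to $\bar x+\alpha\xi$, i.e. $d(\bar x+\alpha\xi,S)=\alpha\|\xi\|$. Prox-regularity: for $r\in(0,+\infty]$, a closed set $S\subset H$ is $r$-prox-regular if for all $\bar x\in S$, all $0\ne\xi\in N^P(S,\bar x)$ and all $x\in S$, $\big\langle \frac{\xi}{\|\xi\|},x-\bar x\big\rangle\le\frac{1}{2r}\|x-\bar x\|^2$ (with $\frac1r=0$ when $r=+\infty$); for $r<+\infty$ this is equivalent to $S\cap \mathrm{int}\big(\bar x+r\frac{\xi}{\|\xi\|}+r\mathbb{B}\big)=\emptyset$ for all such $\bar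 x,\xi$. Normal cone: $N_S(\bar x)$ denotes the normal cone to $S$ at $\bar x\in S$; for $r$-prox-regular $S$ the usual normal cones (proximal, limiting, Clarke) coincide, so $N_S(\bar x)=N^P(S,\bar x)$. The sum $N_S(\bar x)+w$ is the translate of the cone by the vector $w$. Solution: a solution $x(\cdot)$ is a map in $\mathbf{C}^1_H(I)$ whose derivative $\dot x$ is absolutely continuous on $I$ (so that $\ddot x$ exists a.e.) and which satisfies all the displayed relations. *)

theory Defs
  imports "HOL-Analysis.Analysis"
begin

text \<open>
  The library's Bochner integral is restricted to second-countable codomains, hence to separable
  Hilbert spaces. The next two notions are the same construction for an arbitrary normed codomain,
  with Borel measurability replaced by approximability by simple functions.
\<close>

definition strongly_measurable :: "'a measure \<Rightarrow> ('a \<Rightarrow> 'b::real_normed_vector) \<Rightarrow> bool" where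
  "strongly_measurable M f \<longleftrightarrow>
     (\<exists>s. (\<forall>i::nat. simple_function M (s i)) \<and> (AE x in M. (\<lambda>i. s i x) \<longlonglongrightarrow> f x))"

definition has_strong_bochner_integral ::
  "'a measure \<Rightarrow> ('a \<Rightarrow> 'b::real_normed_vector) \<Rightarrow> 'b \<Rightarrow> bool" where
  "has_strong_bochner_integral M f y \<longleftrightarrow>
     strongly_measurable M f \<and>
     (\<exists>s. (\<forall>i::nat. Bochner_Integration.simple_bochner_integrable M (s i)) \<and>
          (\<lambda>i. \<integral>\<^sup>+x. ennreal (norm (f x - s i x)) \<partial>M) \<longlonglongrightarrow> 0 \<and>
          (\<lambda>i. Bochner_Integration.simple_bochner_integral M (s i)) \<longlonglongrightarrow> y)"

definition strongly_integrable :: "'a measure \<Rightarrow> ('a \<Rightarrow> 'b::real_normed_vector) \<Rightarrow> bool" where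
  "strongly_integrable M f \<longleftrightarrow> (\<exists>y. has_strong_bochner_integral M f y)"

lemma strongly_measurable_iff_borel_measurable:
  fixes f :: "'a \<Rightarrow> 'b::{real_normed_vector, second_countable_topology}"
  assumes "complete_measure M"
  shows "strongly_measurable M f \<longleftrightarrow> f \<in> borel_measurable M"
proof
  interpret complete_measure M by fact
  assume "strongly_measurable M f"
  then obtain s where s: "\<And>i::nat. simple_function M (s i)"
    and lim: "AE x in M. (\<lambda>i. s i x) \<longlonglongrightarrow> f x"
    by (auto simp: strongly_measurable_def)
  obtain N where N: "N \<in> null_sets M" "{x \<in> space M. \<not> (\<lambda>i. s i x) \<longlonglongrightarrow> f x} \<subseteq> N"
    using lim by (auto elim!: AE_E simp: null_sets_def)
  define g where "g x = (if x \<in> N then 0 else f x)" for x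
  have Ns: "N \<in> sets M" using N(1) by auto
  have sm: "(\<lambda>x. if x \<in> N then 0 else s i x) \<in> borel_measurable M" for i
    using borel_measurable_simple_function[OF s[of i]] Ns by measurable
  have g: "g \<in> borel_measurable M"
    by (rule borel_measurable_LIMSEQ_metric[OF sm]) (use N(2) in \<open>auto simp: g_def\<close>)
  show "f \<in> borel_measurable M"
  proof (rule measurableI)
    fix A :: "'b set" assume A: "A \<in> sets borel"
    have gA: "g -` A \<inter> space M \<in> sets M" using g A by (rule measurable_sets)
    have B: "f -` A \<inter> N \<inter> space M \<in> sets M" using complete[OF _ N(1)] by auto
    have "f -` A \<inter> space M = (g -` A \<inter> space M - N) \<union> (f -` A \<inter> N \<inter> space M)"
      by (auto simp: g_def split: if_splits)
    then show "f -` A \<inter> space M \<in> sets M" using gA B Ns by (metis sets.Diff sets.Un)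
  qed simp
next
  assume "f \<in> borel_measurable M"
  then show "strongly_measurable M f"
    unfolding strongly_measurable_def
    using borel_measurable_implies_sequence_metric[of f M 0] by (meson AE_I2)
qed

lemma has_strong_bochner_integral_iff_has_bochner_integral:
  fixes f :: "'a \<Rightarrow> 'b::{real_normed_vector, second_countable_topology}"
  assumes "complete_measure M"
  shows "has_strong_bochner_integral M f y \<longleftrightarrow> has_bochner_integral M f y"
  unfolding has_strong_bochner_integral_def has_bochner_integral.simps
    strongly_measurable_iff_borel_measurable[OF assms] by auto

definition absolutely_continuous_upto :: "real \<Rightarrow> (real \<Rightarrow> 'b::real_normed_vector) \<Rightarrow> bool" where
  "absolutely_continuous_upto T u \<longleftrightarrow>
     (\<exists>v. strongly_integrable (lebesgue_on {0..T}) v \<and>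
          (\<forall>t\<in>{0..T}. has_strong_bochner_integral (lebesgue_on {0..t}) v (u t - u 0)))"

definition prox_normal_cone :: "'h::real_inner set \<Rightarrow> 'h \<Rightarrow> 'h set" where
  "prox_normal_cone S x =
     {\<xi>. x \<in> S \<and> (\<exists>\<alpha>>0. infdist (x + \<alpha> *\<^sub>R \<xi>) S = \<alpha> * norm \<xi>)}"

text \<open>For \<open>r = \<infinity>\<close> the factor \<open>1 / (2 * r)\<close> is \<open>0\<close> in \<open>ereal\<close>.\<close>

definition prox_regular :: "ereal \<Rightarrow> 'h::real_inner set \<Rightarrow> bool" where
  "prox_regular r S \<longleftrightarrow>
     closed S \<and>
     (\<forall>xb\<in>S. \<forall>\<xi>\<in>prox_normal_cone S xb. \<forall>x\<in>S. \<xi> \<noteq> 0 \<longrightarrow>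
        (\<xi> /\<^sub>R norm \<xi>) \<bullet> (x - xb) \<le> real_of_ereal (1 / (2 * r)) * (norm (x - xb))\<^sup>2)"

end

theory Submission
  imports Defs
begin

text \<open>
  With \<open>z = (x, x')\<close> the problem becomes a first-order sweeping process
  \<open>- z' \<in> N(z) + g t z\<close> in \<open>H \<times> H\<close> with the moving set \<open>UNIV \<times> K t\<close> and \<open>g t z = (- x', f t x x')\<close>.
  It is discretised by the catching-up algorithm: subtract the integral of \<open>g\<close> over a mesh cell and
  project onto the next set. Nearest points exist because normals are hypomonotone, and the same
  hypomonotonicity with a discrete Gronwall argument makes the discrete solutions uniformly Cauchy,
  so no compactness is needed. The limit \<open>u\<close> satisfies, for \<open>s < t\<close> and \<open>y \<in> C t\<close>, an integrated
  variational inequality whose error is quadratic in the variation of a fixed weight between \<open>s\<close> and \<open>t\<close>;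
  dividing by \<open>t - s\<close> at a point where \<open>u\<close>, the weight and the integral of \<open>g\<close> are differentiable
  gives the quadratic inequality characterising proximal normals. Differentiability of \<open>u\<close> almost
  everywhere is the Radon--Nikodym property of \<open>H\<close>; integrals in \<open>H\<close> are handled weakly, by
  testing with inner products, which reduces them to real integrals.
\<close>

section \<open>Strong measurability and the strong Bochner integral\<close>

text \<open>The Lipschitz bound on the forcing is only local, so a norm bound has to precede the
  choice of \<open>k\<close>. The radius in the locale \<open>sweeping\<close> therefore depends
  only on \<open>c\<close> and \<open>z0\<close>, and \<open>lip\<close> is asked for on that ball
  alone. One integrable weight \<open>m\<close> dominates the drift, its Lipschitz constant and the
  motion of the sets, so every estimate can be measured by increments of its primitive
  \<open>V\<close>. Prox-regularity yields projections only in a tube around the set, whence the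
  restriction to fine meshes (\<open>good\<close>). Comparing two meshes over a coarse cell of
  variation \<delta> \<le> \<epsilon> must cost only \<delta> times a sum of \<epsilon> and squared
  distances: summed over all cells, this leaves a multiple of \<epsilon> and a Gronwall term. In the
  product space the position is unconstrained, so the normal vector has no component there. This is
  what makes the second component of the solution the velocity of the first.\<close>

lemma complete_measure_lebesgue_on:
  assumes "S \<in> sets lebesgue"
  shows "complete_measure (lebesgue_on S)"
proof
  fix B A :: "'a set"
  assume BA: "B \<subseteq> A" and A: "A \<in> null_sets (lebesgue_on S)"
  have "A \<in> null_sets lebesgue" "A \<subseteq> S"
    using A assms by (auto simp: null_sets_restrict_space)
  then have "B \<in> null_sets lebesgue"
    using BA by (meson completion.complete2)
  then show "B \<in> sets (lebesgue_on S)"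
    using BA \<open>A \<subseteq> S\<close> assms by (auto simp: sets_restrict_space_iff)
qed

lemma strongly_measurableE:
  assumes "strongly_measurable M f"
  obtains s where "\<And>i::nat. simple_function M (s i)" "AE x in M. (\<lambda>i. s i x) \<longlonglongrightarrow> f x"
proof -
  from assms obtain s where "(\<forall>i::nat. simple_function M (s i)) \<and> (AE x in M. (\<lambda>i. s i x) \<longlonglongrightarrow> f x)"
    unfolding strongly_measurable_def ..
  then show thesis by (intro that[of s]) simp_all
qed

lemma strongly_measurable_const: "strongly_measurable M (\<lambda>x. c)"
  unfolding strongly_measurable_def by (rule exI[of _ "\<lambda>i x. c"]) auto

lemma strongly_measurable_compose2:
  assumes "strongly_measurable M f" "strongly_measurable M g"
    and h: "\<And>X Y x y. X \<longlonglongrightarrow> x \<Longrightarrow> Y \<longlonglongrightarrow> y \<Longrightarrow> (\<lambda>i. h (X i) (Y i)) \<longlonglongrightarrow> h x y"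
  shows "strongly_measurable M (\<lambda>x. h (f x) (g x))"
proof -
  obtain s where s: "\<And>i::nat. simple_function M (s i)" "AE x in M. (\<lambda>i. s i x) \<longlonglongrightarrow> f x"
    by (rule strongly_measurableE[OF assms(1)]) (rule that)
  obtain t where t: "\<And>i::nat. simple_function M (t i)" "AE x in M. (\<lambda>i. t i x) \<longlonglongrightarrow> g x"
    by (rule strongly_measurableE[OF assms(2)]) (rule that)
  have "simple_function M (\<lambda>x. h (s i x) (t i x))" for i
    by (rule simple_function_compose2[OF s(1) t(1)])
  moreover have "AE x in M. (\<lambda>i. h (s i x) (t i x)) \<longlonglongrightarrow> h (f x) (g x)"
    using s(2) t(2) by eventually_elim (rule h)
  ultimately show ?thesis
    unfolding strongly_measurable_def by (intro exI[of _ "\<lambda>i x. h (s i x) (t i x)"] conjI allI)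
qed

lemma strongly_measurable_compose:
  assumes "strongly_measurable M f"
    and "\<And>X x. X \<longlonglongrightarrow> x \<Longrightarrow> (\<lambda>i. h (X i)) \<longlonglongrightarrow> h x"
  shows "strongly_measurable M (\<lambda>x. h (f x))"
proof -
  have "strongly_measurable M (\<lambda>x. (\<lambda>x y. h x) (f x) (f x))"
    using assms(2) by (intro strongly_measurable_compose2[OF assms(1) assms(1)]) blast
  then show ?thesis by simp
qed

lemma strongly_measurable_AE_cong:
  assumes "strongly_measurable M f" "AE x in M. f x = g x"
  shows "strongly_measurable M g"
proof -
  obtain s where s: "\<And>i::nat. simple_function M (s i)" "AE x in M. (\<lambda>i. s i x) \<longlonglongrightarrow> f x"
    by (rule strongly_measurableE[OF assms(1)]) (rule that)
  have "AE x in M. (\<lambda>i. s i x) \<longlonglongrightarrow> g x"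
    using s(2) assms(2) by eventually_elim simp
  with s(1) show ?thesis unfolding strongly_measurable_def by blast
qed

lemma strongly_measurable_lebesgue_on_subset:
  assumes f: "strongly_measurable (lebesgue_on S) f"
    and S: "A \<subseteq> S" "A \<in> sets lebesgue" "S \<in> sets lebesgue"
  shows "strongly_measurable (lebesgue_on A) f"
proof -
  obtain s where s: "\<And>i::nat. simple_function (lebesgue_on S) (s i)"
      "AE x in lebesgue_on S. (\<lambda>i. s i x) \<longlonglongrightarrow> f x"
    by (rule strongly_measurableE[OF f]) (rule that)
  have "simple_function (lebesgue_on A) (s i)" for i
  proof -
    have fin: "finite (s i ` A)"
      using s(1)[of i] by (intro finite_subset[OF image_mono[OF S(1)]]) (simp add: simple_function_def)
    have "s i -` {s i x} \<inter> A \<in> sets (lebesgue_on A)" if "x \<in> A" for x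
    proof -
      have "s i -` {s i x} \<inter> S \<in> sets (lebesgue_on S)"
        using s(1)[of i] S(1) that by (auto simp: simple_function_def)
      then have "s i -` {s i x} \<inter> S \<in> sets lebesgue"
        using S(3) by (auto simp: sets_restrict_space_iff)
      then have "(s i -` {s i x} \<inter> S) \<inter> A \<in> sets lebesgue" using S(2) by blast
      moreover have "(s i -` {s i x} \<inter> S) \<inter> A = s i -` {s i x} \<inter> A" using S(1) by auto
      ultimately show ?thesis using S(2) by (auto simp: sets_restrict_space_iff)
    qed
    then show ?thesis using fin by (auto simp: simple_function_def)
  qed
  moreover have "AE x in lebesgue_on A. (\<lambda>i. s i x) \<longlonglongrightarrow> f x"
    using s(2) S by (auto simp: AE_restrict_space_iff)
  ultimately show ?thesis unfolding strongly_measurable_def by blast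
qed

text \<open>Intended for \<open>j\<close> the index of a mesh cell: a map of time and state,
  measurable in time for each fixed state, stays measurable when evaluated along a step
  function.\<close>

lemma strongly_measurable_piecewise:
  assumes f: "\<And>i. i \<in> I \<Longrightarrow> strongly_measurable M (f i)" and "finite I"
    and j: "simple_function M j" "\<And>x. x \<in> space M \<Longrightarrow> j x \<in> I"
  shows "strongly_measurable M (\<lambda>x. f (j x) x)"
proof -
  have "\<forall>i\<in>I. \<exists>s. (\<forall>n::nat. simple_function M (s n)) \<and> (AE x in M. (\<lambda>n. s n x) \<longlonglongrightarrow> f i x)"
    using f by (simp add: strongly_measurable_def)
  then obtain s where s: "\<And>i n. i \<in> I \<Longrightarrow> simple_function M (s i n)"
      "\<And>i. i \<in> I \<Longrightarrow> AE x in M. (\<lambda>n. s i n x) \<longlonglongrightarrow> f i x"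
    using bchoice[of I "\<lambda>i s. (\<forall>n::nat. simple_function M (s n)) \<and>
      (AE x in M. (\<lambda>n. s n x) \<longlonglongrightarrow> f i x)"] by blast
  have "simple_function M (\<lambda>x. s (j x) n x)" for n
  proof -
    have img: "(\<lambda>x. s (j x) n x) ` space M \<subseteq> (\<Union>i\<in>I. s i n ` space M)"
      using j(2) by auto
    have "finite (\<Union>i\<in>I. s i n ` space M)"
      using \<open>finite I\<close> s(1) by (auto simp: simple_function_def)
    then have fin: "finite ((\<lambda>x. s (j x) n x) ` space M)" using img finite_subset by blast
    have "(\<lambda>x. s (j x) n x) -` {y} \<inter> space M \<in> sets M" for y
    proof -
      have "(\<lambda>x. s (j x) n x) -` {y} \<inter> space M
          = (\<Union>i\<in>I. (j -` {i} \<inter> space M) \<inter> (s i n -` {y} \<inter> space M))"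
        using j(2) by auto
      moreover have "(j -` {i} \<inter> space M) \<in> sets M" for i
        using j(1) by (rule simple_functionD(2))
      moreover have "s i n -` {y} \<inter> space M \<in> sets M" if "i \<in> I" for i
        using s(1)[OF that] by (rule simple_functionD(2))
      ultimately show ?thesis using \<open>finite I\<close> by (auto intro!: sets.finite_UN)
    qed
    with fin show ?thesis by (auto simp: simple_function_def)
  qed
  moreover have "AE x in M. (\<lambda>n. s (j x) n x) \<longlonglongrightarrow> f (j x) x"
  proof -
    have "AE x in M. \<forall>i\<in>I. (\<lambda>n. s i n x) \<longlonglongrightarrow> f i x"
      using \<open>finite I\<close> s(2) by (auto intro: AE_finite_allI)
    then show ?thesis using AE_space by eventually_elim (use j(2) in auto)
  qed
  ultimately show ?thesis
    unfolding strongly_measurable_def by (intro exI[of _ "\<lambda>n x. s (j x) n x"] conjI allI)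
qed

lemma strongly_measurable_norm_borel:
  assumes "complete_measure M" "strongly_measurable M f"
  shows "(\<lambda>x. norm (f x)) \<in> borel_measurable M"
  using strongly_measurable_iff_borel_measurable[OF assms(1)]
    strongly_measurable_compose[OF assms(2), of norm] by (auto intro: tendsto_norm)

text \<open>Truncating the simple approximants where their norm exceeds \<open>2 * norm f\<close> makes
  dominated convergence applicable.\<close>

lemma has_strong_bochner_integral_dominated:
  fixes f :: "'a \<Rightarrow> 'b::{real_normed_vector, complete_space}"
  assumes M: "complete_measure M" "finite_measure M"
    and f: "strongly_measurable M f"
    and \<phi>: "integrable M \<phi>" "\<And>x. x \<in> space M \<Longrightarrow> norm (f x) \<le> \<phi> x"
  obtains y where "has_strong_bochner_integral M f y"
proof -
  interpret complete_measure M by fact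
  interpret finite_measure M by fact
  obtain s where s: "\<And>i::nat. simple_function M (s i)" "AE x in M. (\<lambda>i. s i x) \<longlonglongrightarrow> f x"
    by (rule strongly_measurableE[OF f]) (rule that)
  have nf[measurable]: "(\<lambda>x. norm (f x)) \<in> borel_measurable M"
    by (rule strongly_measurable_norm_borel[OF M(1) f])
  have ns[measurable]: "(\<lambda>x. norm (s i x)) \<in> borel_measurable M" for i
    using s(1) by (intro borel_measurable_simple_function) (rule simple_function_compose1)
  define t where "t i x = (if norm (s i x) \<le> 2 * norm (f x) then s i x else 0)" for i x
  have t: "simple_function M (t i)" for i
    unfolding t_def by (rule simple_function_If[OF s(1)]) (auto intro: measurable)
  have bt: "Bochner_Integration.simple_bochner_integrable M (t i)" for i
    using t by (intro simple_bochner_integrable.intros) (auto simp: emeasure_eq_measure)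
  have tf: "AE x in M. (\<lambda>i. norm (f x - t i x)) \<longlonglongrightarrow> 0"
    using s(2)
  proof eventually_elim
    case (elim x)
    have "(\<lambda>i. t i x) \<longlonglongrightarrow> f x"
    \<comment> \<open>Where \<open>f\<close> vanishes the truncation vanishes identically; elsewhere
      it is eventually inactive.\<close>
    proof (cases "f x = 0")
      case True
      then have "t i x = f x" for i by (auto simp: t_def)
      then show ?thesis by simp
    next
      case False
      have "(\<lambda>i. norm (s i x)) \<longlonglongrightarrow> norm (f x)" using elim by (rule tendsto_norm)
      then have "\<forall>\<^sub>F i in sequentially. norm (s i x) < 2 * norm (f x)"
        using False by (auto intro: order_tendstoD)
      then have "\<forall>\<^sub>F i in sequentially. s i x = t i x"
        by eventually_elim (auto simp: t_def)
      then show ?thesis using elim by (rule Lim_transform_eventually[rotated])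
    qed
    then have "(\<lambda>i. norm (f x - t i x)) \<longlonglongrightarrow> norm (f x - f x)" by (intro tendsto_intros)
    then show ?case by simp
  qed
  have sft: "strongly_measurable M (\<lambda>x. f x - t i x)" for i
  proof -
    have "strongly_measurable M (t i)"
      using t unfolding strongly_measurable_def by (intro exI[of _ "\<lambda>n. t i"]) auto
    then show ?thesis by (rule strongly_measurable_compose2[OF f, where h = "(-)"]) (rule tendsto_diff)
  qed
  have [measurable]: "(\<lambda>x. norm (f x - t i x)) \<in> borel_measurable M" for i
    by (rule strongly_measurable_norm_borel[OF M(1) sft])
  have bnd: "norm (f x - t i x) \<le> 3 * \<phi> x" if "x \<in> space M" for i x
  proof -
    have "norm (t i x) \<le> 2 * norm (f x)" by (auto simp: t_def)
    then show ?thesis using norm_triangle_ineq4[of "f x" "t i x"] \<phi>(2)[OF that] by linarith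
  qed
  have i\<phi>: "integrable M (\<lambda>x. 3 * \<phi> x)" using \<phi>(1) by simp
  have bnd': "AE x in M. norm (norm (f x - t i x)) \<le> 3 * \<phi> x" for i
    using bnd by (auto intro!: AE_I2)
  have int: "integrable M (\<lambda>x. norm (f x - t i x))" for i
    by (rule Bochner_Integration.integrable_bound[OF i\<phi>])
      (use bnd' in \<open>auto intro!: AE_I2 order_trans[OF bnd]\<close>)
  have "(\<lambda>i. \<integral>x. norm (f x - t i x) \<partial>M) \<longlonglongrightarrow> (\<integral>x. 0 \<partial>M)"
    by (rule integral_dominated_convergence[OF _ _ i\<phi> tf bnd']) auto
  then have lim: "(\<lambda>i. \<integral>x. norm (f x - t i x) \<partial>M) \<longlonglongrightarrow> 0" by simp
  have nn: "(\<integral>\<^sup>+x. ennreal (norm (f x - t i x)) \<partial>M) = ennreal (\<integral>x. norm (f x - t i x) \<partial>M)" for i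
    by (intro nn_integral_eq_integral int) auto
  define J where "J i = Bochner_Integration.simple_bochner_integral M (t i)" for i
  have J: "dist (J i) (J k) \<le> (\<integral>x. norm (f x - t i x) \<partial>M) + (\<integral>x. norm (f x - t k x) \<partial>M)" for i k
  proof -
    have b: "Bochner_Integration.simple_bochner_integrable M (\<lambda>x. t i x - t k x)"
      by (rule simple_bochner_integrable_compose2[OF _ bt bt]) simp
    then have bn: "Bochner_Integration.simple_bochner_integrable M (\<lambda>x. norm (t i x - t k x))"
      by (rule simple_bochner_integrable_compose2[where p = "\<lambda>x y. norm x", OF _ _ b, rotated]) simp
    have "dist (J i) (J k) = norm (Bochner_Integration.simple_bochner_integral M (\<lambda>x. t i x - t k x))"
      by (simp add: dist_norm J_def simple_bochner_integral_diff[OF bt bt])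
    also have "\<dots> \<le> Bochner_Integration.simple_bochner_integral M (\<lambda>x. norm (t i x - t k x))"
      by (rule simple_bochner_integral_norm_bound[OF b])
    also have "\<dots> = (\<integral>x. norm (t i x - t k x) \<partial>M)"
      by (rule simple_bochner_integrable_eq_integral[OF bn])
    also have "\<dots> \<le> (\<integral>x. norm (f x - t i x) + norm (f x - t k x) \<partial>M)"
    proof (rule integral_mono)
      show "integrable M (\<lambda>x. norm (t i x - t k x))"
        using has_bochner_integral_simple_bochner_integrable[OF bn] by (rule integrable.intros)
      show "integrable M (\<lambda>x. norm (f x - t i x) + norm (f x - t k x))" using int by simp
      show "norm (t i x - t k x) \<le> norm (f x - t i x) + norm (f x - t k x)" for x
        using norm_triangle_ineq4[of "f x - t k x" "f x - t i x"] by simp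
    qed
    also have "\<dots> = (\<integral>x. norm (f x - t i x) \<partial>M) + (\<integral>x. norm (f x - t k x) \<partial>M)"
      using int by simp
    finally show ?thesis .
  qed
  have "Cauchy J"
  proof (rule metric_CauchyI)
    fix e :: real assume "e > 0"
    then have "\<forall>\<^sub>F i in sequentially. (\<integral>x. norm (f x - t i x) \<partial>M) < e / 2"
      using order_tendstoD(2)[OF lim, of "e / 2"] by simp
    then obtain N where N: "\<And>i. i \<ge> N \<Longrightarrow> (\<integral>x. norm (f x - t i x) \<partial>M) < e / 2"
      by (auto simp: eventually_sequentially)
    show "\<exists>N. \<forall>m\<ge>N. \<forall>n\<ge>N. dist (J m) (J n) < e"
    proof (intro exI[of _ N] allI impI)
      fix i k assume "N \<le> i" "N \<le> k"
      with J[of i k] N[of i] N[of k] show "dist (J i) (J k) < e" by linarith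
    qed
  qed
  then obtain y where y: "J \<longlonglongrightarrow> y"
    using Cauchy_convergent[OF \<open>Cauchy J\<close>] unfolding convergent_def by blast
  have "(\<lambda>i. \<integral>\<^sup>+x. ennreal (norm (f x - t i x)) \<partial>M) \<longlonglongrightarrow> 0"
    unfolding nn using tendsto_ennrealI[OF lim] by simp
  then have "has_strong_bochner_integral M f y"
    unfolding has_strong_bochner_integral_def using f bt y
    by (intro conjI exI[of _ t]) (auto simp: J_def[abs_def])
  then show thesis by (rule that)
qed

text \<open>The scalar errors are at most \<open>norm z\<close> times the vector errors, so the
  simple functions that approximate \<open>f\<close> also serve
  \<open>f x \<bullet> z\<close>.\<close>

lemma has_bochner_integral_inner:
  fixes f :: "'a \<Rightarrow> 'b::real_inner"
  assumes M: "complete_measure M" and f: "has_strong_bochner_integral M f y"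
  shows "has_bochner_integral M (\<lambda>x. f x \<bullet> z) (y \<bullet> z)"
proof -
  from f obtain s where sm: "strongly_measurable M f"
    and s: "\<And>i::nat. Bochner_Integration.simple_bochner_integrable M (s i)"
    and lim: "(\<lambda>i. \<integral>\<^sup>+x. ennreal (norm (f x - s i x)) \<partial>M) \<longlonglongrightarrow> 0"
    and y: "(\<lambda>i. Bochner_Integration.simple_bochner_integral M (s i)) \<longlonglongrightarrow> y"
    unfolding has_strong_bochner_integral_def by blast
  have ss: "strongly_measurable M (s i)" for i
    using s[of i] unfolding strongly_measurable_def
    by (intro exI[of _ "\<lambda>n. s i"]) (auto elim: simple_bochner_integrable.cases)
  have [measurable]: "(\<lambda>x. norm (f x - s i x)) \<in> borel_measurable M" for i
    by (rule strongly_measurable_norm_borel[OF M strongly_measurable_compose2[OF sm ss, where h = "(-)"]])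
       (rule tendsto_diff)
  have le: "(\<integral>\<^sup>+x. ennreal (norm (f x \<bullet> z - s i x \<bullet> z)) \<partial>M)
      \<le> ennreal (norm z) * (\<integral>\<^sup>+x. ennreal (norm (f x - s i x)) \<partial>M)" for i
  proof -
    have "(\<integral>\<^sup>+x. ennreal (norm (f x \<bullet> z - s i x \<bullet> z)) \<partial>M)
        \<le> (\<integral>\<^sup>+x. ennreal (norm z) * ennreal (norm (f x - s i x)) \<partial>M)"
    proof (rule nn_integral_mono)
      fix x
      have "norm (f x \<bullet> z - s i x \<bullet> z) \<le> norm z * norm (f x - s i x)"
        using Cauchy_Schwarz_ineq2[of "f x - s i x" z] by (simp add: inner_diff_left mult.commute)
      then show "ennreal (norm (f x \<bullet> z - s i x \<bullet> z)) \<le> ennreal (norm z) * ennreal (norm (f x - s i x))"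
        by (simp add: ennreal_leI flip: ennreal_mult)
    qed
    also have "\<dots> = ennreal (norm z) * (\<integral>\<^sup>+x. ennreal (norm (f x - s i x)) \<partial>M)"
      by (rule nn_integral_cmult) measurable
    finally show ?thesis .
  qed
  have "(\<lambda>i. ennreal (norm z) * (\<integral>\<^sup>+x. ennreal (norm (f x - s i x)) \<partial>M)) \<longlonglongrightarrow> ennreal (norm z) * 0"
    by (rule tendsto_mult_ennreal[OF tendsto_const lim]) auto
  then have lim0: "(\<lambda>i. ennreal (norm z) * (\<integral>\<^sup>+x. ennreal (norm (f x - s i x)) \<partial>M)) \<longlonglongrightarrow> 0"
    by simp
  have lim': "(\<lambda>i. \<integral>\<^sup>+x. ennreal (norm (f x \<bullet> z - s i x \<bullet> z)) \<partial>M) \<longlonglongrightarrow> 0"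
    by (rule tendsto_sandwich[OF always_eventually always_eventually tendsto_const lim0])
       (simp, use le in blast)
  have lin: "linear (\<lambda>x. x \<bullet> z)"
    by (rule bounded_linear.linear) (rule bounded_linear_inner_left)
  have b: "Bochner_Integration.simple_bochner_integrable M (\<lambda>x. s i x \<bullet> z)" for i
    by (rule simple_bochner_integrable_compose2[where p = "\<lambda>x y. x \<bullet> z", OF _ s s]) simp
  have "(\<lambda>i. Bochner_Integration.simple_bochner_integral M (s i) \<bullet> z) \<longlonglongrightarrow> y \<bullet> z"
    using y by (intro tendsto_intros)
  then have y': "(\<lambda>i. Bochner_Integration.simple_bochner_integral M (\<lambda>x. s i x \<bullet> z)) \<longlonglongrightarrow> y \<bullet> z"
    unfolding simple_bochner_integral_linear[OF lin s] .
  have "strongly_measurable M (\<lambda>x. f x \<bullet> z)"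
    by (rule strongly_measurable_compose[OF sm, where h = "\<lambda>x. x \<bullet> z"]) (intro tendsto_intros)
  then have "(\<lambda>x. f x \<bullet> z) \<in> borel_measurable M"
    using strongly_measurable_iff_borel_measurable[OF M] by blast
  then show ?thesis using b lim' y' by (rule has_bochner_integral.intros)
qed

text \<open>A limit of limits of simple functions is reduced to a single limit in mean: each
  \<open>f n\<close> has a simple function within \<open>(1/2) ^ n\<close> of it in mean. The errors
  then tend to 0 almost everywhere along a subsequence, and there the simple functions inherit the
  limit of \<open>f n\<close>.\<close>

lemma strongly_measurable_AE_lim:
  fixes f :: "nat \<Rightarrow> 'a \<Rightarrow> 'b::{real_normed_vector, complete_space}"
  assumes M: "complete_measure M" "finite_measure M"
    and f: "\<And>n. strongly_measurable M (f n)"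
    and \<phi>: "integrable M \<phi>" "\<And>n x. x \<in> space M \<Longrightarrow> norm (f n x) \<le> \<phi> x"
    and lim: "AE x in M. (\<lambda>n. f n x) \<longlonglongrightarrow> g x"
  shows "strongly_measurable M g"
proof -
  interpret complete_measure M by fact
  have "\<exists>s. simple_function M s \<and> integrable M (\<lambda>x. norm (f n x - s x)) \<and>
      (\<integral>x. norm (f n x - s x) \<partial>M) \<le> (1/2) ^ n" for n
  proof -
    obtain y where "has_strong_bochner_integral M (f n) y"
      by (rule has_strong_bochner_integral_dominated[OF M f \<phi>])
    then obtain s where s: "\<And>i::nat. Bochner_Integration.simple_bochner_integrable M (s i)"
      and lim: "(\<lambda>i. \<integral>\<^sup>+x. ennreal (norm (f n x - s i x)) \<partial>M) \<longlonglongrightarrow> 0"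
      unfolding has_strong_bochner_integral_def by blast
    have "\<forall>\<^sub>F i in sequentially. (\<integral>\<^sup>+x. ennreal (norm (f n x - s i x)) \<partial>M) < ennreal ((1/2) ^ n)"
      using lim by (rule order_tendstoD) simp
    then obtain i where i: "(\<integral>\<^sup>+x. ennreal (norm (f n x - s i x)) \<partial>M) < ennreal ((1/2) ^ n)"
      by (auto simp: eventually_sequentially)
    have si: "simple_function M (s i)" using s[of i] by (auto elim: simple_bochner_integrable.cases)
    then have ss: "strongly_measurable M (s i)"
      unfolding strongly_measurable_def by (intro exI[of _ "\<lambda>n. s i"]) auto
    have m: "(\<lambda>x. norm (f n x - s i x)) \<in> borel_measurable M"
      by (rule strongly_measurable_norm_borel[OF M(1) strongly_measurable_compose2[OF f ss, where h = "(-)"]])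
         (rule tendsto_diff)
    have int: "integrable M (\<lambda>x. norm (f n x - s i x))"
      by (rule integrableI_nonneg[OF m AE_I2 less_trans[OF i]]) simp_all
    then have "ennreal (\<integral>x. norm (f n x - s i x) \<partial>M) < ennreal ((1/2) ^ n)"
      using i by (subst nn_integral_eq_integral[symmetric]) auto
    then have "(\<integral>x. norm (f n x - s i x) \<partial>M) \<le> (1/2) ^ n"
      by (simp add: ennreal_less_iff)
    then show ?thesis using si int by blast
  qed
  then obtain s where s: "\<And>n. simple_function M (s n)"
      "\<And>n. integrable M (\<lambda>x. norm (f n x - s n x))"
      "\<And>n. (\<integral>x. norm (f n x - s n x) \<partial>M) \<le> (1/2) ^ n"
    using choice[of "\<lambda>n s. simple_function M s \<and> integrable M (\<lambda>x. norm (f n x - s x)) \<and>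
      (\<integral>x. norm (f n x - s x) \<partial>M) \<le> (1/2) ^ n"] by blast
  have "(\<lambda>n. \<integral>x. norm (norm (f n x - s n x)) \<partial>M) \<longlonglongrightarrow> 0"
    by (rule tendsto_sandwich[OF always_eventually always_eventually tendsto_const
          LIMSEQ_power_zero[of "1/2::real"]]) (simp_all add: s(3))
  then obtain r :: "nat \<Rightarrow> nat" where r: "strict_mono r"
    "AE x in M. (\<lambda>n. norm (f (r n) x - s (r n) x)) \<longlonglongrightarrow> 0"
    using tendsto_L1_AE_subseq[of M "\<lambda>n x. norm (f n x - s n x)", OF s(2)] by blast
  have "AE x in M. (\<lambda>n. s (r n) x) \<longlonglongrightarrow> g x"
    using r(2) lim
  proof eventually_elim
    case (elim x)
    have "(\<lambda>n. f (r n) x) \<longlonglongrightarrow> g x"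
      using LIMSEQ_subseq_LIMSEQ[OF elim(2) r(1)] by (simp add: o_def)
    then have "(\<lambda>n. f (r n) x - (f (r n) x - s (r n) x)) \<longlonglongrightarrow> g x - 0"
      using elim(1) by (intro tendsto_diff) (simp_all add: tendsto_norm_zero_iff)
    then show ?case by simp
  qed
  then show ?thesis unfolding strongly_measurable_def
    using s(1) by (intro exI[of _ "\<lambda>n. s (r n)"]) auto
qed

section \<open>Weak integrals and Lebesgue differentiation\<close>

lemma AE_lebesgue_on_iff_negligible:
  assumes "S \<in> sets lebesgue"
  shows "(AE x in lebesgue_on S. P x) \<longleftrightarrow> negligible {x \<in> S. \<not> P x}"
proof -
  interpret complete_measure "lebesgue_on S" using assms by (rule complete_measure_lebesgue_on)
  have "(AE x in lebesgue_on S. P x) \<longleftrightarrow> {x \<in> S. \<not> P x} \<in> null_sets (lebesgue_on S)"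
    using AE_iff_null_sets[of P] by simp
  also have "\<dots> \<longleftrightarrow> {x \<in> S. \<not> P x} \<in> null_sets lebesgue"
    using assms by (auto simp: null_sets_restrict_space)
  finally show ?thesis by (simp add: negligible_iff_null_sets)
qed

lemma integrable_lebesgue_on_nonneg:
  fixes \<phi> :: "real \<Rightarrow> real"
  assumes "\<phi> integrable_on S" "\<And>x. x \<in> S \<Longrightarrow> 0 \<le> \<phi> x" "S \<in> sets lebesgue"
  shows "integrable (lebesgue_on S) \<phi>"
  using nonnegative_absolutely_integrable_1[OF assms(1,2)] assms(3)
  by (simp add: integrable_restrict_space set_integrable_def)

text \<open>An integral of Pettis type. Uniqueness, linearity and additivity over adjacent intervals
  are inherited from the scalar integral for each \<open>z\<close>.\<close>

definition has_weak_integral :: "(real \<Rightarrow> 'b::real_inner) \<Rightarrow> 'b \<Rightarrow> real \<Rightarrow> real \<Rightarrow> bool" where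
  "has_weak_integral f y a b \<longleftrightarrow> (\<forall>z. ((\<lambda>s. f s \<bullet> z) has_integral y \<bullet> z) {a..b})"

lemma has_weak_integralD:
  "has_weak_integral f y a b \<Longrightarrow> ((\<lambda>s. f s \<bullet> z) has_integral y \<bullet> z) {a..b}"
  by (simp add: has_weak_integral_def)

lemma has_weak_integral_strong:
  assumes "has_strong_bochner_integral (lebesgue_on {a..b}) f y"
  shows "has_weak_integral f y a b"
  unfolding has_weak_integral_def
proof
  fix z
  have "has_bochner_integral (lebesgue_on {a..b}) (\<lambda>x. f x \<bullet> z) (y \<bullet> z)"
    by (rule has_bochner_integral_inner[OF complete_measure_lebesgue_on assms]) simp
  then have "integrable (lebesgue_on {a..b}) (\<lambda>x. f x \<bullet> z)"
    "integral\<^sup>L (lebesgue_on {a..b}) (\<lambda>x. f x \<bullet> z) = y \<bullet> z"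
    by (simp_all add: has_bochner_integral_iff)
  then show "((\<lambda>x. f x \<bullet> z) has_integral y \<bullet> z) {a..b}"
    using has_integral_integral_lebesgue_on[of "{a..b}" "\<lambda>x. f x \<bullet> z"] by simp
qed

lemma has_weak_integral_unique:
  assumes "has_weak_integral f y a b" "has_weak_integral f y' a b"
  shows "y = y'"
proof -
  have "y \<bullet> z = y' \<bullet> z" for z
    using has_weak_integralD[OF assms(1), of z] has_weak_integralD[OF assms(2), of z]
    by (rule has_integral_unique)
  then show ?thesis by (metis inner_diff_left inner_eq_zero_iff right_minus_eq)
qed

lemma has_weak_integral_diff:
  assumes "has_weak_integral f y a b" "has_weak_integral g y' a b"
  shows "has_weak_integral (\<lambda>s. f s - g s) (y - y') a b"
  using has_integral_diff[OF has_weak_integralD[OF assms(1)] has_weak_integralD[OF assms(2)]]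
  by (simp add: has_weak_integral_def inner_diff_left)

lemma has_weak_integral_const:
  assumes "a \<le> b"
  shows "has_weak_integral (\<lambda>s. q) ((b - a) *\<^sub>R q) a b"
  using assms has_integral_const_real[of "q \<bullet> _" a b] by (simp add: has_weak_integral_def)

lemma has_weak_integral_refl: "has_weak_integral f 0 a a"
  by (simp add: has_weak_integral_def has_integral_refl)

lemma has_weak_integral_combine:
  assumes "a \<le> c" "c \<le> b" "has_weak_integral f y a c" "has_weak_integral f y' c b"
  shows "has_weak_integral f (y + y') a b"
  using has_integral_combine[OF assms(1,2) has_weak_integralD[OF assms(3)] has_weak_integralD[OF assms(4)]]
  by (simp add: has_weak_integral_def inner_add_left)

text \<open>Testing with \<open>z = y\<close> turns the norm of the integral into a real integral,
  with one factor \<open>norm y\<close> to cancel.\<close>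

lemma has_weak_integral_norm_le:
  assumes f: "has_weak_integral f y a b" and \<phi>: "\<phi> integrable_on {a..b}"
    and le: "\<And>s. s \<in> {a..b} \<Longrightarrow> norm (f s) \<le> \<phi> s"
  shows "norm y \<le> integral {a..b} \<phi>"
proof (cases "y = 0")
  case True
  have "0 \<le> integral {a..b} \<phi>"
    by (rule integral_nonneg[OF \<phi>]) (use le norm_ge_zero order_trans in blast)
  then show ?thesis using True by simp
next
  case False
  have "y \<bullet> y \<le> integral {a..b} \<phi> * norm y"
  proof (rule has_integral_le[OF has_weak_integralD[OF f, of y]])
    show "((\<lambda>s. \<phi> s * norm y) has_integral integral {a..b} \<phi> * norm y) {a..b}"
      by (rule has_integral_mult_left) (use \<phi> in \<open>simp add: integrable_integral\<close>)
    show "f s \<bullet> y \<le> \<phi> s * norm y" if "s \<in> {a..b}" for s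
      using norm_cauchy_schwarz[of "f s" y] mult_right_mono[OF le[OF that], of "norm y"] by simp
  qed
  then have "norm y * norm y \<le> integral {a..b} \<phi> * norm y"
    by (simp add: dot_square_norm power2_eq_square)
  then show ?thesis using False by simp
qed

lemma has_weak_integral_increment:
  assumes "\<And>t. 0 \<le> t \<Longrightarrow> t \<le> T \<Longrightarrow> has_weak_integral v (U t - U 0) 0 t"
    and st: "0 \<le> s" "s \<le> t" "t \<le> T"
  shows "has_weak_integral v (U t - U s) s t"
  unfolding has_weak_integral_def
proof
  fix z
  have t: "((\<lambda>x. v x \<bullet> z) has_integral (U t - U 0) \<bullet> z) {0..t}"
    and s: "((\<lambda>x. v x \<bullet> z) has_integral (U s - U 0) \<bullet> z) {0..s}"
    using st by (auto intro!: has_weak_integralD assms(1))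
  have "(\<lambda>x. v x \<bullet> z) integrable_on {s..t}"
    by (rule integrable_subinterval_real[OF has_integral_integrable[OF t]]) (use st in auto)
  then have "((\<lambda>x. v x \<bullet> z) has_integral integral {s..t} (\<lambda>x. v x \<bullet> z)) {s..t}"
    by (rule integrable_integral)
  moreover have "integral {s..t} (\<lambda>x. v x \<bullet> z) = (U t - U s) \<bullet> z"
    using Henstock_Kurzweil_Integration.integral_combine[OF st(1,2) has_integral_integrable[OF t]]
      integral_unique[OF s] integral_unique[OF t]
    by (simp add: inner_diff_left)
  ultimately show "((\<lambda>x. v x \<bullet> z) has_integral (U t - U s) \<bullet> z) {s..t}" by simp
qed

lemma strong_bochner_integral_exists:
  fixes f :: "real \<Rightarrow> 'b::{real_inner, complete_space}"
  assumes f: "strongly_measurable (lebesgue_on {a..b}) f" and \<phi>: "\<phi> integrable_on {a..b}"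
    and le: "\<And>s. s \<in> {a..b} \<Longrightarrow> norm (f s) \<le> \<phi> s"
  obtains y where "has_strong_bochner_integral (lebesgue_on {a..b}) f y" "has_weak_integral f y a b"
proof -
  have "integrable (lebesgue_on {a..b}) \<phi>"
    by (rule integrable_lebesgue_on_nonneg[OF \<phi>]) (use le norm_ge_zero order_trans in \<open>blast, simp\<close>)
  then obtain y where "has_strong_bochner_integral (lebesgue_on {a..b}) f y"
    by (rule has_strong_bochner_integral_dominated[OF complete_measure_lebesgue_on
          finite_measure_lebesgue_on f, rotated 2]) (use le in auto)
  then show thesis using has_weak_integral_strong that by blast
qed

text \<open>\<open>integrable_ccontinuous_explicit\<close> gives averages over intervals that start
  at the point. Applied to the reflected function it gives averages over intervals that end there,
  whence the exceptional set \<open>N1 \<union> uminus\<close> followed by the image of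
  \<open>N2\<close>.\<close>

lemma Lebesgue_differentiation_real:
  fixes h :: "real \<Rightarrow> real"
  assumes h: "h integrable_on {0..T}"
  obtains N where "negligible N"
    "\<And>t e. t \<in> {0..T} - N \<Longrightarrow> 0 < e \<Longrightarrow> \<exists>d>0. \<forall>s\<in>{0..T}. \<bar>s - t\<bar> < d \<longrightarrow>
      \<bar>integral {0..s} h - integral {0..t} h - (s - t) * h t\<bar> \<le> e * \<bar>s - t\<bar>"
proof -
  define g where "g x = (if x \<in> {0..T} then h x else 0)" for x
  have gU: "g integrable_on UNIV"
    unfolding g_def[abs_def] using h by (simp only: integrable_restrict_UNIV)
  then have g: "g integrable_on {a..b}" for a b
    using integrable_on_subinterval by blast
  have g': "(\<lambda>x. g (- x)) integrable_on {a..b}" for a b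
    using g[of "-b" "-a"] Henstock_Kurzweil_Integration.integrable_reflect_real[where f = g and a = "-b" and b = "-a"] by simp
  obtain N1 where N1: "negligible N1" "\<And>x e. x \<notin> N1 \<Longrightarrow> 0 < e \<Longrightarrow>
      \<exists>d>0. \<forall>k. 0 < k \<and> k < d \<longrightarrow> norm (integral (cbox x (x + k *\<^sub>R One)) g /\<^sub>R k ^ DIM(real) - g x) < e"
    using integrable_ccontinuous_explicit[of g] g by (auto simp: cbox_interval)
  obtain N2 where N2: "negligible N2" "\<And>x e. x \<notin> N2 \<Longrightarrow> 0 < e \<Longrightarrow>
      \<exists>d>0. \<forall>k. 0 < k \<and> k < d \<longrightarrow> norm (integral (cbox x (x + k *\<^sub>R One)) (\<lambda>x. g (- x)) /\<^sub>R k ^ DIM(real) - g (- x)) < e"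
    using integrable_ccontinuous_explicit[of "\<lambda>x. g (- x)"] g' by (auto simp: cbox_interval)
  have hg: "integral {a..b} h = integral {a..b} g" if "0 \<le> a" "b \<le> T" for a b
    by (rule Henstock_Kurzweil_Integration.integral_cong) (use that in \<open>auto simp: g_def\<close>)
  have comb: "integral {0..b} h - integral {0..a} h = integral {a..b} g" if "0 \<le> a" "a \<le> b" "b \<le> T" for a b
  proof -
    have "integral {0..a} h + integral {a..b} h = integral {0..b} h"
      by (rule Henstock_Kurzweil_Integration.integral_combine)
         (use that h in \<open>auto intro: integrable_subinterval_real\<close>)
    then show ?thesis using hg[of a b] that by simp
  qed
  show thesis
  proof (rule that)
    show "negligible (N1 \<union> uminus ` N2)"
      using N1(1) N2(1) by (intro negligible_Un negligible_differentiable_image_negligible)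
        (auto intro!: differentiable_on_minus differentiable_on_id)
    fix t e :: real assume t: "t \<in> {0..T} - (N1 \<union> uminus ` N2)" and e: "0 < e"
    then have t1: "t \<notin> N1" and t2: "- t \<notin> N2"
      by (auto simp: image_iff)
    obtain d1 where d1: "d1 > 0" "\<And>k. 0 < k \<Longrightarrow> k < d1 \<Longrightarrow> \<bar>integral {t..t + k} g / k - g t\<bar> < e"
      using N1(2)[OF t1 e] by (auto simp: cbox_interval divide_inverse mult.commute)
    obtain d2 where d2: "d2 > 0"
        "\<And>k. 0 < k \<Longrightarrow> k < d2 \<Longrightarrow> \<bar>integral {- t..- t + k} (\<lambda>x. g (- x)) / k - g t\<bar> < e"
      using N2(2)[OF t2 e] by (auto simp: cbox_interval divide_inverse mult.commute)
    have gt: "g t = h t" using t by (simp add: g_def)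
    have scale: "\<bar>I - k * c\<bar> \<le> e * k" if "\<bar>I / k - c\<bar> < e" "0 < k" for I k c :: real
    proof -
      have "I - k * c = (I / k - c) * k" using that by (simp add: field_simps)
      then show ?thesis using that by (simp add: abs_mult mult_right_mono)
    qed
    show "\<exists>d>0. \<forall>s\<in>{0..T}. \<bar>s - t\<bar> < d \<longrightarrow>
        \<bar>integral {0..s} h - integral {0..t} h - (s - t) * h t\<bar> \<le> e * \<bar>s - t\<bar>"
    proof (intro exI[of _ "min d1 d2"] conjI ballI impI)
      fix s assume s: "s \<in> {0..T}" "\<bar>s - t\<bar> < min d1 d2"
      consider "s = t" | "t < s" | "s < t" by linarith
      then show "\<bar>integral {0..s} h - integral {0..t} h - (s - t) * h t\<bar> \<le> e * \<bar>s - t\<bar>"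
      proof cases
        case 2
        have "\<bar>integral {t..s} g - (s - t) * g t\<bar> \<le> e * (s - t)"
          using d1(2)[of "s - t"] 2 s by (intro scale) auto
        then show ?thesis using comb[of t s] 2 s t gt by auto
      next
        case 3
        have "integral {- t..- s} (\<lambda>x. g (- x)) = integral {s..t} g"
          by (rule Henstock_Kurzweil_Integration.integral_reflect_real)
        then have "\<bar>integral {s..t} g - (t - s) * g t\<bar> \<le> e * (t - s)"
          using d2(2)[of "t - s"] 3 s by (intro scale) auto
        then show ?thesis using comb[of s t] 3 s t gt by (auto simp: algebra_simps abs_if split: if_splits)
      qed simp
    qed (use d1(1) d2(1) in auto)
  qed
qed

text \<open>A point is good if it is a Lebesgue point of \<open>\<lambda>s. norm (v s - q)\<close> for the countably many
  values \<open>q\<close> of the simple functions approximating \<open>v\<close>.\<close>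

lemma Lebesgue_differentiation:
  fixes v U :: "real \<Rightarrow> 'b::{real_inner, complete_space}"
  assumes v: "strongly_measurable (lebesgue_on {0..T}) v" and \<phi>: "\<phi> integrable_on {0..T}"
    and le: "\<And>t. t \<in> {0..T} \<Longrightarrow> norm (v t) \<le> \<phi> t"
    and U: "\<And>s t. 0 \<le> s \<Longrightarrow> s \<le> t \<Longrightarrow> t \<le> T \<Longrightarrow> has_weak_integral v (U t - U s) s t"
  shows "AE t in lebesgue_on {0..T}. (U has_vector_derivative v t) (at t within {0..T})"
proof -
  let ?M = "lebesgue_on {0..T}"
  have M: "complete_measure ?M" by (rule complete_measure_lebesgue_on) simp
  obtain s where s: "\<And>i::nat. simple_function ?M (s i)" "AE x in ?M. (\<lambda>i. s i x) \<longlonglongrightarrow> v x"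
    by (rule strongly_measurableE[OF v]) (rule that)
  define Q where "Q = (\<Union>i. s i ` {0..T})"
  have "countable Q"
    unfolding Q_def
  proof (rule countable_UN)
    show "countable (s i ` {0..T})" for i
      using s(1)[of i] by (auto simp: simple_function_def intro: countable_finite)
  qed simp
  define h where "h q t = norm (v t - q)" for q t
  have h: "h q integrable_on {0..T}" for q
  proof -
    have "strongly_measurable ?M (\<lambda>t. v t - q)"
      using strongly_measurable_compose2[OF v strongly_measurable_const, where h = "(-)"]
      by (auto intro: tendsto_diff)
    then have "h q \<in> borel_measurable ?M"
      unfolding h_def[abs_def] by (rule strongly_measurable_norm_borel[OF M])
    moreover have "(\<lambda>t. \<phi> t + norm q) integrable_on {0..T}"
      using \<phi> by (intro integrable_add integrable_const_ivl)
    moreover have "norm (h q t) \<le> \<phi> t + norm q" if "t \<in> {0..T}" for t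
      using le[OF that] norm_triangle_ineq4[of "v t" q] by (simp add: h_def)
    ultimately show ?thesis
      by (rule measurable_bounded_by_integrable_imp_integrable) auto
  qed
  have "\<forall>q. \<exists>N. negligible N \<and> (\<forall>t e. t \<in> {0..T} - N \<longrightarrow> 0 < e \<longrightarrow> (\<exists>d>0. \<forall>s\<in>{0..T}. \<bar>s - t\<bar> < d \<longrightarrow>
      \<bar>integral {0..s} (h q) - integral {0..t} (h q) - (s - t) * h q t\<bar> \<le> e * \<bar>s - t\<bar>))"
    using Lebesgue_differentiation_real[OF h] by metis
  from choice[OF this] obtain N where N: "\<And>q. negligible (N q)"
    "\<And>q t e. t \<in> {0..T} - N q \<Longrightarrow> 0 < e \<Longrightarrow> \<exists>d>0. \<forall>s\<in>{0..T}. \<bar>s - t\<bar> < d \<longrightarrow>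
      \<bar>integral {0..s} (h q) - integral {0..t} (h q) - (s - t) * h q t\<bar> \<le> e * \<bar>s - t\<bar>"
    by blast
  have "negligible (\<Union>q\<in>Q. N q)"
    using \<open>countable Q\<close> N(1) by (intro negligible_countable_Union) auto
  then have "AE t in ?M. t \<notin> (\<Union>q\<in>Q. N q)"
    by (subst AE_lebesgue_on_iff_negligible) (auto intro: negligible_subset)
  then show ?thesis using s(2) AE_space
  proof eventually_elim
    case (elim t)
    then have t: "t \<in> {0..T}" by simp
    show ?case
      unfolding has_vector_derivative_def has_derivative_within_alt
    proof (intro conjI allI impI)
      show "bounded_linear (\<lambda>x. x *\<^sub>R v t)" by (rule bounded_linear_scaleR_left)
      fix e :: real assume e: "e > 0"
      have "\<forall>\<^sub>F i in sequentially. dist (s i t) (v t) < e / 3"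
        using elim(2) e by (intro tendstoD) auto
      then obtain i where i: "dist (s i t) (v t) < e / 3"
        by (auto simp: eventually_sequentially)
      define q where "q = s i t"
      have "q \<in> Q" unfolding Q_def q_def using t by blast
      \<comment> \<open>The three thirds of \<open>e\<close>: the value \<open>h q t\<close>, the
        Lebesgue point error at \<open>t\<close>, and the replacement of \<open>q\<close> by
        \<open>v t\<close>.\<close>
      have hq: "h q t < e / 3" using i by (simp add: h_def q_def dist_norm norm_minus_commute)
      obtain d where d: "d > 0" "\<And>r. r \<in> {0..T} \<Longrightarrow> \<bar>r - t\<bar> < d \<Longrightarrow>
          \<bar>integral {0..r} (h q) - integral {0..t} (h q) - (r - t) * h q t\<bar> \<le> e / 3 * \<bar>r - t\<bar>"
        using N(2)[of t q "e / 3"] elim(1) \<open>q \<in> Q\<close> t e by auto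
      have key: "norm (U b - U a - (b - a) *\<^sub>R q) \<le> integral {0..b} (h q) - integral {0..a} (h q)"
        if "0 \<le> a" "a \<le> b" "b \<le> T" for a b
      proof -
        have hab: "h q integrable_on {a..b}"
          using integrable_subinterval_real[OF h] that by auto
        have "norm (U b - U a - (b - a) *\<^sub>R q) \<le> integral {a..b} (h q)"
          by (rule has_weak_integral_norm_le[OF has_weak_integral_diff[OF U has_weak_integral_const] hab])
            (use that in \<open>auto simp: h_def\<close>)
        also have "integral {0..a} (h q) + integral {a..b} (h q) = integral {0..b} (h q)"
          by (rule Henstock_Kurzweil_Integration.integral_combine)
            (use that in \<open>auto intro: integrable_subinterval_real[OF h]\<close>)
        then have "integral {a..b} (h q) = integral {0..b} (h q) - integral {0..a} (h q)" by simp
        finally show ?thesis .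
      qed
      show "\<exists>d>0. \<forall>y\<in>{0..T}. norm (y - t) < d \<longrightarrow>
          norm (U y - U t - (y - t) *\<^sub>R v t) \<le> e * norm (y - t)"
      proof (intro exI[of _ d] conjI ballI impI d(1))
        fix r assume r: "r \<in> {0..T}" "norm (r - t) < d"
        have "norm (U r - U t - (r - t) *\<^sub>R q) \<le> \<bar>integral {0..r} (h q) - integral {0..t} (h q)\<bar>"
        proof (cases "t \<le> r")
          case True
          then show ?thesis using key[of t r] t r by auto
        next
          case False
          have "U r - U t - (r - t) *\<^sub>R q = - (U t - U r - (t - r) *\<^sub>R q)"
            by (simp add: algebra_simps)
          then have "norm (U r - U t - (r - t) *\<^sub>R q) = norm (U t - U r - (t - r) *\<^sub>R q)"
            by (simp only: norm_minus_cancel)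
          then show ?thesis using key[of r t] t r False by auto
        qed
        also have "\<dots> \<le> \<bar>(r - t) * h q t\<bar> + e / 3 * \<bar>r - t\<bar>"
          using d(2)[OF r(1)] r(2) unfolding real_norm_def by linarith
        also have "\<bar>(r - t) * h q t\<bar> \<le> e / 3 * \<bar>r - t\<bar>"
          using mult_left_mono[of "h q t" "e / 3" "\<bar>r - t\<bar>"] hq
          by (simp add: abs_mult h_def mult.commute)
        finally have 1: "norm (U r - U t - (r - t) *\<^sub>R q) \<le> e / 3 * \<bar>r - t\<bar> + e / 3 * \<bar>r - t\<bar>" by simp
        have "norm ((r - t) *\<^sub>R (q - v t)) = \<bar>r - t\<bar> * h q t"
          by (simp add: h_def norm_minus_commute)
        also have "\<dots> \<le> e / 3 * \<bar>r - t\<bar>"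
          using mult_left_mono[of "h q t" "e / 3" "\<bar>r - t\<bar>"] hq by (simp add: mult.commute)
        finally have 2: "norm ((r - t) *\<^sub>R (q - v t)) \<le> e / 3 * \<bar>r - t\<bar>" .
        have "U r - U t - (r - t) *\<^sub>R v t = (U r - U t - (r - t) *\<^sub>R q) + (r - t) *\<^sub>R (q - v t)"
          by (simp add: algebra_simps)
        then have "norm (U r - U t - (r - t) *\<^sub>R v t)
            \<le> norm (U r - U t - (r - t) *\<^sub>R q) + norm ((r - t) *\<^sub>R (q - v t))"
          by (metis norm_triangle_ineq)
        also have "\<dots> \<le> e * \<bar>r - t\<bar>" using 1 2 by (simp add: field_simps)
        finally show "norm (U r - U t - (r - t) *\<^sub>R v t) \<le> e * norm (r - t)" by simp
      qed
    qed
  qed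
qed

section \<open>The Radon--Nikodym property\<close>

definition dyad :: "real \<Rightarrow> nat \<Rightarrow> nat \<Rightarrow> real" where
  "dyad T n i = T * real i / 2 ^ n"

text \<open>Cells are half-open, so \<open>cell T n T\<close> is \<open>2 ^ n\<close>, one past the
  last cell. This is why \<open>t = T\<close> is often treated apart.\<close>

definition cell :: "real \<Rightarrow> nat \<Rightarrow> real \<Rightarrow> nat" where
  "cell T n t = nat \<lfloor>t * 2 ^ n / T\<rfloor>"

lemma dyad_0 [simp]: "dyad T n 0 = 0"
  by (simp add: dyad_def)

lemma dyad_top [simp]: "dyad T n (2 ^ n) = T"
  by (simp add: dyad_def)

text \<open>Nestedness of the meshes. The martingale identity \<open>q_cross\<close> and the
  comparison of two discrete solutions in \<open>P_compare\<close> both rest on it.\<close>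

lemma dyad_refine: "dyad T (n + k) (i * 2 ^ k) = dyad T n i"
  by (simp add: dyad_def power_add)

lemma dyad_Suc: "dyad T n (Suc i) = dyad T n i + T / 2 ^ n"
  by (simp add: dyad_def field_simps)

lemma dyad_mono: "0 < T \<Longrightarrow> i \<le> j \<Longrightarrow> dyad T n i \<le> dyad T n j"
  by (simp add: dyad_def divide_right_mono)

lemma dyad_less_Suc: "0 < T \<Longrightarrow> dyad T n i < dyad T n (Suc i)"
  by (simp add: dyad_Suc)

lemma dyad_nonneg: "0 < T \<Longrightarrow> 0 \<le> dyad T n i"
  by (simp add: dyad_def)

lemma dyad_le: "0 < T \<Longrightarrow> i \<le> 2 ^ n \<Longrightarrow> dyad T n i \<le> T"
  using dyad_mono[of T i "2 ^ n" n] by simp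

lemma cell_eqI:
  assumes T: "0 < T" and "dyad T n i \<le> t" "t < dyad T n (Suc i)"
  shows "cell T n t = i"
proof -
  have "real i \<le> t * 2 ^ n / T" "t * 2 ^ n / T < real i + 1"
    using assms by (auto simp: dyad_def field_simps)
  then have "\<lfloor>t * 2 ^ n / T\<rfloor> = int i" by (intro floor_unique) auto
  then show ?thesis by (simp add: cell_def)
qed

lemma cell_bounds:
  assumes T: "0 < T" and "0 \<le> t"
  shows "dyad T n (cell T n t) \<le> t" "t < dyad T n (Suc (cell T n t))"
proof -
  have "0 \<le> t * 2 ^ n / T" using assms by simp
  then have "real (cell T n t) = of_int \<lfloor>t * 2 ^ n / T\<rfloor>" by (simp add: cell_def)
  then have "real (cell T n t) \<le> t * 2 ^ n / T" "t * 2 ^ n / T < real (cell T n t) + 1"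
    by linarith+
  then show "dyad T n (cell T n t) \<le> t" "t < dyad T n (Suc (cell T n t))"
    using T by (auto simp: dyad_def field_simps)
qed

lemma cell_dyad: "0 < T \<Longrightarrow> cell T n (dyad T n i) = i"
  by (intro cell_eqI) (auto simp: dyad_less_Suc)

lemma dyad_less_cancel: "0 < T \<Longrightarrow> dyad T n i < dyad T n j \<longleftrightarrow> i < j"
  by (simp add: dyad_def divide_less_cancel)

lemma dyad_le_cancel: "0 < T \<Longrightarrow> dyad T n i \<le> dyad T n j \<longleftrightarrow> i \<le> j"
  by (simp add: dyad_def divide_le_cancel)

lemma cell_less:
  assumes "0 < T" "0 \<le> t" "t < T"
  shows "cell T n t < 2 ^ n"
proof -
  have "dyad T n (cell T n t) < dyad T n (2 ^ n)"
    using cell_bounds(1)[OF assms(1,2), of n] assms(3) by simp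
  then show ?thesis using dyad_less_cancel[OF assms(1)] by blast
qed

lemma cell_le:
  assumes "0 < T" "0 \<le> t" "t \<le> T"
  shows "cell T n t \<le> 2 ^ n"
proof -
  have "dyad T n (cell T n t) \<le> dyad T n (2 ^ n)"
    using cell_bounds(1)[OF assms(1,2), of n] assms(3) by simp
  then show ?thesis using dyad_le_cancel[OF assms(1)] by blast
qed

lemma cell_mono: "0 < T \<Longrightarrow> s \<le> t \<Longrightarrow> cell T n s \<le> cell T n t"
  unfolding cell_def by (intro nat_mono floor_mono) (simp add: divide_right_mono)

lemma dyad_cell_tendsto:
  assumes "0 < T" "0 \<le> t"
  shows "(\<lambda>n. dyad T n (cell T n t)) \<longlonglongrightarrow> t"
proof (rule tendsto_sandwich[OF always_eventually always_eventually _ tendsto_const])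
  have "(\<lambda>n. t - T * (1/2) ^ n) \<longlonglongrightarrow> t - T * 0"
    by (intro tendsto_intros LIMSEQ_power_zero) simp
  then show "(\<lambda>n. t - T * (1/2) ^ n) \<longlonglongrightarrow> t" by simp
  show "\<forall>n. t - T * (1/2) ^ n \<le> dyad T n (cell T n t)"
  proof
    fix n
    show "t - T * (1/2) ^ n \<le> dyad T n (cell T n t)"
      using cell_bounds(2)[OF assms, of n] by (simp add: dyad_Suc power_divide)
  qed
qed (use cell_bounds(1)[OF assms] in auto)

lemma simple_function_cell:
  assumes "0 < T"
  shows "simple_function (lebesgue_on {0..T}) (cell T n)"
proof -
  have "cell T n \<in> measurable borel (count_space UNIV)"
    unfolding cell_def[abs_def] by measurable
  then have m: "cell T n \<in> measurable (lebesgue_on {0..T}) (count_space UNIV)"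
    by (intro measurable_restrict_space1 measurable_completion) simp
  have "cell T n ` {0..T} \<subseteq> {..2 ^ n}" using cell_le[OF assms] by auto
  then have "finite (cell T n ` {0..T})" by (rule finite_subset) simp
  moreover have "cell T n -` {x} \<inter> {0..T} \<in> sets (lebesgue_on {0..T})" for x
    using measurable_sets[OF m, of "{x}"] by simp
  ultimately show ?thesis by (simp add: simple_function_def)
qed

lemma has_integral_dyad_sum:
  fixes h :: "real \<Rightarrow> real"
  assumes "0 < T" "\<And>i. i < N \<Longrightarrow> (h has_integral J i) {dyad T n i..dyad T n (Suc i)}"
  shows "(h has_integral (\<Sum>i<N. J i)) {0..dyad T n N}"
  using assms(2)
proof (induction N)
  case (Suc N)
  have "(h has_integral (\<Sum>i<N. J i) + J N) {0..dyad T n (Suc N)}"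
    by (rule has_integral_combine[of _ "dyad T n N"])
      (use Suc assms(1) in \<open>auto simp: dyad_nonneg dyad_mono\<close>)
  then show ?case by simp
qed (simp add: has_integral_refl)

lemma Cauchy_summable_dist:
  fixes x :: "nat \<Rightarrow> 'a::metric_space"
  assumes "summable (\<lambda>j. dist (x (Suc j)) (x j))"
  shows "Cauchy x"
proof (rule metric_CauchyI)
  fix e :: real assume e: "e > 0"
  have d: "dist (x n) (x m) \<le> (\<Sum>j=m..<n. dist (x (Suc j)) (x j))" if "m \<le> n" for m n
    using that
  proof (induction n rule: dec_induct)
    case (step n)
    then show ?case using dist_triangle[of "x (Suc n)" "x m" "x n"] by simp
  qed simp
  obtain N where N: "\<And>m n. m \<ge> N \<Longrightarrow> norm (\<Sum>j=m..<n. dist (x (Suc j)) (x j)) < e"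
    using assms e unfolding summable_Cauchy by blast
  have "dist (x n) (x m) < e" if "N \<le> m" "m \<le> n" for m n
    using d[OF that(2)] N[OF that(1), of n] by simp
  then show "\<exists>M. \<forall>m\<ge>M. \<forall>n\<ge>M. dist (x m) (x n) < e"
    by (metis dist_commute nat_le_linear)
qed

text \<open>The primitive \<open>V\<close> acts as a new clock. The lower bound 1 on the density
  makes its increments over cells positive, so that difference quotients with respect to
  \<open>V\<close> make sense.\<close>

locale weight =
  fixes T :: real and \<phi> :: "real \<Rightarrow> real"
  assumes T: "0 < T" and \<phi>: "\<phi> integrable_on {0..T}" and \<phi>1: "\<And>t. t \<in> {0..T} \<Longrightarrow> 1 \<le> \<phi> t"
begin

definition "V t = integral {0..t} \<phi>"

lemma V_0 [simp]: "V 0 = 0"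
  by (simp add: V_def)

lemma \<phi>_sub: "0 \<le> s \<Longrightarrow> t \<le> T \<Longrightarrow> \<phi> integrable_on {s..t}"
  using integrable_subinterval_real[OF \<phi>] by simp

lemma V_diff: "0 \<le> s \<Longrightarrow> s \<le> t \<Longrightarrow> t \<le> T \<Longrightarrow> integral {s..t} \<phi> = V t - V s"
  using Henstock_Kurzweil_Integration.integral_combine[of 0 s t \<phi>] \<phi>_sub[of 0 t]
  by (simp add: V_def)

lemma V_ge:
  assumes "0 \<le> s" "s \<le> t" "t \<le> T"
  shows "t - s \<le> V t - V s"
proof -
  have "integral {s..t} (\<lambda>_. 1::real) \<le> integral {s..t} \<phi>"
    by (rule integral_le) (use \<phi>_sub \<phi>1 assms in auto)
  then show ?thesis using V_diff assms by simp
qed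

lemma V_dyad_less: "i < 2 ^ n \<Longrightarrow> V (dyad T n i) < V (dyad T n (Suc i))"
  using V_ge[of "dyad T n i" "dyad T n (Suc i)"] T dyad_less_Suc[OF T, of n i]
  by (simp add: dyad_nonneg dyad_le)

lemma V_mono: "0 \<le> s \<Longrightarrow> s \<le> t \<Longrightarrow> t \<le> T \<Longrightarrow> V s \<le> V t"
  using V_ge[of s t] by simp

lemma V_continuous: "continuous_on {0..T} V"
  unfolding V_def[abs_def] by (rule indefinite_integral_continuous_1[OF \<phi>])

lemma V_tendsto:
  assumes "0 \<le> t" "t \<le> T"
  shows "(\<lambda>n. V (dyad T n (cell T n t))) \<longlonglongrightarrow> V t"
  by (rule continuous_on_tendsto_compose[OF V_continuous dyad_cell_tendsto[OF T assms(1)]])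
    (use assms T cell_le[OF T assms] in \<open>auto intro!: always_eventually simp: dyad_nonneg dyad_le\<close>)

text \<open>The Radon--Nikodym property of a Hilbert space. With respect to the measure of density
  \<open>\<phi>\<close> the dyadic difference quotients \<open>q n\<close> form a bounded martingale: the increments are orthogonal
  and the energies \<open>A n\<close> increase to a finite limit, so \<open>q\<close> is Cauchy in mean square and a rapidly
  convergent subsequence converges almost everywhere.\<close>

context
  fixes u :: "real \<Rightarrow> 'b::{real_inner, complete_space}"
  assumes u: "\<And>s t. 0 \<le> s \<Longrightarrow> s \<le> t \<Longrightarrow> t \<le> T \<Longrightarrow> norm (u t - u s) \<le> integral {s..t} \<phi>"
begin

private definition "Q n i = (u (dyad T n (Suc i)) - u (dyad T n i)) /\<^sub>R (V (dyad T n (Suc i)) - V (dyad T n i))"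
text \<open>No cell starts at \<open>T\<close> inside the interval; the value 0 keeps the bound
  \<open>norm_q\<close> valid there.\<close>

private definition "q n t = (if t < T then Q n (cell T n t) else 0)"
text \<open>The integral of \<open>\<phi> s * (norm (q n s))\<^sup>2\<close> over
  \<open>{0..T}\<close>, see \<open>q_energy\<close>.\<close>

private definition "A n = (\<Sum>i<2^n. (V (dyad T n (Suc i)) - V (dyad T n i)) * (norm (Q n i))\<^sup>2)"

private lemma norm_u: "0 \<le> s \<Longrightarrow> s \<le> t \<Longrightarrow> t \<le> T \<Longrightarrow> norm (u t - u s) \<le> V t - V s"
  using u V_diff by metis

private lemma norm_Q:
  assumes "i < 2 ^ n"
  shows "norm (Q n i) \<le> 1"
  using norm_u[of "dyad T n i" "dyad T n (Suc i)"] V_dyad_less[OF assms] assms T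
  by (simp add: Q_def dyad_nonneg dyad_le dyad_mono divide_inverse[symmetric] mult.commute)

private lemma Q_eq: "i < 2 ^ n \<Longrightarrow>
    (V (dyad T n (Suc i)) - V (dyad T n i)) *\<^sub>R Q n i = u (dyad T n (Suc i)) - u (dyad T n i)"
  using V_dyad_less[of i n] by (simp add: Q_def)

private lemma norm_q: "0 \<le> t \<Longrightarrow> norm (q n t) \<le> 1"
  using norm_Q cell_less[OF T] by (simp add: q_def)

private lemma q_on_cell:
  assumes "i < 2 ^ n" "dyad T n i \<le> t" "t < dyad T n (Suc i)"
  shows "q n t = Q n i"
proof -
  have "t < T" using assms(1,3) dyad_le[OF T, of "Suc i" n] by simp
  then show ?thesis using cell_eqI[OF T assms(2,3)] by (simp add: q_def)
qed

text \<open>Generic in \<open>h\<close>: inner products give the weak integral of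
  \<open>q n\<close>, the squared norm gives its energy. The right end node belongs to the next
  cell, hence the exempted point.\<close>

private lemma \<phi>_cell_integral:
  assumes "i < 2 ^ n" "dyad T n i \<le> t" "t \<le> dyad T n (Suc i)"
  shows "((\<lambda>s. \<phi> s * h (q n s)) has_integral (V t - V (dyad T n i)) * h (Q n i)) {dyad T n i..t}"
proof (rule has_integral_spike_finite[of "{dyad T n (Suc i)}"])
  have t: "0 \<le> dyad T n i" "t \<le> T"
    using assms dyad_le[OF T, of "Suc i" n] by (auto simp: dyad_nonneg T)
  have "(\<phi> has_integral (V t - V (dyad T n i))) {dyad T n i..t}"
    using integrable_integral[OF \<phi>_sub[OF t]] V_diff[OF t(1) assms(2) t(2)] by simp
  then show "((\<lambda>s. \<phi> s * h (Q n i)) has_integral (V t - V (dyad T n i)) * h (Q n i)) {dyad T n i..t}"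
    by (rule has_integral_mult_left)
qed (use assms q_on_cell[OF assms(1)] in auto)

private lemma q_weak_cell:
  assumes "i < 2 ^ n" "dyad T n i \<le> t" "t \<le> dyad T n (Suc i)"
  shows "has_weak_integral (\<lambda>s. \<phi> s *\<^sub>R q n s) ((V t - V (dyad T n i)) *\<^sub>R Q n i) (dyad T n i) t"
  unfolding has_weak_integral_def using \<phi>_cell_integral[OF assms, of "\<lambda>x. x \<bullet> _"] by simp

private lemma q_weak_dyad:
  assumes "i \<le> j" "j \<le> 2 ^ n"
  shows "has_weak_integral (\<lambda>s. \<phi> s *\<^sub>R q n s) (u (dyad T n j) - u (dyad T n i)) (dyad T n i) (dyad T n j)"
  using assms
proof (induction j rule: dec_induct)
  case base
  show ?case by (simp add: has_weak_integral_refl)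
next
  case (step j)
  have "has_weak_integral (\<lambda>s. \<phi> s *\<^sub>R q n s)
     ((u (dyad T n j) - u (dyad T n i)) + (u (dyad T n (Suc j)) - u (dyad T n j))) (dyad T n i) (dyad T n (Suc j))"
    by (rule has_weak_integral_combine[of _ "dyad T n j"])
      (use step T q_weak_cell[of j n "dyad T n (Suc j)"] in \<open>auto simp: dyad_mono Q_eq\<close>)
  then show ?case by simp
qed

private lemma q_energy: "((\<lambda>s. \<phi> s * (norm (q n s))\<^sup>2) has_integral A n) {0..T}"
proof -
  have "((\<lambda>s. \<phi> s * (norm (q n s))\<^sup>2) has_integral
      (V (dyad T n (Suc i)) - V (dyad T n i)) * (norm (Q n i))\<^sup>2) {dyad T n i..dyad T n (Suc i)}"
    if "i < 2 ^ n" for i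
    using \<phi>_cell_integral[OF that, of "dyad T n (Suc i)" "\<lambda>x. (norm x)\<^sup>2"] by (simp add: dyad_mono T)
  from has_integral_dyad_sum[OF T this, of "2 ^ n"] show ?thesis by (simp add: A_def)
qed

text \<open>The martingale property. On a coarse cell \<open>q n\<close> is the constant
  \<open>Q n i\<close>, while the weighted integral of the finer \<open>q k\<close> is the increment
  of \<open>u\<close> over that cell, that is, the increment of \<open>V\<close> times
  \<open>Q n i\<close>. Expanding the square then gives the orthogonality in
  \<open>q_diff_energy\<close>.\<close>

private lemma q_cross:
  assumes "n \<le> k"
  shows "((\<lambda>s. \<phi> s * (q k s \<bullet> q n s)) has_integral A n) {0..T}"
proof -
  obtain m where k: "k = n + m" using assms le_Suc_ex by blast
  have "((\<lambda>s. \<phi> s * (q k s \<bullet> q n s)) has_integral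
      (V (dyad T n (Suc i)) - V (dyad T n i)) * (norm (Q n i))\<^sup>2) {dyad T n i..dyad T n (Suc i)}"
    if i: "i < 2 ^ n" for i
  proof (rule has_integral_spike_finite[of "{dyad T n (Suc i)}"])
    have "Suc i * 2 ^ m \<le> 2 ^ n * 2 ^ m" using i by (intro mult_right_mono) auto
    then have "has_weak_integral (\<lambda>s. \<phi> s *\<^sub>R q k s) (u (dyad T n (Suc i)) - u (dyad T n i))
        (dyad T n i) (dyad T n (Suc i))"
      using q_weak_dyad[of "i * 2 ^ m" "Suc i * 2 ^ m" k] unfolding k dyad_refine
      by (simp add: power_add)
    from has_weak_integralD[OF this, of "Q n i"] i
    show "((\<lambda>s. \<phi> s * (q k s \<bullet> Q n i)) has_integral
        (V (dyad T n (Suc i)) - V (dyad T n i)) * (norm (Q n i))\<^sup>2) {dyad T n i..dyad T n (Suc i)}"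
      by (simp add: power2_norm_eq_inner flip: Q_eq)
  qed (use q_on_cell[OF i] in auto)
  from has_integral_dyad_sum[OF T this, of "2 ^ n"] show ?thesis by (simp add: A_def)
qed

private lemma q_diff_energy:
  assumes "n \<le> k"
  shows "((\<lambda>s. \<phi> s * (norm (q k s - q n s))\<^sup>2) has_integral A k - A n) {0..T}"
proof -
  have "((\<lambda>s. \<phi> s * (norm (q k s))\<^sup>2 - 2 * (\<phi> s * (q k s \<bullet> q n s)) + \<phi> s * (norm (q n s))\<^sup>2)
      has_integral A k - 2 * A n + A n) {0..T}"
    by (intro has_integral_add has_integral_diff has_integral_mult_right q_energy q_cross assms)
  moreover have "\<phi> s * (norm (q k s))\<^sup>2 - 2 * (\<phi> s * (q k s \<bullet> q n s)) + \<phi> s * (norm (q n s))\<^sup>2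
      = \<phi> s * (norm (q k s - q n s))\<^sup>2" for s
    by (simp add: power2_norm_eq_inner inner_diff_left inner_diff_right inner_commute algebra_simps)
  ultimately show ?thesis by simp
qed

private lemma A_mono: "n \<le> k \<Longrightarrow> A n \<le> A k"
proof -
  assume "n \<le> k"
  have "0 \<le> A k - A n"
  proof (rule has_integral_nonneg[OF q_diff_energy[OF \<open>n \<le> k\<close>]])
    show "0 \<le> \<phi> s * (norm (q k s - q n s))\<^sup>2" if "s \<in> {0..T}" for s
      using \<phi>1[OF that] by simp
  qed
  then show ?thesis by simp
qed

private lemma A_le: "A n \<le> V T"
proof (rule has_integral_le[OF q_energy])
  show "(\<phi> has_integral V T) {0..T}" unfolding V_def using \<phi> by (rule integrable_integral)
  show "\<phi> s * (norm (q n s))\<^sup>2 \<le> \<phi> s" if "s \<in> {0..T}" for s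
  proof -
    have "(norm (q n s))\<^sup>2 \<le> 1" using norm_q[of s n] that by (simp add: power_le_one)
    then show ?thesis using \<phi>1[OF that] by (simp add: mult_left_le)
  qed
qed

private lemma q_strongly_measurable: "strongly_measurable (lebesgue_on {0..T}) (\<lambda>t. \<phi> t *\<^sub>R q n t)"
proof -
  let ?M = "lebesgue_on {0..T}"
  have 1: "strongly_measurable ?M (\<lambda>x. Q n (cell T n x))"
  proof (rule strongly_measurable_piecewise[where f = "\<lambda>i _. Q n i" and I = "{..2 ^ n}"])
    show "simple_function ?M (cell T n)" by (rule simple_function_cell[OF T])
    show "cell T n x \<in> {..2 ^ n}" if "x \<in> space ?M" for x
      using cell_le[OF T, of x n] that by simp
  qed (simp_all add: strongly_measurable_const)
  have "{x \<in> {0..T}. \<not> Q n (cell T n x) = q n x} \<subseteq> {T}" by (auto simp: q_def)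
  then have "AE x in ?M. Q n (cell T n x) = q n x"
    by (subst AE_lebesgue_on_iff_negligible) (simp, rule negligible_subset[OF negligible_sing])
  with 1 have 2: "strongly_measurable ?M (q n)"
    by (rule strongly_measurable_AE_cong)
  have "strongly_measurable ?M \<phi>"
    using strongly_measurable_iff_borel_measurable[OF complete_measure_lebesgue_on, of "{0..T}" \<phi>]
      integrable_imp_measurable[OF \<phi>] by simp
  then show ?thesis
    using 2 by (rule strongly_measurable_compose2[where h = "\<lambda>x y. x *\<^sub>R y"]) (rule tendsto_scaleR)
qed

private lemma fast_subsequence:
  obtains r where "\<And>j. r j \<le> r (Suc j)" "\<And>j. A (r (Suc j)) - A (r j) \<le> (1/4) ^ j"
    "filterlim r at_top sequentially"
proof -
  have inc: "incseq A" using A_mono by (auto simp: incseq_def)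
  obtain L where L: "A \<longlonglongrightarrow> L"
    by (rule incseq_convergent[OF inc, of "V T"]) (use A_le in auto)
  have AL: "A n \<le> L" for n
    by (rule incseq_le[OF inc L])
  have "\<exists>N. \<forall>n\<ge>N. L - A n \<le> (1/4) ^ j" for j :: nat
  proof -
    have "\<forall>\<^sub>F n in sequentially. L - (1/4) ^ j < A n"
      by (rule order_tendstoD(1)[OF L]) simp
    then have "\<forall>\<^sub>F n in sequentially. L - A n \<le> (1/4) ^ j" by eventually_elim simp
    then show ?thesis unfolding eventually_sequentially .
  qed
  then obtain N where N: "\<And>j n. N j \<le> n \<Longrightarrow> L - A n \<le> (1/4) ^ j" by metis
  \<comment> \<open>Summing the thresholds makes \<open>r\<close> monotone and at least
    \<open>N j\<close>; the summand \<open>j\<close> makes it tend to infinity.\<close>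
  define r where "r j = j + (\<Sum>i\<le>j. N i)" for j
  have "N j \<le> r j" for j unfolding r_def by (intro trans_le_add2 member_le_sum) auto
  then have "A (r (Suc j)) - A (r j) \<le> (1/4) ^ j" for j
    using N[of j "r j"] AL[of "r (Suc j)"] by fastforce
  moreover have "r j \<le> r (Suc j)" for j by (simp add: r_def)
  moreover have "filterlim r at_top sequentially"
    by (rule filterlim_at_top_mono[OF filterlim_ident]) (simp add: r_def)
  ultimately show thesis using that by blast
qed

text \<open>Mean-square smallness becomes mean smallness through
  \<open>x \<le> (1/2) ^ j + 2 ^ j * x\<^sup>2\<close>, whose weighted right-hand side is
  \<open>b\<close>. The energy gap \<open>(1/4) ^ j\<close> still leaves \<open>(1/2) ^ j\<close>
  after multiplication by \<open>2 ^ j\<close>. Hence the sum of the increments has finite integral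
  and is finite almost everywhere.\<close>

private lemma subsequence_AE_Cauchy:
  assumes r: "\<And>j. r j \<le> r (Suc j)" "\<And>j. A (r (Suc j)) - A (r j) \<le> (1/4) ^ j"
  shows "AE t in lebesgue_on {0..T}. Cauchy (\<lambda>j. q (r j) t)"
proof -
  let ?M = "lebesgue_on {0..T}"
  have M: "complete_measure ?M" by (rule complete_measure_lebesgue_on) simp
  define e where "e j t = norm (\<phi> t *\<^sub>R q (r (Suc j)) t - \<phi> t *\<^sub>R q (r j) t)" for j t
  have e_eq: "e j t = \<phi> t * norm (q (r (Suc j)) t - q (r j) t)" if "t \<in> {0..T}" for j t
    using \<phi>1[OF that] by (simp add: e_def flip: scaleR_diff_right)
  have [measurable]: "e j \<in> borel_measurable ?M" for j
    unfolding e_def[abs_def]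
    by (rule strongly_measurable_norm_borel[OF M
          strongly_measurable_compose2[OF q_strongly_measurable q_strongly_measurable, where h = "(-)"]])
      (rule tendsto_diff)
  define b where "b j t = (1/2) ^ j * \<phi> t + 2 ^ j * (\<phi> t * (norm (q (r (Suc j)) t - q (r j) t))\<^sup>2)" for j t
  have "(\<phi> has_integral V T) {0..T}" unfolding V_def using \<phi> by (rule integrable_integral)
  then have b: "(b j has_integral (1/2) ^ j * V T + 2 ^ j * (A (r (Suc j)) - A (r j))) {0..T}" for j
    unfolding b_def by (intro has_integral_add has_integral_mult_right q_diff_energy r)
  have eb: "e j t \<le> b j t" if "t \<in> {0..T}" for j t
  proof -
    define x where "x = norm (q (r (Suc j)) t - q (r j) t)"
    have "0 \<le> ((1/2) ^ j - x)\<^sup>2 * 2 ^ j" by simp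
    also have "\<dots> = (1/2) ^ j + 2 ^ j * x\<^sup>2 - 2 * x"
      by (simp add: power2_eq_square algebra_simps power_one_over)
    finally have "x \<le> (1/2) ^ j + 2 ^ j * x\<^sup>2" using norm_ge_zero[of "q (r (Suc j)) t - q (r j) t"]
      unfolding x_def by linarith
    then have "\<phi> t * x \<le> \<phi> t * ((1/2) ^ j + 2 ^ j * x\<^sup>2)"
      using \<phi>1[OF that] by (intro mult_left_mono) auto
    then show ?thesis using e_eq[OF that] by (simp add: b_def x_def algebra_simps)
  qed
  have b0: "0 \<le> b j t" if "t \<in> {0..T}" for j t
    using eb[OF that, of j] order_trans[OF norm_ge_zero] unfolding e_def by blast
  have nn: "(\<integral>\<^sup>+t. ennreal (e j t) \<partial>?M) \<le> ennreal ((1/2) ^ j * (V T + 1))" for j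
  proof -
    have ib: "integrable ?M (b j)"
      by (rule integrable_lebesgue_on_nonneg[OF has_integral_integrable[OF b]]) (use b0 in auto)
    have "(\<integral>\<^sup>+t. ennreal (e j t) \<partial>?M) \<le> (\<integral>\<^sup>+t. ennreal (b j t) \<partial>?M)"
      by (rule nn_integral_mono) (use eb in \<open>auto intro!: ennreal_leI\<close>)
    also have "\<dots> = ennreal (\<integral>t. b j t \<partial>?M)"
      by (rule nn_integral_eq_integral[OF ib]) (use b0 in \<open>auto intro!: AE_I2\<close>)
    also have "(\<integral>t. b j t \<partial>?M) = (1/2) ^ j * V T + 2 ^ j * (A (r (Suc j)) - A (r j))"
      using has_integral_integral_lebesgue_on[OF ib] b by (auto intro: has_integral_unique)
    also have "\<dots> \<le> (1/2) ^ j * V T + 2 ^ j * (1/4) ^ j"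
      using r(2)[of j] by simp
    also have "\<dots> = (1/2) ^ j * (V T + 1)"
      by (simp add: algebra_simps flip: power_mult_distrib)
    finally show ?thesis by (simp add: ennreal_leI)
  qed
  have "V T \<ge> 0" using V_ge[of 0 T] T by (simp add: V_def)
  have "(\<integral>\<^sup>+t. (\<Sum>j. ennreal (e j t)) \<partial>?M) = (\<Sum>j. \<integral>\<^sup>+t. ennreal (e j t) \<partial>?M)"
    by (rule nn_integral_suminf) measurable
  also have "\<dots> \<le> (\<Sum>j. ennreal ((1/2) ^ j * (V T + 1)))"
    by (intro suminf_le nn) auto
  also have "\<dots> = ennreal (\<Sum>j. (1/2) ^ j * (V T + 1))"
    by (rule suminf_ennreal2) (use \<open>V T \<ge> 0\<close> in \<open>auto intro!: summable_mult2 summable_geometric\<close>)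
  finally have "(\<integral>\<^sup>+t. (\<Sum>j. ennreal (e j t)) \<partial>?M) \<noteq> \<infinity>" by (auto simp: top_unique)
  then have "AE t in ?M. (\<Sum>j. ennreal (e j t)) \<noteq> \<infinity>"
    by (rule nn_integral_PInf_AE[rotated]) measurable
  then show ?thesis using AE_space
  proof eventually_elim
    case (elim t)
    then have t: "t \<in> {0..T}" by simp
    have "summable (\<lambda>j. e j t)"
      by (rule summable_suminf_not_top) (use elim in \<open>auto simp: e_def\<close>)
    then have "summable (\<lambda>j. dist (q (r (Suc j)) t) (q (r j) t))"
    proof (rule summable_comparison_test'[where N = 0])
      show "norm (dist (q (r (Suc j)) t) (q (r j) t)) \<le> e j t" for j
        using \<phi>1[OF t] by (simp add: e_eq[OF t] dist_norm mult_le_cancel_right1)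
    qed
    then show ?case by (rule Cauchy_summable_dist)
  qed
qed

text \<open>At nodes the integral is exactly the increment of \<open>u\<close>. Past the last node
  before \<open>t\<close> the integral and \<open>u\<close> each move by at most the increment of
  \<open>V\<close>, whence the factor 2.\<close>

private lemma q_weak:
  assumes t: "0 \<le> t" "t \<le> T"
  shows "\<exists>y. has_weak_integral (\<lambda>s. \<phi> s *\<^sub>R q n s) y 0 t \<and>
    norm (y - (u t - u 0)) \<le> 2 * (V t - V (dyad T n (cell T n t)))"
proof (cases "t = T")
  case True
  have "cell T n T = 2 ^ n" using cell_dyad[OF T, of n "2 ^ n"] by simp
  then show ?thesis
    using q_weak_dyad[of 0 "2 ^ n" n] True by (intro exI[of _ "u t - u 0"]) simp
next
  case False
  define i where "i = cell T n t"
  define y where "y = u (dyad T n i) - u 0 + (V t - V (dyad T n i)) *\<^sub>R Q n i"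
  have i: "i < 2 ^ n" "dyad T n i \<le> t" "t < dyad T n (Suc i)"
    using cell_less[OF T t(1)] cell_bounds[OF T t(1)] False t by (auto simp: i_def)
  have y: "has_weak_integral (\<lambda>s. \<phi> s *\<^sub>R q n s) y 0 t"
    unfolding y_def
    using has_weak_integral_combine[OF _ _ q_weak_dyad[of 0 i n] q_weak_cell[of i n t]] i
    by (simp add: dyad_nonneg T)
  have Vn: "0 \<le> V t - V (dyad T n i)"
    using V_ge[of "dyad T n i" t] i t T dyad_nonneg[OF T, of n i] by auto
  have "norm (y - (u t - u 0)) = norm ((V t - V (dyad T n i)) *\<^sub>R Q n i - (u t - u (dyad T n i)))"
    by (simp add: y_def algebra_simps)
  also have "\<dots> \<le> norm ((V t - V (dyad T n i)) *\<^sub>R Q n i) + norm (u t - u (dyad T n i))"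
    by (rule norm_triangle_ineq4)
  also have "norm ((V t - V (dyad T n i)) *\<^sub>R Q n i) \<le> V t - V (dyad T n i)"
    using norm_Q[OF i(1)] Vn by (simp add: mult_left_le)
  also have "norm (u t - u (dyad T n i)) \<le> V t - V (dyad T n i)"
    by (rule norm_u) (use i t T in \<open>auto simp: dyad_nonneg\<close>)
  finally have "norm (y - (u t - u 0)) \<le> 2 * (V t - V (dyad T n i))" by simp
  with y show ?thesis by (auto simp: i_def)
qed

theorem dominated_increments_imp_primitive:
  obtains v where "strongly_measurable (lebesgue_on {0..T}) v"
    "\<And>t. t \<in> {0..T} \<Longrightarrow> norm (v t) \<le> \<phi> t"
    "\<And>s t. 0 \<le> s \<Longrightarrow> s \<le> t \<Longrightarrow> t \<le> T \<Longrightarrow> has_weak_integral v (u t - u s) s t"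
proof -
  let ?M = "lebesgue_on {0..T}"
  have M: "complete_measure ?M" by (rule complete_measure_lebesgue_on) simp
  have F: "finite_measure ?M" by (rule finite_measure_lebesgue_on) simp
  obtain r where r: "\<And>j. r j \<le> r (Suc j)" "\<And>j. A (r (Suc j)) - A (r j) \<le> (1/4) ^ j"
    "filterlim r at_top sequentially"
    using fast_subsequence by blast
  \<comment> \<open>The value 0 where the subsequence fails to be Cauchy makes the bound by
    \<open>\<phi>\<close> hold at every point.\<close>
  define v where "v t = (if Cauchy (\<lambda>j. q (r j) t) then \<phi> t *\<^sub>R lim (\<lambda>j. q (r j) t) else 0)" for t
  have lim: "(\<lambda>j. \<phi> t *\<^sub>R q (r j) t) \<longlonglongrightarrow> v t" if "Cauchy (\<lambda>j. q (r j) t)" for t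
    using that Cauchy_convergent[OF that] by (auto simp: v_def convergent_LIMSEQ_iff intro!: tendsto_scaleR)
  have AE: "AE t in ?M. (\<lambda>j. \<phi> t *\<^sub>R q (r j) t) \<longlonglongrightarrow> v t"
    using subsequence_AE_Cauchy[OF r(1,2)] by eventually_elim (rule lim)
  have i\<phi>: "integrable ?M \<phi>"
    by (rule integrable_lebesgue_on_nonneg[OF \<phi>]) (use \<phi>1 in force)+
  have nq: "norm (\<phi> t *\<^sub>R q n t) \<le> \<phi> t" if "t \<in> {0..T}" for n t
    using norm_q[of t n] \<phi>1[OF that] that by (simp add: mult_left_le)
  have v1: "strongly_measurable ?M v"
    by (rule strongly_measurable_AE_lim[OF M F q_strongly_measurable i\<phi> _ AE]) (use nq in simp)
  have v2: "norm (v t) \<le> \<phi> t" if "t \<in> {0..T}" for t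
  proof (cases "Cauchy (\<lambda>j. q (r j) t)")
    case True
    show ?thesis
      by (rule LIMSEQ_le_const2[OF tendsto_norm[OF lim[OF True]]]) (use nq[OF that] in blast)
  qed (use \<phi>1[OF that] in \<open>simp add: v_def\<close>)
  have v3: "has_weak_integral v (u t - u 0) 0 t" if t: "0 \<le> t" "t \<le> T" for t
    unfolding has_weak_integral_def
  proof
    fix z
    let ?N = "lebesgue_on {0..t}"
    obtain y where y: "\<And>n. has_weak_integral (\<lambda>s. \<phi> s *\<^sub>R q n s) (y n) 0 t"
      "\<And>n. norm (y n - (u t - u 0)) \<le> 2 * (V t - V (dyad T n (cell T n t)))"
      using q_weak[OF t] by metis
    have "(\<lambda>n. 2 * (V t - V (dyad T n (cell T n t)))) \<longlonglongrightarrow> 2 * (V t - V t)"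
      by (intro tendsto_intros V_tendsto t)
    then have "(\<lambda>n. 2 * (V t - V (dyad T n (cell T n t)))) \<longlonglongrightarrow> 0" by simp
    then have "(\<lambda>n. y n - (u t - u 0)) \<longlonglongrightarrow> 0"
      by (rule Lim_null_comparison[OF always_eventually[OF allI[OF y(2)]]])
    then have "y \<longlonglongrightarrow> u t - u 0" by (simp add: LIM_zero_iff)
    then have "(\<lambda>j. y (r j)) \<longlonglongrightarrow> u t - u 0"
      using r(3) by (rule filterlim_compose)
    then have yz: "(\<lambda>j. y (r j) \<bullet> z) \<longlonglongrightarrow> (u t - u 0) \<bullet> z" by (intro tendsto_intros)
    have sub: "strongly_measurable ?N w" if "strongly_measurable ?M w" for w :: "real \<Rightarrow> 'b"
      by (rule strongly_measurable_lebesgue_on_subset[OF that]) (use t in auto)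
    have meas: "(\<lambda>s. w s \<bullet> z) \<in> borel_measurable ?N" if "strongly_measurable ?M w" for w
    proof -
      have "strongly_measurable ?N (\<lambda>s. w s \<bullet> z)"
        by (rule strongly_measurable_compose[OF sub[OF that], where h = "\<lambda>x. x \<bullet> z"]) (intro tendsto_intros)
      then show ?thesis
        using strongly_measurable_iff_borel_measurable[OF complete_measure_lebesgue_on, of "{0..t}" "\<lambda>s. w s \<bullet> z"]
        by simp
    qed
    have AEN: "AE s in ?N. (\<lambda>j. (\<phi> s *\<^sub>R q (r j) s) \<bullet> z) \<longlonglongrightarrow> v s \<bullet> z"
    proof -
      have "AE s in ?N. (\<lambda>j. \<phi> s *\<^sub>R q (r j) s) \<longlonglongrightarrow> v s"
        using AE t by (auto simp: AE_lebesgue_on_iff_negligible elim!: negligible_subset)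
      then show ?thesis by eventually_elim (intro tendsto_intros)
    qed
    have i\<phi>z: "integrable ?N (\<lambda>s. \<phi> s * norm z)"
      using integrable_lebesgue_on_nonneg[OF \<phi>_sub[of 0 t]] \<phi>1 t by force
    have bnd: "AE s in ?N. norm ((\<phi> s *\<^sub>R q (r j) s) \<bullet> z) \<le> \<phi> s * norm z" for j
    proof (rule AE_I2)
      fix s assume "s \<in> space ?N"
      then have s: "s \<in> {0..T}" using t by auto
      have "norm ((\<phi> s *\<^sub>R q (r j) s) \<bullet> z) \<le> norm (\<phi> s *\<^sub>R q (r j) s) * norm z"
        using Cauchy_Schwarz_ineq2[of "\<phi> s *\<^sub>R q (r j) s" z] by (simp only: real_norm_def)
      also have "\<dots> \<le> \<phi> s * norm z" using nq[OF s] by (rule mult_right_mono) simp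
      finally show "norm ((\<phi> s *\<^sub>R q (r j) s) \<bullet> z) \<le> \<phi> s * norm z" .
    qed
    note dc = integral_dominated_convergence[OF meas[OF v1] meas[OF q_strongly_measurable] i\<phi>z AEN bnd]
      integrable_dominated_convergence[OF meas[OF v1] meas[OF q_strongly_measurable] i\<phi>z AEN bnd]
    have bnd': "AE s in ?N. norm ((\<phi> s *\<^sub>R q (r j) s) \<bullet> z) \<le> norm (\<phi> s * norm z)" for j
      using bnd[of j] by eventually_elim (metis abs_ge_self order_trans real_norm_def)
    have iq: "integrable ?N (\<lambda>s. (\<phi> s *\<^sub>R q (r j) s) \<bullet> z)" for j
      by (rule Bochner_Integration.integrable_bound[OF i\<phi>z meas[OF q_strongly_measurable]])
        (rule bnd')
    have "(\<integral>s. (\<phi> s *\<^sub>R q (r j) s) \<bullet> z \<partial>?N) = y (r j) \<bullet> z" for j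
      using has_integral_integral_lebesgue_on[OF iq] has_weak_integralD[OF y(1)]
      by (auto intro: has_integral_unique)
    then have "(\<integral>s. v s \<bullet> z \<partial>?N) = (u t - u 0) \<bullet> z"
      using dc(1) yz by (auto intro: LIMSEQ_unique)
    then show "((\<lambda>s. v s \<bullet> z) has_integral (u t - u 0) \<bullet> z) {0..t}"
      using has_integral_integral_lebesgue_on[OF dc(2)] by simp
  qed
  show thesis by (rule that[OF v1 v2 has_weak_integral_increment[OF v3]])
qed

end

end

section \<open>Nearest points and proximal normals\<close>

text \<open>Stated for squares because the estimates that use it go through
  \<open>norm_convex_comb_sq\<close>.\<close>

lemma infdist_almost_attained:
  fixes w :: "'b::real_normed_vector"
  assumes "S \<noteq> {}" "0 < \<epsilon>"
  shows "\<exists>y\<in>S. (norm (w - y))\<^sup>2 \<le> (infdist w S)\<^sup>2 + \<epsilon>"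
proof -
  have "infdist w S < sqrt ((infdist w S)\<^sup>2 + \<epsilon>)"
    by (rule real_less_rsqrt) (use assms in simp)
  then obtain y where y: "y \<in> S" "dist w y < sqrt ((infdist w S)\<^sup>2 + \<epsilon>)"
    using infdist_notempty[OF assms(1), of w] cINF_less_iff[OF assms(1) bdd_belowI2[of S 0 "dist w"]]
    by auto
  then have "(dist w y)\<^sup>2 \<le> (sqrt ((infdist w S)\<^sup>2 + \<epsilon>))\<^sup>2"
    by (intro power_mono) auto
  then show ?thesis using y(1) assms by (auto simp: dist_norm)
qed

text \<open>Stewart's identity: the quantitative form of strict convexity by which almost nearest
  points are compared.\<close>

lemma norm_convex_comb_sq:
  fixes w y z :: "'b::real_inner"
  shows "(norm (w + \<theta> *\<^sub>R (y - w) - z))\<^sup>2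
    = (1 - \<theta>) * (norm (w - z))\<^sup>2 + \<theta> * (norm (y - z))\<^sup>2 - \<theta> * (1 - \<theta>) * (norm (w - y))\<^sup>2"
proof -
  have *: "w + \<theta> *\<^sub>R (y - w) - z = (1 - \<theta>) *\<^sub>R (w - z) + \<theta> *\<^sub>R (y - z)" by (simp add: algebra_simps)
  have **: "w - y = (w - z) - (y - z)" by simp
  show ?thesis
    unfolding * ** by (simp add: power2_norm_eq_inner inner_diff_left inner_diff_right inner_add_left
        inner_add_right inner_commute algebra_simps)
qed

text \<open>Points with a nearest point are dense: moving the centre \<open>w\<close> slightly towards an almost
  nearest point \<open>y\<close> forces all almost nearest points of the new centre to lie close to \<open>y\<close>.\<close>

lemma nearest_point_dense:
  fixes S :: "'b::{real_inner, complete_space} set"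
  assumes S: "closed S" "S \<noteq> {}" and e: "0 < e"
  shows "\<exists>w' p. dist w w' \<le> e \<and> p \<in> S \<and> dist w' p = infdist w' S"
proof -
  define B where "B = sqrt ((infdist w S)\<^sup>2 + 2)"
  have B: "B > 0" "B\<^sup>2 = (infdist w S)\<^sup>2 + 2"
    unfolding B_def by (simp_all add: add_nonneg_pos)
  define \<theta> where "\<theta> = min (1/2) (e / (2 * B))"
  have \<theta>: "0 < \<theta>" "\<theta> \<le> 1/2" "2 * (\<theta> * B) \<le> e"
    using e B by (auto simp: \<theta>_def min_def field_simps)
  \<comment> \<open>The centres drift in total by at most \<open>2 * (\<theta> * B) \<le> e\<close>,
    because \<open>\<theta>n\<close> is geometric and \<open>B\<close> bounds every
    \<open>norm (W n - y n)\<close>. The errors decay faster: the ratio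
    \<open>\<epsilon> n / \<theta>n n = (1/4) ^ n\<close> controls the squared distance between
    successive \<open>y n\<close>.\<close>
  define \<theta>n where "\<theta>n n = \<theta> * (1/2) ^ n" for n :: nat
  define \<epsilon> where "\<epsilon> n = \<theta> * (1/8) ^ n" for n :: nat
  have \<theta>n: "0 < \<theta>n n" "\<theta>n n \<le> 1" for n
  proof -
    show "0 < \<theta>n n" using \<theta> by (simp add: \<theta>n_def)
    have "\<theta> * (1/2) ^ n \<le> 1 * 1" by (rule mult_mono) (use \<theta> in \<open>auto simp: power_le_one\<close>)
    then show "\<theta>n n \<le> 1" by (simp add: \<theta>n_def)
  qed
  have \<epsilon>: "0 < \<epsilon> n" "\<epsilon> n \<le> (1/8) ^ n" for n
    using \<theta> by (auto simp: \<epsilon>_def mult_le_cancel_right1)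
  obtain Y where Y: "\<And>w n. Y w n \<in> S" "\<And>w n. (norm (w - Y w n))\<^sup>2 \<le> (infdist w S)\<^sup>2 + \<epsilon> n"
    using infdist_almost_attained[OF S(2) \<epsilon>(1)] by metis
  define W where "W = rec_nat w (\<lambda>n x. x + \<theta>n n *\<^sub>R (Y x n - x))"
  have W0: "W 0 = w" and WS: "W (Suc n) = W n + \<theta>n n *\<^sub>R (Y (W n) n - W n)" for n
    by (simp_all add: W_def)
  define y where "y n = Y (W n) n" for n
  have y: "y n \<in> S" "(norm (W n - y n))\<^sup>2 \<le> (infdist (W n) S)\<^sup>2 + \<epsilon> n" for n
    using Y by (auto simp: y_def)
  have infd: "(infdist (W (Suc n)) S)\<^sup>2 \<le> (1 - \<theta>n n)\<^sup>2 * (norm (W n - y n))\<^sup>2" for n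
  proof -
    have "W (Suc n) - y n = (1 - \<theta>n n) *\<^sub>R (W n - y n)"
      by (simp add: WS y_def algebra_simps)
    then have "norm (W (Suc n) - y n) = (1 - \<theta>n n) * norm (W n - y n)"
      using \<theta>n(2)[of n] by simp
    then have "infdist (W (Suc n)) S \<le> (1 - \<theta>n n) * norm (W n - y n)"
      using infdist_le[OF y(1), of "W (Suc n)" n] by (simp add: dist_norm)
    then show ?thesis using power_mono[OF _ infdist_nonneg, of _ _ _ 2]
      by (metis power_mult_distrib)
  qed
  \<comment> \<open>The slack \<open>(1/8) ^ n\<close> pays for the accumulated errors: in each step
    it shrinks by more than the new error \<open>\<epsilon> (Suc n)\<close>.\<close>
  have Dn: "(norm (W n - y n))\<^sup>2 \<le> (infdist w S)\<^sup>2 + 2 - (1/8) ^ n" for n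
  proof (induction n)
    case 0
    show ?case using y(2)[of 0] \<epsilon>(2)[of 0] by (simp add: W0)
  next
    case (Suc n)
    have "(1 - \<theta>n n)\<^sup>2 * (norm (W n - y n))\<^sup>2 \<le> 1 * (norm (W n - y n))\<^sup>2"
      using \<theta>n[of n] by (intro mult_right_mono) (auto simp: power_le_one)
    then have "(norm (W (Suc n) - y (Suc n)))\<^sup>2 \<le> (norm (W n - y n))\<^sup>2 + \<epsilon> (Suc n)"
      using y(2)[of "Suc n"] infd[of n] by linarith
    moreover have "(0::real) \<le> (1/8) ^ n" by simp
    ultimately show ?case
      using Suc \<epsilon>(2)[of "Suc n"] power_Suc[of "1/8::real" n] by linarith
  qed
  have DB: "norm (W n - y n) \<le> B" for n
  proof (rule power2_le_imp_le)
    have "(0::real) \<le> (1/8) ^ n" by simp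
    then show "(norm (W n - y n))\<^sup>2 \<le> B\<^sup>2" using Dn[of n] B(2) by linarith
  qed (use B in simp)
  have Wd: "dist (W (Suc n)) (W n) \<le> \<theta> * B * (1/2) ^ n" for n
  proof -
    have "dist (W (Suc n)) (W n) = \<theta>n n * norm (W n - y n)"
      using \<theta>n(1)[of n] by (simp add: WS dist_norm y_def norm_minus_commute)
    also have "\<dots> \<le> \<theta>n n * B" using DB \<theta>n(1)[of n] by (intro mult_left_mono) auto
    finally show ?thesis by (simp add: \<theta>n_def mult_ac)
  qed
  have yd: "dist (y (Suc n)) (y n) \<le> 2 * (1/2) ^ n" for n
  proof -
    have id: "(norm (W (Suc n) - y (Suc n)))\<^sup>2 = (1 - \<theta>n n) * (norm (W n - y (Suc n)))\<^sup>2
      + \<theta>n n * (norm (y n - y (Suc n)))\<^sup>2 - \<theta>n n * (1 - \<theta>n n) * (norm (W n - y n))\<^sup>2"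
      unfolding WS y_def by (rule norm_convex_comb_sq)
    have "(infdist (W n) S)\<^sup>2 \<le> (norm (W n - y (Suc n)))\<^sup>2"
      using infdist_le[OF y(1), of "W n" "Suc n"]
      by (intro power_mono) (auto simp: dist_norm infdist_nonneg)
    then have "(norm (W n - y n))\<^sup>2 - \<epsilon> n \<le> (norm (W n - y (Suc n)))\<^sup>2" using y(2)[of n] by linarith
    then have 1: "(1 - \<theta>n n) * ((norm (W n - y n))\<^sup>2 - \<epsilon> n) \<le> (1 - \<theta>n n) * (norm (W n - y (Suc n)))\<^sup>2"
      using \<theta>n(2)[of n] by (intro mult_left_mono) auto
    have 2: "(norm (W (Suc n) - y (Suc n)))\<^sup>2 \<le> (1 - \<theta>n n)\<^sup>2 * (norm (W n - y n))\<^sup>2 + \<epsilon> (Suc n)"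
      using y(2)[of "Suc n"] infd[of n] by linarith
    have 3: "(1 - \<theta>n n) * \<epsilon> n \<le> \<epsilon> n" using \<theta>n[of n] \<epsilon>(1)[of n] by (simp add: mult_le_cancel_right1)
    \<comment> \<open>Since \<open>(1 - \<theta>) - \<theta> * (1 - \<theta>) = (1 -
      \<theta>)\<^sup>2\<close>, the terms with \<open>norm (W n - y n)\<close> cancel and only the
      two errors remain.\<close>
    have "\<theta>n n * (norm (y n - y (Suc n)))\<^sup>2 \<le> \<epsilon> n + \<epsilon> (Suc n)"
      using id 1 2 3 by (simp add: power2_eq_square algebra_simps)
    also have "\<dots> \<le> 2 * \<epsilon> n" using \<theta> by (simp add: \<epsilon>_def)
    also have "\<epsilon> n = \<theta>n n * (1/4) ^ n" by (simp add: \<epsilon>_def \<theta>n_def flip: power_mult_distrib)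
    finally have "(norm (y n - y (Suc n)))\<^sup>2 \<le> 2 * (1/4) ^ n"
      using \<theta>n(1)[of n] by (simp add: mult.left_commute)
    also have "\<dots> \<le> (2 * (1/2) ^ n)\<^sup>2"
      by (simp add: power_mult_distrib power2_eq_square flip: power_mult_distrib)
    finally have "norm (y n - y (Suc n)) \<le> 2 * (1/2) ^ n" by (rule power2_le_imp_le) simp
    then show ?thesis by (simp add: dist_norm norm_minus_commute)
  qed
  have geo: "summable (\<lambda>n. c * (1/2) ^ n)" for c :: real
    by (intro summable_mult summable_geometric) simp
  have "Cauchy W"
    by (rule Cauchy_summable_dist, rule summable_comparison_test'[OF geo, of 0]) (use Wd in auto)
  then obtain w' where w': "W \<longlonglongrightarrow> w'"
    using Cauchy_convergent unfolding convergent_def by blast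
  have "Cauchy y"
    by (rule Cauchy_summable_dist, rule summable_comparison_test'[OF geo, of 0]) (use yd in auto)
  then obtain p where p: "y \<longlonglongrightarrow> p"
    using Cauchy_convergent unfolding convergent_def by blast
  have pS: "p \<in> S" using closed_sequentially[OF S(1) _ p] y(1) by blast
  have "dist (W n) w \<le> 2 * (\<theta> * B) - 2 * (\<theta> * B) * (1/2) ^ n" for n
  proof (induction n)
    case (Suc n)
    then show ?case using dist_triangle[of "W (Suc n)" w "W n"] Wd[of n] by simp
  qed (simp add: W0)
  moreover have "0 \<le> 2 * (\<theta> * B) * (1/2) ^ n" for n :: nat using \<theta> B by simp
  ultimately have "dist (W n) w \<le> e" for n using \<theta>(3) by (smt (verit))
  moreover have "(\<lambda>n. dist (W n) w) \<longlonglongrightarrow> dist w' w" by (intro tendsto_intros w')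
  ultimately have d: "dist w' w \<le> e" by (intro LIMSEQ_le_const2) auto
  have "(\<lambda>n. (infdist (W n) S)\<^sup>2 + \<epsilon> n) \<longlonglongrightarrow> (infdist w' S)\<^sup>2 + \<theta> * 0"
    unfolding \<epsilon>_def by (intro tendsto_intros tendsto_infdist w' LIMSEQ_power_zero) simp
  moreover have "(\<lambda>n. (norm (W n - y n))\<^sup>2) \<longlonglongrightarrow> (norm (w' - p))\<^sup>2"
    by (intro tendsto_intros w' p)
  ultimately have "(norm (w' - p))\<^sup>2 \<le> (infdist w' S)\<^sup>2 + \<theta> * 0"
    using y(2) by (intro LIMSEQ_le) auto
  then have "norm (w' - p) \<le> infdist w' S"
    by (intro power2_le_imp_le[of "norm (w' - p)"]) (auto simp: infdist_nonneg)
  then have "dist w' p = infdist w' S"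
    using infdist_le[OF pS, of w'] by (simp add: dist_norm)
  moreover have "dist w w' \<le> e" using d by (simp add: dist_commute)
  ultimately show ?thesis using pS by blast
qed

text \<open>Prox-regularity multiplied out, for normals \<open>w - p\<close> that come from a
  nearest point \<open>p\<close> of \<open>w\<close>. Here \<open>\<rho>\<close> stands for
  \<open>1 / (2 * r)\<close>; the case \<open>w = p\<close> is harmless because no norm is divided
  by.\<close>

definition hypomonotone_normals :: "real \<Rightarrow> 'b::real_inner set \<Rightarrow> bool" where
  "hypomonotone_normals \<rho> S \<longleftrightarrow>
    (\<forall>w. \<forall>p\<in>S. dist w p = infdist w S \<longrightarrow> (\<forall>y\<in>S. (w - p) \<bullet> (y - p) \<le> \<rho> * norm (w - p) * (norm (y - p))\<^sup>2))"

text \<open>For centres whose distance to \<open>S\<close> is at most \<open>d\<close>, with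
  \<open>2 * \<rho> * d < 1\<close>, adding the inequalities of two nearest-point pairs makes the
  projection Lipschitz with constant \<open>1 / c\<close>. Centres that tend to \<open>w\<close> and
  possess nearest points therefore have convergent projections.\<close>

lemma nearest_point_exists:
  fixes S :: "'b::{real_inner, complete_space} set"
  assumes S: "closed S" "S \<noteq> {}" "hypomonotone_normals \<rho> S"
    and \<rho>: "0 \<le> \<rho>" "2 * \<rho> * infdist w S < 1"
  shows "\<exists>p\<in>S. dist w p = infdist w S"
proof -
  \<comment> \<open>A radius strictly above the distance that still satisfies
    \<open>2 * \<rho> * d < 1\<close>: the increase uses up only the fraction
    \<open>2 * \<rho> / (4 * \<rho> + 1)\<close> of the remaining room.\<close>
  define d where "d = infdist w S + (1 - 2 * \<rho> * infdist w S) / (4 * \<rho> + 1)"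
  define c where "c = 1 - 2 * \<rho> * d"
  have d: "infdist w S < d" using \<rho> by (simp add: d_def)
  have "2 * \<rho> * ((1 - 2 * \<rho> * infdist w S) / (4 * \<rho> + 1)) < 1 - 2 * \<rho> * infdist w S"
  proof -
    have "2 * \<rho> / (4 * \<rho> + 1) < 1" using \<rho>(1) by (simp add: field_simps)
    then have "2 * \<rho> / (4 * \<rho> + 1) * (1 - 2 * \<rho> * infdist w S) < 1 * (1 - 2 * \<rho> * infdist w S)"
      using \<rho>(2) by (intro mult_strict_right_mono) auto
    then show ?thesis by simp
  qed
  then have c: "c > 0" by (simp add: c_def d_def distrib_left)
  define e where "e n = (d - infdist w S) * (1/2) ^ n" for n :: nat
  have e: "0 < e n" "e n \<le> d - infdist w S" for n
    using d by (auto simp: e_def mult_le_cancel_left1 power_le_one)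
  obtain W P where WP: "\<And>n. dist w (W n) \<le> e n" "\<And>n. P n \<in> S" "\<And>n. dist (W n) (P n) = infdist (W n) S"
    using nearest_point_dense[OF S(1,2) e(1), of w] by metis
  have WPd: "norm (W n - P n) \<le> d" for n
    using infdist_triangle[of "W n" S w] WP(1,3)[of n] e(2)[of n] by (simp add: dist_norm norm_minus_commute)
  have mono: "(W n - P n) \<bullet> (P m - P n) \<le> \<rho> * d * (norm (P m - P n))\<^sup>2" for n m
  proof -
    have "(W n - P n) \<bullet> (P m - P n) \<le> \<rho> * norm (W n - P n) * (norm (P m - P n))\<^sup>2"
      using S(3) WP(2,3) unfolding hypomonotone_normals_def by blast
    also have "\<dots> \<le> \<rho> * d * (norm (P m - P n))\<^sup>2"
      using WPd \<rho>(1) by (intro mult_right_mono mult_left_mono) auto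
    finally show ?thesis .
  qed
  have Pd: "c * norm (P n - P m) \<le> norm (W n - W m)" for n m
  proof (cases "P n = P m")
    case False
    have "(W n - P n) \<bullet> (P m - P n) + (W m - P m) \<bullet> (P n - P m)
        = (norm (P n - P m))\<^sup>2 - (W n - W m) \<bullet> (P n - P m)"
      by (simp add: power2_norm_eq_inner inner_diff_left inner_diff_right inner_commute)
    then have "(norm (P n - P m))\<^sup>2 - (W n - W m) \<bullet> (P n - P m) \<le> 2 * \<rho> * d * (norm (P n - P m))\<^sup>2"
      using mono[of n m] mono[of m n] by (simp add: norm_minus_commute)
    then have "c * (norm (P n - P m))\<^sup>2 \<le> (W n - W m) \<bullet> (P n - P m)"
      by (simp add: c_def algebra_simps)
    also have "\<dots> \<le> norm (W n - W m) * norm (P n - P m)" by (rule norm_cauchy_schwarz)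
    finally show ?thesis using False by (simp add: power2_eq_square)
  qed simp
  have "(\<lambda>n. (d - infdist w S) * (1/2) ^ n) \<longlonglongrightarrow> (d - infdist w S) * 0"
    by (intro tendsto_intros LIMSEQ_power_zero) simp
  then have e0: "e \<longlonglongrightarrow> 0" by (simp add: e_def[abs_def])
  have W: "W \<longlonglongrightarrow> w"
    using tendsto_sandwich[OF always_eventually always_eventually tendsto_const e0, of "\<lambda>n. dist (W n) w"] WP(1)
    by (subst tendsto_dist_iff) (auto simp: dist_commute)
  then have CW: "Cauchy W" by (rule LIMSEQ_imp_Cauchy)
  have "Cauchy P"
  proof (rule metric_CauchyI)
    fix \<epsilon> :: real assume "\<epsilon> > 0"
    then obtain N where N: "\<And>m n. m \<ge> N \<Longrightarrow> n \<ge> N \<Longrightarrow> dist (W m) (W n) < c * \<epsilon>"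
      using metric_CauchyD[OF CW, of "c * \<epsilon>"] c by auto
    show "\<exists>M. \<forall>m\<ge>M. \<forall>n\<ge>M. dist (P m) (P n) < \<epsilon>"
    proof (intro exI[of _ N] allI impI)
      fix m n assume "N \<le> m" "N \<le> n"
      then have "c * dist (P m) (P n) < c * \<epsilon>"
        using N[of m n] Pd[of m n] by (simp add: dist_norm)
      then show "dist (P m) (P n) < \<epsilon>" using c by simp
    qed
  qed
  then obtain p where p: "P \<longlonglongrightarrow> p"
    using Cauchy_convergent unfolding convergent_def by blast
  have pS: "p \<in> S" using closed_sequentially[OF S(1) _ p] WP(2) by blast
  have "(\<lambda>n. dist (W n) (P n)) \<longlonglongrightarrow> dist w p" by (intro tendsto_intros W p)
  moreover have "(\<lambda>n. dist (W n) (P n)) \<longlonglongrightarrow> infdist w S"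
    unfolding WP(3) by (intro tendsto_infdist W)
  ultimately show ?thesis using pS LIMSEQ_unique by blast
qed

lemma prox_regular_imp_hypomonotone_normals:
  assumes "prox_regular r S"
  shows "hypomonotone_normals (real_of_ereal (1 / (2 * r))) S"
  unfolding hypomonotone_normals_def
proof (intro allI ballI impI)
  fix w p y assume p: "p \<in> S" "dist w p = infdist w S" and y: "y \<in> S"
  let ?\<rho> = "real_of_ereal (1 / (2 * r))"
  show "(w - p) \<bullet> (y - p) \<le> ?\<rho> * norm (w - p) * (norm (y - p))\<^sup>2"
  proof (cases "w = p")
    case False
    have "w - p \<in> prox_normal_cone S p"
      unfolding prox_normal_cone_def using p by (auto simp: dist_norm intro!: exI[of _ 1])
    then have "((w - p) /\<^sub>R norm (w - p)) \<bullet> (y - p) \<le> ?\<rho> * (norm (y - p))\<^sup>2"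
      using assms p(1) y False unfolding prox_regular_def by auto
    then have le: "norm (w - p) * (((w - p) /\<^sub>R norm (w - p)) \<bullet> (y - p)) \<le> norm (w - p) * (?\<rho> * (norm (y - p))\<^sup>2)"
      by (rule mult_left_mono) simp
    have "(w - p) \<bullet> (y - p) = norm (w - p) * (((w - p) /\<^sub>R norm (w - p)) \<bullet> (y - p))"
      using False by simp
    also note le
    finally show ?thesis by (simp only: mult_ac)
  qed simp
qed

text \<open>Expanding the squared distance from \<open>x + \<alpha> *\<^sub>R \<xi>\<close> to
  \<open>y\<close>, the cross term is absorbed by \<open>(norm (y - x))\<^sup>2\<close> as soon as
  \<open>2 * \<alpha> * \<sigma> \<le> 1\<close>. The constant \<open>\<sigma>\<close> may thus be
  arbitrary, and may vary with time in the application.\<close>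

lemma prox_normal_coneI:
  assumes x: "x \<in> S" and \<xi>: "\<And>y. y \<in> S \<Longrightarrow> \<xi> \<bullet> (y - x) \<le> \<sigma> * (norm (y - x))\<^sup>2"
  shows "\<xi> \<in> prox_normal_cone S x"
proof -
  define \<alpha> where "\<alpha> = 1 / (2 * \<bar>\<sigma>\<bar> + 1)"
  have \<alpha>: "\<alpha> > 0" "2 * \<alpha> * \<sigma> \<le> 1" by (auto simp: \<alpha>_def field_simps)
  have le: "\<alpha> * norm \<xi> \<le> dist (x + \<alpha> *\<^sub>R \<xi>) y" if y: "y \<in> S" for y
  proof -
    have "(norm (\<alpha> *\<^sub>R \<xi> - (y - x)))\<^sup>2 = (\<alpha> * norm \<xi>)\<^sup>2 - 2 * \<alpha> * (\<xi> \<bullet> (y - x)) + (norm (y - x))\<^sup>2"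
    proof -
      have "(\<alpha> * norm \<xi>)\<^sup>2 = (norm (\<alpha> *\<^sub>R \<xi>))\<^sup>2" using \<alpha> by simp
      then show ?thesis
        by (simp only: power2_norm_eq_inner) (simp add: inner_diff_left inner_diff_right inner_commute algebra_simps)
    qed
    moreover have "2 * \<alpha> * (\<xi> \<bullet> (y - x)) \<le> (norm (y - x))\<^sup>2"
    proof -
      have "2 * \<alpha> * (\<xi> \<bullet> (y - x)) \<le> 2 * \<alpha> * (\<sigma> * (norm (y - x))\<^sup>2)"
        using \<xi>[OF y] \<alpha> by (intro mult_left_mono) auto
      also have "\<dots> = (2 * \<alpha> * \<sigma>) * (norm (y - x))\<^sup>2" by simp
      also have "\<dots> \<le> 1 * (norm (y - x))\<^sup>2" using \<alpha> by (intro mult_right_mono) auto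
      finally show ?thesis by simp
    qed
    ultimately have "(\<alpha> * norm \<xi>)\<^sup>2 \<le> (norm (\<alpha> *\<^sub>R \<xi> - (y - x)))\<^sup>2" by linarith
    then have "\<alpha> * norm \<xi> \<le> norm (\<alpha> *\<^sub>R \<xi> - (y - x))" by (rule power2_le_imp_le) simp
    then show ?thesis by (simp add: dist_norm algebra_simps)
  qed
  have "\<alpha> * norm \<xi> \<le> infdist (x + \<alpha> *\<^sub>R \<xi>) S"
    using x le by (subst infdist_notempty) (auto intro!: cINF_greatest)
  moreover have "infdist (x + \<alpha> *\<^sub>R \<xi>) S \<le> \<alpha> * norm \<xi>"
    using infdist_le[OF x, of "x + \<alpha> *\<^sub>R \<xi>"] \<alpha> by (simp add: dist_norm)
  ultimately show ?thesis
    unfolding prox_normal_cone_def using x \<alpha> by (auto intro!: exI[of _ \<alpha>])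
qed

text \<open>The new value \<open>E (Suc i)\<close> also stands on the right. With
  \<open>x = L * (v (Suc i) - v i) \<le> 1/2\<close> it is absorbed on the left, and
  \<open>(1 + x) / (1 - x) \<le> exp (3 * x)\<close> is the growth factor of one step.\<close>

lemma implicit_discrete_gronwall:
  fixes E v :: "nat \<Rightarrow> real"
  assumes L: "0 \<le> L" and \<epsilon>: "0 \<le> \<epsilon>"
    and v: "\<And>i. i < N \<Longrightarrow> v i \<le> v (Suc i)" "\<And>i. i < N \<Longrightarrow> L * (v (Suc i) - v i) \<le> 1/2"
    and E: "\<And>i. 0 \<le> E i"
      "\<And>i. i < N \<Longrightarrow> E (Suc i) \<le> E i + L * (v (Suc i) - v i) * (E i + E (Suc i) + \<epsilon>)"
    and i: "i \<le> N"
  shows "E i + \<epsilon> \<le> (E 0 + \<epsilon>) * exp (3 * L * (v i - v 0))"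
  using i
proof (induction i)
  case (Suc i)
  define x where "x = L * (v (Suc i) - v i)"
  have x: "0 \<le> x" "x \<le> 1/2" using v Suc.prems L by (auto simp: x_def)
  have "E (Suc i) + \<epsilon> \<le> E i + \<epsilon> + x * (E i + E (Suc i) + \<epsilon>)"
    using E(2)[of i] Suc.prems by (simp add: x_def)
  also have "\<dots> \<le> (E i + \<epsilon>) + x * (E i + \<epsilon>) + x * (E (Suc i) + \<epsilon>)"
    using x \<epsilon> by (simp add: algebra_simps)
  finally have 1: "(1 - x) * (E (Suc i) + \<epsilon>) \<le> (1 + x) * (E i + \<epsilon>)" by (simp add: algebra_simps)
  have "(1 + x) \<le> (1 - x) * exp (3 * x)"
  proof -
    have "1 \<le> (1 - x) * (1 + 2 * x)" using mult_nonneg_nonneg[of x "1 - 2 * x"] x by (simp add: algebra_simps)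
    also have "\<dots> \<le> (1 - x) * exp (2 * x)" using exp_ge_add_one_self[of "2 * x"] x by (intro mult_left_mono) auto
    finally have a: "1 \<le> (1 - x) * exp (2 * x)" .
    have "1 + x \<le> exp x" by (rule exp_ge_add_one_self)
    also have "\<dots> \<le> exp x * ((1 - x) * exp (2 * x))" using mult_left_mono[OF a, of "exp x"] by simp
    also have "\<dots> = (1 - x) * exp (3 * x)"
      using exp_add[of x "2 * x"] by (simp add: algebra_simps)
    finally show ?thesis .
  qed
  then have "(1 + x) * (E i + \<epsilon>) \<le> ((1 - x) * exp (3 * x)) * (E i + \<epsilon>)"
    using E(1)[of i] \<epsilon> by (intro mult_right_mono) auto
  with 1 have "(1 - x) * (E (Suc i) + \<epsilon>) \<le> (1 - x) * (exp (3 * x) * (E i + \<epsilon>))" by (simp add: mult_ac)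
  then have "E (Suc i) + \<epsilon> \<le> exp (3 * x) * (E i + \<epsilon>)" using x by simp
  also have "\<dots> \<le> exp (3 * x) * ((E 0 + \<epsilon>) * exp (3 * L * (v i - v 0)))"
    using Suc by (intro mult_left_mono) auto
  also have "\<dots> = (E 0 + \<epsilon>) * exp (3 * L * (v (Suc i) - v 0))"
    by (simp add: x_def algebra_simps flip: exp_add)
  finally show ?case .
qed simp

section \<open>The catching-up algorithm\<close>

text \<open>Quotients from the left fit the variational inequality, which tests the increment over
  \<open>{s..t}\<close> against points of the set at the later time \<open>t\<close>.\<close>

lemma has_vector_derivative_left_quotient:
  assumes D: "(U has_vector_derivative D) (at t within {0..T})" and t: "0 < t" "t \<le> T"
  shows "((\<lambda>s. (U t - U s) /\<^sub>R (t - s)) \<longlongrightarrow> D) (at_left t)"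
proof -
  have "(U has_vector_derivative D) (at t within {0..t})"
    by (rule has_vector_derivative_within_subset[OF D]) (use t in auto)
  then have "((\<lambda>s. norm (U s - U t - (s - t) *\<^sub>R D) / norm (s - t)) \<longlongrightarrow> 0) (at_left t)"
    using t(1) by (simp add: has_vector_derivative_def has_derivative_iff_norm at_within_Icc_at_left)
  moreover have "\<forall>\<^sub>F s in at_left t. norm (U s - U t - (s - t) *\<^sub>R D) / norm (s - t)
      = norm ((U t - U s) /\<^sub>R (t - s) - D)"
    unfolding eventually_at_filter
  proof (intro always_eventually allI impI)
    fix s assume "s \<noteq> t" "s \<in> {..<t}"
    then have "(U t - U s) /\<^sub>R (t - s) - D = (U t - U s - (t - s) *\<^sub>R D) /\<^sub>R (t - s)"
      by (simp add: scaleR_diff_right)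
    then have "norm ((U t - U s) /\<^sub>R (t - s) - D) = norm (U t - U s - (t - s) *\<^sub>R D) / norm (t - s)"
      by (simp add: divide_inverse)
    also have "U t - U s - (t - s) *\<^sub>R D = - (U s - U t - (s - t) *\<^sub>R D)" by (simp add: algebra_simps)
    finally show "norm (U s - U t - (s - t) *\<^sub>R D) / norm (s - t) = norm ((U t - U s) /\<^sub>R (t - s) - D)"
      by (simp only: norm_minus_cancel norm_minus_commute[of t s])
  qed
  ultimately have "((\<lambda>s. norm ((U t - U s) /\<^sub>R (t - s) - D)) \<longlongrightarrow> 0) (at_left t)"
    by (rule Lim_transform_eventually)
  then show ?thesis by (simp add: tendsto_norm_zero_iff LIM_zero_iff)
qed

text \<open>Energy estimate with the increments tested at the new points, where the normal
  inequalities hold. The discarded term is the square of the difference of the increments.\<close>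

lemma norm_implicit_step:
  fixes p q p' q' :: "'b::real_inner"
  shows "(norm (p' - q'))\<^sup>2 \<le> (norm (p - q))\<^sup>2 + 2 * (((p' - p) - (q' - q)) \<bullet> (p' - q'))"
proof -
  have "(norm (p - q))\<^sup>2 + 2 * (((p' - p) - (q' - q)) \<bullet> (p' - q')) - (norm (p' - q'))\<^sup>2
      = (norm ((p' - p) - (q' - q)))\<^sup>2"
    by (simp add: power2_norm_eq_inner inner_diff_left inner_diff_right inner_commute algebra_simps)
  then show ?thesis by (smt (verit) zero_le_power2)
qed

text \<open>Catching-up algorithm for \<open>- z' \<in> N\<^bsub>C t\<^esub>(z) + g t z\<close> on dyadic meshes. The constant in \<open>lip\<close> is the
  Gronwall bound for the norm of the iterates.\<close>

locale sweeping =
  fixes T \<rho> :: real and c k :: "real \<Rightarrow> real"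
    and g :: "real \<Rightarrow> 'b \<Rightarrow> 'b::{real_inner, complete_space}"
    and C :: "real \<Rightarrow> 'b set" and z0 :: 'b
  assumes T_pos: "0 < T" and \<rho>: "0 \<le> \<rho>"
    and c: "c integrable_on {0..T}" "\<And>t. t \<in> {0..T} \<Longrightarrow> 0 \<le> c t"
    and k: "k integrable_on {0..T}" "\<And>t. t \<in> {0..T} \<Longrightarrow> 0 \<le> k t"
    and g_meas: "\<And>z. strongly_measurable (lebesgue_on {0..T}) (\<lambda>t. g t z)"
    and growth: "\<And>t z. t \<in> {0..T} \<Longrightarrow> norm (g t z) \<le> c t * (1 + norm z)"
    and lip: "\<And>t z z'. t \<in> {0..T} \<Longrightarrow> norm z \<le> (1 + norm z0) * exp (3 * integral {0..T} c) \<Longrightarrow>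
      norm z' \<le> (1 + norm z0) * exp (3 * integral {0..T} c) \<Longrightarrow> norm (g t z - g t z') \<le> k t * norm (z - z')"
    and C: "\<And>t. t \<in> {0..T} \<Longrightarrow> C t \<noteq> {}" "\<And>t. t \<in> {0..T} \<Longrightarrow> closed (C t)"
      "\<And>t. t \<in> {0..T} \<Longrightarrow> hypomonotone_normals \<rho> (C t)"
    and move: "\<And>s t x. 0 \<le> s \<Longrightarrow> s \<le> t \<Longrightarrow> t \<le> T \<Longrightarrow> \<bar>infdist x (C s) - infdist x (C t)\<bar> \<le> integral {s..t} c"
    and z0: "z0 \<in> C 0"
begin

definition "R = (1 + norm z0) * exp (3 * integral {0..T} c)"
text \<open>The parts of the weight: 1 makes \<open>V\<close> strictly increasing,
  \<open>c t * (1 + R)\<close> bounds the drift on the ball of radius \<open>R\<close>, a further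
  \<open>c t\<close> bounds the motion of the sets, and \<open>k t\<close> is the Lipschitz
  constant.\<close>

definition "m t = 1 + c t * (2 + R) + k t"

lemma R_pos: "0 < R"
  unfolding R_def by (simp add: add_pos_nonneg)

lemma m_bounds:
  assumes "t \<in> {0..T}"
  shows "1 \<le> m t" "k t \<le> m t" "c t * (1 + R) \<le> m t" "c t + 1 \<le> m t" "c t * (1 + R) + c t \<le> m t"
proof -
  have cR: "0 \<le> c t * R" using c(2)[OF assms] R_pos by simp
  then show "1 \<le> m t" "k t \<le> m t" "c t * (1 + R) \<le> m t" "c t + 1 \<le> m t" "c t * (1 + R) + c t \<le> m t"
    using c(2)[OF assms] k(2)[OF assms] by (simp_all add: m_def algebra_simps)
qed

sublocale weight T m
proof
  have "(\<lambda>t. 1 + c t * (2 + R) + k t) integrable_on {0..T}"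
    by (intro integrable_add integrable_on_mult_left integrable_const_ivl c(1) k(1))
  then show "m integrable_on {0..T}" by (simp add: m_def[abs_def])
qed (use T_pos m_bounds(1) in auto)

lemma c_sub: "0 \<le> s \<Longrightarrow> t \<le> T \<Longrightarrow> c integrable_on {s..t}"
  using integrable_subinterval_real[OF c(1)] by simp

lemma c_nonneg: "0 \<le> s \<Longrightarrow> t \<le> T \<Longrightarrow> 0 \<le> integral {s..t} c"
  using c(2) by (intro integral_nonneg c_sub) auto

lemma c_mono: "0 \<le> s \<Longrightarrow> s \<le> s' \<Longrightarrow> t \<le> T \<Longrightarrow> integral {s'..t} c \<le> integral {s..t} c"
  using c(2) by (intro integral_subset_le c_sub) auto

lemma c_combine: "0 \<le> s \<Longrightarrow> s \<le> t \<Longrightarrow> t \<le> T \<Longrightarrow> integral {0..t} c = integral {0..s} c + integral {s..t} c"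
  using Henstock_Kurzweil_Integration.integral_combine[of 0 s t c] c_sub[of 0 t] by simp

text \<open>Strictness lets \<open>discrete_variational_inequality\<close> pick a point of a nearby
  set at distance below \<open>d\<close> although the infimum need not be attained.\<close>

lemma c_less_V: "0 \<le> s \<Longrightarrow> s < t \<Longrightarrow> t \<le> T \<Longrightarrow> integral {s..t} c < V t - V s"
proof -
  assume st: "0 \<le> s" "s < t" "t \<le> T"
  have "integral {s..t} (\<lambda>x. c x + 1) \<le> integral {s..t} m"
    by (rule integral_le) (use st m_bounds(4) in \<open>auto intro!: integrable_add c_sub \<phi>_sub\<close>)
  moreover have "integral {s..t} (\<lambda>x. c x + 1) = integral {s..t} c + (t - s)"
    using st by (subst integral_add) (auto intro!: c_sub)
  ultimately show ?thesis using V_diff[of s t] st by simp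
qed

lemma growth_R: "t \<in> {0..T} \<Longrightarrow> norm z \<le> R \<Longrightarrow> norm (g t z) \<le> c t * (1 + R)"
  using growth[of t z] mult_left_mono[of "1 + norm z" "1 + R" "c t"] c(2)[of t] by simp

lemma lip_R: "t \<in> {0..T} \<Longrightarrow> norm z \<le> R \<Longrightarrow> norm z' \<le> R \<Longrightarrow> norm (g t z - g t z') \<le> m t * norm (z - z')"
  using lip[of t z z'] mult_right_mono[OF m_bounds(2), of t "norm (z - z')"] unfolding R_def by simp

lemma primitive_exists:
  assumes f: "strongly_measurable (lebesgue_on {0..T}) f" and le: "\<And>t. t \<in> {0..T} \<Longrightarrow> norm (f t) \<le> b * c t"
  obtains G :: "real \<Rightarrow> 'b" where "\<And>s t. 0 \<le> s \<Longrightarrow> s \<le> t \<Longrightarrow> t \<le> T \<Longrightarrow> has_weak_integral f (G t - G s) s t"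
proof -
  have "\<exists>y. has_weak_integral f y 0 t" if t: "t \<in> {0..T}" for t
  proof -
    have "strongly_measurable (lebesgue_on {0..t}) f"
      by (rule strongly_measurable_lebesgue_on_subset[OF f]) (use t in auto)
    moreover have "(\<lambda>t. b * c t) integrable_on {0..t}"
      using c_sub[of 0 t] t by (intro integrable_on_mult_right) auto
    ultimately show ?thesis
      by (rule strong_bochner_integral_exists) (use le t in auto)
  qed
  then have "\<forall>t\<in>{0..T}. \<exists>y. has_weak_integral f y 0 t" by blast
  from bchoice[OF this] obtain G where G: "\<And>t. t \<in> {0..T} \<Longrightarrow> has_weak_integral f (G t) 0 t" by blast
  have "G 0 = 0"
    using has_weak_integral_unique[OF G has_weak_integral_refl] T_pos by auto
  then have "has_weak_integral f (G t - G s) s t" if "0 \<le> s" "s \<le> t" "t \<le> T" for s t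
    by (intro has_weak_integral_increment[of T f G, OF _ that]) (use G in simp)
  then show thesis by (rule that)
qed

section \<open>One step of the discrete scheme and its a priori bounds\<close>

abbreviation "\<tau> n i \<equiv> dyad T n i"
abbreviation "\<Delta> n i \<equiv> V (\<tau> n (Suc i)) - V (\<tau> n i)"

lemma \<tau>: "0 \<le> \<tau> n i" "i \<le> j \<Longrightarrow> \<tau> n i \<le> \<tau> n j" "i \<le> 2 ^ n \<Longrightarrow> \<tau> n i \<le> T"
  by (simp_all add: dyad_nonneg dyad_mono dyad_le T_pos)

lemma \<tau>_less_Suc: "\<tau> n i < \<tau> n (Suc i)"
  by (rule dyad_less_Suc[OF T_pos])

text \<open>The state is frozen over the cell, so measurability of \<open>g\<close> for fixed states
  suffices for the integral to exist.\<close>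

definition "F n i z = (SOME y. has_weak_integral (\<lambda>s. g s z) y (\<tau> n i) (\<tau> n (Suc i)))"

text \<open>The nearest point is known to exist only on fine meshes, so the facts about
  \<open>P\<close> assume \<open>good n\<close>.\<close>

primrec P :: "nat \<Rightarrow> nat \<Rightarrow> 'b" where
  "P n 0 = z0"
| "P n (Suc i) = (SOME p. p \<in> C (\<tau> n (Suc i)) \<and>
     dist (P n i - F n i (P n i)) p = infdist (P n i - F n i (P n i)) (C (\<tau> n (Suc i))))"

declare P.simps(2) [simp del]

text \<open>The vector from the projection back to the projected point: a proximal normal at the new
  iterate when the projection exists. It is not divided by the step length, so its natural size is
  \<open>\<Delta> n i\<close>.\<close>

definition "N n i = P n i - F n i (P n i) - P n (Suc i)"

lemma F: "i < 2 ^ n \<Longrightarrow> has_weak_integral (\<lambda>s. g s z) (F n i z) (\<tau> n i) (\<tau> n (Suc i))"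
proof -
  assume i: "i < 2 ^ n"
  have "norm (g t z) \<le> (1 + norm z) * c t" if "t \<in> {0..T}" for t
    using growth[OF that] by (simp add: mult.commute)
  then obtain G :: "real \<Rightarrow> 'b" where
    "\<And>s t. 0 \<le> s \<Longrightarrow> s \<le> t \<Longrightarrow> t \<le> T \<Longrightarrow> has_weak_integral (\<lambda>s. g s z) (G t - G s) s t"
    by (rule primitive_exists[OF g_meas]) (assumption, rule that)
  then have "has_weak_integral (\<lambda>s. g s z) (G (\<tau> n (Suc i)) - G (\<tau> n i)) (\<tau> n i) (\<tau> n (Suc i))"
    using \<tau> i by simp
  then show ?thesis unfolding F_def by (rule someI)
qed

text \<open>The condition of \<open>nearest_point_exists\<close>, with \<open>\<Delta> n i\<close>
  as bound for the distance to the next set.\<close>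

definition "good n \<longleftrightarrow> (\<forall>i<2^n. 2 * \<rho> * \<Delta> n i < 1)"

text \<open>The point to be projected is within the norm of the drift of the old set; adding the
  motion, its distance to the new set is at most \<open>\<Delta> n i\<close>. The last bound keeps
  the actual norm in place of \<open>R\<close>, so that it can feed the induction that establishes
  \<open>R\<close>. Its factor 3 counts the drift twice, directly and through \<open>N\<close>, and
  the motion once.\<close>

lemma step:
  assumes n: "good n" and i: "i < 2 ^ n" and Pi: "P n i \<in> C (\<tau> n i)" "norm (P n i) \<le> R"
  shows "P n (Suc i) \<in> C (\<tau> n (Suc i))"
    and "dist (P n i - F n i (P n i)) (P n (Suc i)) = infdist (P n i - F n i (P n i)) (C (\<tau> n (Suc i)))"
    and "norm (N n i) \<le> \<Delta> n i"
    and "norm (P n (Suc i) - P n i) \<le> 2 * \<Delta> n i"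
    and "norm (P n (Suc i) - P n i) \<le> 3 * (1 + norm (P n i)) * integral {\<tau> n i..\<tau> n (Suc i)} c"
proof -
  let ?I = "integral {\<tau> n i..\<tau> n (Suc i)} c" and ?w = "P n i - F n i (P n i)"
  have ts: "0 \<le> \<tau> n i" "\<tau> n i \<le> \<tau> n (Suc i)" "\<tau> n (Suc i) \<le> T" using \<tau> i by auto
  have I0: "0 \<le> ?I" by (rule c_nonneg) (use ts in auto)
  have "norm (F n i (P n i)) \<le> integral {\<tau> n i..\<tau> n (Suc i)} (\<lambda>t. c t * (1 + norm (P n i)))"
    by (rule has_weak_integral_norm_le[OF F[OF i]])
      (use growth ts in \<open>auto intro!: integrable_on_mult_left c_sub\<close>)
  then have Fn: "norm (F n i (P n i)) \<le> ?I * (1 + norm (P n i))" by simp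
  have IV: "?I * (1 + R) + ?I \<le> \<Delta> n i"
  proof -
    have "integral {\<tau> n i..\<tau> n (Suc i)} (\<lambda>t. c t * (1 + R) + c t) \<le> integral {\<tau> n i..\<tau> n (Suc i)} m"
      by (rule integral_le)
        (use ts m_bounds(5) in \<open>auto intro!: integrable_add integrable_on_mult_left c_sub \<phi>_sub\<close>)
    moreover have "integral {\<tau> n i..\<tau> n (Suc i)} (\<lambda>t. c t * (1 + R) + c t) = ?I * (1 + R) + ?I"
      using ts by (subst integral_add) (auto intro!: integrable_on_mult_left c_sub)
    ultimately show ?thesis using V_diff ts by simp
  qed
  have FR: "norm (F n i (P n i)) \<le> ?I * (1 + R)"
    using Fn mult_left_mono[of "1 + norm (P n i)" "1 + R" ?I] Pi(2) I0 by simp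
  have "infdist ?w (C (\<tau> n i)) \<le> norm (F n i (P n i))"
    using infdist_le[OF Pi(1), of ?w] by (simp add: dist_norm)
  then have inf1: "infdist ?w (C (\<tau> n (Suc i))) \<le> norm (F n i (P n i)) + ?I"
    using move[OF ts, of ?w] by simp
  then have inf2: "infdist ?w (C (\<tau> n (Suc i))) \<le> \<Delta> n i" using FR IV by linarith
  then have "2 * \<rho> * infdist ?w (C (\<tau> n (Suc i))) \<le> 2 * \<rho> * \<Delta> n i"
    using \<rho> by (intro mult_left_mono) auto
  also have "\<dots> < 1" using n i by (simp add: good_def)
  finally have "\<exists>p\<in>C (\<tau> n (Suc i)). dist ?w p = infdist ?w (C (\<tau> n (Suc i)))"
    using C[of "\<tau> n (Suc i)"] ts \<rho> by (intro nearest_point_exists) auto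
  then have "\<exists>p. p \<in> C (\<tau> n (Suc i)) \<and> dist ?w p = infdist ?w (C (\<tau> n (Suc i)))" by blast
  from someI_ex[OF this]
  show 1: "P n (Suc i) \<in> C (\<tau> n (Suc i))"
    and 2: "dist ?w (P n (Suc i)) = infdist ?w (C (\<tau> n (Suc i)))"
    by (simp_all add: P.simps(2))
  have N: "norm (N n i) = infdist ?w (C (\<tau> n (Suc i)))" using 2 by (simp add: N_def dist_norm)
  then show "norm (N n i) \<le> \<Delta> n i" using inf2 by simp
  have "P n (Suc i) - P n i = - (N n i + F n i (P n i))" by (simp add: N_def)
  then have d: "norm (P n (Suc i) - P n i) \<le> norm (N n i) + norm (F n i (P n i))"
    by (metis norm_minus_cancel norm_triangle_ineq)
  have Fd: "norm (F n i (P n i)) \<le> \<Delta> n i" using FR IV I0 by linarith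
  have "norm (P n (Suc i) - P n i) \<le> \<Delta> n i + \<Delta> n i"
    by (rule order_trans[OF d add_mono[OF _ Fd]]) (use N inf2 in simp)
  then show "norm (P n (Suc i) - P n i) \<le> 2 * \<Delta> n i" by simp
  have "norm (P n (Suc i) - P n i) \<le> 2 * (?I * (1 + norm (P n i))) + ?I"
    using d N inf1 Fn by linarith
  moreover have "?I \<le> ?I * (1 + norm (P n i))" using I0 by (simp add: mult_le_cancel_left1)
  ultimately have "norm (P n (Suc i) - P n i) \<le> 3 * (?I * (1 + norm (P n i)))" by linarith
  then show "norm (P n (Suc i) - P n i) \<le> 3 * (1 + norm (P n i)) * ?I" by (simp only: mult_ac)
qed

lemma norm_le_R:
  assumes "1 + norm z \<le> (1 + norm z0) * exp (3 * integral {0..t} c)" "0 \<le> t" "t \<le> T"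
  shows "norm z \<le> R"
proof -
  have "(1 + norm z0) * exp (3 * integral {0..t} c) \<le> R"
    unfolding R_def using c_combine[of t T] c_nonneg[of t T] assms
    by (intro mult_left_mono) auto
  then show ?thesis using assms(1) by simp
qed

text \<open>Membership and bound go through one induction because \<open>step\<close> needs both at
  the previous node.\<close>

lemma P_invariant:
  assumes n: "good n" and i: "i \<le> 2 ^ n"
  shows "P n i \<in> C (\<tau> n i) \<and> 1 + norm (P n i) \<le> (1 + norm z0) * exp (3 * integral {0..\<tau> n i} c)"
  using i
proof (induction i)
  case 0
  then show ?case using z0 by simp
next
  case (Suc i)
  then have i: "i < 2 ^ n" and IH: "P n i \<in> C (\<tau> n i)"
    "1 + norm (P n i) \<le> (1 + norm z0) * exp (3 * integral {0..\<tau> n i} c)" by auto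
  let ?I = "integral {\<tau> n i..\<tau> n (Suc i)} c"
  have ts: "0 \<le> \<tau> n i" "\<tau> n i \<le> \<tau> n (Suc i)" "\<tau> n (Suc i) \<le> T" using \<tau> i by auto
  have R: "norm (P n i) \<le> R" using norm_le_R[OF IH(2)] ts by simp
  note st = step[OF n i IH(1) R]
  have "1 + norm (P n (Suc i)) \<le> 1 + norm (P n i) + norm (P n (Suc i) - P n i)"
    using norm_triangle_sub[of "P n (Suc i)" "P n i"] by simp
  also have "\<dots> \<le> (1 + norm (P n i)) * (1 + 3 * ?I)" using st(5) by (simp add: algebra_simps)
  also have "\<dots> \<le> (1 + norm (P n i)) * exp (3 * ?I)"
    by (intro mult_left_mono exp_ge_add_one_self) auto
  also have "\<dots> \<le> ((1 + norm z0) * exp (3 * integral {0..\<tau> n i} c)) * exp (3 * ?I)"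
    using IH(2) by (intro mult_right_mono) auto
  also have "\<dots> = (1 + norm z0) * exp (3 * integral {0..\<tau> n (Suc i)} c)"
    using c_combine[OF ts] by (simp add: distrib_left exp_add)
  finally show ?case using st(1) by simp
qed

lemma P_in: "good n \<Longrightarrow> i \<le> 2 ^ n \<Longrightarrow> P n i \<in> C (\<tau> n i)"
  using P_invariant by blast

lemma P_R: "good n \<Longrightarrow> i \<le> 2 ^ n \<Longrightarrow> norm (P n i) \<le> R"
  using norm_le_R[OF conjunct2[OF P_invariant] \<tau>(1,3)] by blast

lemma normal_step:
  assumes "good n" "i < 2 ^ n"
  shows "dist (P n i - F n i (P n i)) (P n (Suc i)) = infdist (P n i - F n i (P n i)) (C (\<tau> n (Suc i)))"
    and "norm (N n i) \<le> \<Delta> n i"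
    and "norm (P n (Suc i) - P n i) \<le> 2 * \<Delta> n i"
  using step[OF assms P_in P_R] assms by simp_all

lemma P_diff:
  assumes n: "good n" and "i \<le> j" "j \<le> 2 ^ n"
  shows "norm (P n j - P n i) \<le> 2 * (V (\<tau> n j) - V (\<tau> n i))"
  using assms(2,3)
proof (induction j rule: dec_induct)
  case (step j)
  then have "norm (P n (Suc j) - P n j) \<le> 2 * \<Delta> n j" using normal_step(3)[OF n, of j] by simp
  then show ?case
    using step norm_triangle_ineq[of "P n (Suc j) - P n j" "P n j - P n i"] by simp
qed simp

lemma V_telescope: "i \<le> j \<Longrightarrow> (\<Sum>l=i..<j. \<Delta> n l) = V (\<tau> n j) - V (\<tau> n i)"
  by (rule sum_Suc_diff')

lemma N_telescope: "i \<le> j \<Longrightarrow> (\<Sum>l=i..<j. N n l) = - (P n j - P n i) - (\<Sum>l=i..<j. F n l (P n l))"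
  by (induction j rule: dec_induct) (simp_all add: N_def)

text \<open>Summing the normal inequalities over a range of steps; the moving constraint costs only
  the variation \<open>d\<close> of the weight over that range.\<close>

lemma discrete_variational_inequality:
  assumes n: "good n" and ij: "i \<le> j" "j \<le> 2 ^ n"
    and t: "\<tau> n j \<le> t" "\<tau> n i < t" "t \<le> T" and y: "y \<in> C t" and d: "d = V t - V (\<tau> n i)"
  shows "(\<Sum>l=i..<j. N n l) \<bullet> (y - P n j) \<le> d * (\<rho> * (norm (y - P n j) + 3 * d)\<^sup>2 + 3 * d)"
proof -
  let ?B = "\<rho> * (norm (y - P n j) + 3 * d)\<^sup>2 + 3 * d"
  have d0: "0 < d" using V_ge[of "\<tau> n i" t] t \<tau>(1)[of n i] by (simp add: d)
  have B0: "0 \<le> ?B" using \<rho> d0 by simp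
  have "N n l \<bullet> (y - P n j) \<le> \<Delta> n l * ?B" if l: "i \<le> l" "l < j" for l
  proof -
    have l2: "l < 2 ^ n" using l ij by simp
    have ts: "0 \<le> \<tau> n i" "\<tau> n i \<le> \<tau> n (Suc l)" "\<tau> n (Suc l) \<le> t" "\<tau> n (Suc l) \<le> T"
      using \<tau> l t ij order_trans[OF \<tau>(2)[of "Suc l" j n] t(1)] by auto
    have Ct: "C (\<tau> n (Suc l)) \<noteq> {}" using C(1) ts by auto
    have "infdist y (C (\<tau> n (Suc l))) \<le> infdist y (C t) + integral {\<tau> n (Suc l)..t} c"
      using move[of "\<tau> n (Suc l)" t y] ts t by simp
    also have "\<dots> \<le> integral {\<tau> n i..t} c" using y c_mono[of "\<tau> n i" "\<tau> n (Suc l)" t] ts t by simp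
    also have "\<dots> < d" unfolding d by (rule c_less_V) (use ts t in auto)
    \<comment> \<open>The test point \<open>y\<close> belongs to the set at time \<open>t\<close>;
      \<open>yl\<close> replaces it in the set where the normal lives, at distance below
      \<open>d\<close>.\<close>
    finally obtain yl where yl: "yl \<in> C (\<tau> n (Suc l))" "dist y yl < d"
      using Ct by (auto simp: infdist_notempty cINF_less_iff)
    have Nd: "norm (N n l) \<le> \<Delta> n l" by (rule normal_step(2)[OF n l2])
    have near: "dist (P n l - F n l (P n l)) (P n (Suc l)) = infdist (P n l - F n l (P n l)) (C (\<tau> n (Suc l)))"
      by (rule normal_step(1)[OF n l2])
    have Pin: "P n (Suc l) \<in> C (\<tau> n (Suc l))" using P_in[OF n, of "Suc l"] l2 by simp
    have "V (\<tau> n j) - V (\<tau> n (Suc l)) \<le> d"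
      using V_mono[OF \<tau>(1) t(1,3)] V_mono[OF ts(1,2,4)] unfolding d by linarith
    then have Pd: "norm (P n (Suc l) - P n j) \<le> 2 * d"
      using P_diff[OF n, of "Suc l" j] l ij by (simp add: norm_minus_commute)
    have "norm (yl - P n (Suc l)) \<le> norm (yl - y) + norm (y - P n j) + norm (P n j - P n (Suc l))"
      using norm_triangle_ineq[of "yl - y" "y - P n j"]
        norm_triangle_ineq[of "yl - P n j" "P n j - P n (Suc l)"] by simp
    then have yP: "norm (yl - P n (Suc l)) \<le> norm (y - P n j) + 3 * d"
      using yl(2) Pd by (simp add: dist_norm norm_minus_commute)
    have "hypomonotone_normals \<rho> (C (\<tau> n (Suc l)))" using C(3) ts by auto
    then have "N n l \<bullet> (yl - P n (Suc l)) \<le> \<rho> * norm (N n l) * (norm (yl - P n (Suc l)))\<^sup>2"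
      unfolding hypomonotone_normals_def N_def using Pin near yl(1) by blast
    also have "\<dots> \<le> \<rho> * norm (N n l) * (norm (y - P n j) + 3 * d)\<^sup>2"
      using yP \<rho> by (intro mult_left_mono power_mono) auto
    finally have 1: "N n l \<bullet> (yl - P n (Suc l)) \<le> norm (N n l) * (\<rho> * (norm (y - P n j) + 3 * d)\<^sup>2)"
      by (simp add: mult_ac)
    have "N n l \<bullet> ((y - yl) + (P n (Suc l) - P n j)) \<le> norm (N n l) * norm ((y - yl) + (P n (Suc l) - P n j))"
      by (rule norm_cauchy_schwarz)
    also have "\<dots> \<le> norm (N n l) * (3 * d)"
      using norm_triangle_ineq[of "y - yl" "P n (Suc l) - P n j"] yl(2) Pd
      by (intro mult_left_mono) (auto simp: dist_norm)
    finally have 2: "N n l \<bullet> ((y - yl) + (P n (Suc l) - P n j)) \<le> norm (N n l) * (3 * d)" .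
    \<comment> \<open>The second summand costs \<open>3 * d\<close>: \<open>d\<close> for replacing
      \<open>y\<close> by \<open>yl\<close>, and \<open>2 * d\<close> for the iterates moving from
      step \<open>Suc l\<close> to step \<open>j\<close>.\<close>
    have "N n l \<bullet> (y - P n j) = N n l \<bullet> (yl - P n (Suc l)) + N n l \<bullet> ((y - yl) + (P n (Suc l) - P n j))"
      by (simp add: inner_diff_right inner_add_right)
    also have "\<dots> \<le> norm (N n l) * ?B" using 1 2 by (simp add: distrib_left)
    also have "\<dots> \<le> \<Delta> n l * ?B" using Nd B0 by (rule mult_right_mono)
    finally show ?thesis .
  qed
  then have "(\<Sum>l=i..<j. N n l \<bullet> (y - P n j)) \<le> (\<Sum>l=i..<j. \<Delta> n l * ?B)"
    by (intro sum_mono) auto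
  also have "\<dots> = (V (\<tau> n j) - V (\<tau> n i)) * ?B"
    using V_telescope[OF ij(1), of n] by (simp flip: sum_distrib_right)
  also have "\<dots> \<le> d * ?B"
    using V_mono[OF \<tau>(1) t(1,3)] B0 unfolding d by (intro mult_right_mono) auto
  finally show ?thesis by (simp add: inner_sum_left)
qed

text \<open>Drift with frozen states against the integral of a reference integrand \<open>f\<close>.
  The reference is \<open>g\<close> at a fixed coarse iterate in \<open>P_compare\<close>, and
  \<open>g\<close> along the limit in \<open>F_sum_tendsto\<close>.\<close>

lemma F_sum:
  assumes n: "good n" and ij: "i \<le> j" "j \<le> 2 ^ n"
    and G: "\<And>s t. 0 \<le> s \<Longrightarrow> s \<le> t \<Longrightarrow> t \<le> T \<Longrightarrow> has_weak_integral f (G t - G s) s t"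
    and f: "\<And>l s. i \<le> l \<Longrightarrow> l < j \<Longrightarrow> \<tau> n l \<le> s \<Longrightarrow> s \<le> \<tau> n (Suc l) \<Longrightarrow> norm (g s (P n l) - f s) \<le> \<eta> * m s"
  shows "norm ((\<Sum>l=i..<j. F n l (P n l)) - (G (\<tau> n j) - G (\<tau> n i))) \<le> \<eta> * (V (\<tau> n j) - V (\<tau> n i))"
proof -
  have "norm (F n l (P n l) - (G (\<tau> n (Suc l)) - G (\<tau> n l))) \<le> \<eta> * \<Delta> n l" if l: "i \<le> l" "l < j" for l
  proof -
    have l2: "l < 2 ^ n" using l ij by simp
    have ts: "0 \<le> \<tau> n l" "\<tau> n l \<le> \<tau> n (Suc l)" "\<tau> n (Suc l) \<le> T" using \<tau> l2 by auto
    have "norm (F n l (P n l) - (G (\<tau> n (Suc l)) - G (\<tau> n l))) \<le> integral {\<tau> n l..\<tau> n (Suc l)} (\<lambda>s. \<eta> * m s)"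
      by (rule has_weak_integral_norm_le[OF has_weak_integral_diff[OF F[OF l2] G[OF ts]]])
        (use f[OF l] ts in \<open>auto intro!: integrable_on_mult_right \<phi>_sub\<close>)
    then show ?thesis using V_diff ts by simp
  qed
  then have "(\<Sum>l=i..<j. norm (F n l (P n l) - (G (\<tau> n (Suc l)) - G (\<tau> n l)))) \<le> (\<Sum>l=i..<j. \<eta> * \<Delta> n l)"
    by (intro sum_mono) auto
  also have "\<dots> = \<eta> * (V (\<tau> n j) - V (\<tau> n i))"
    using V_telescope[OF ij(1), of n] by (simp flip: sum_distrib_left)
  finally have "norm (\<Sum>l=i..<j. F n l (P n l) - (G (\<tau> n (Suc l)) - G (\<tau> n l))) \<le> \<eta> * (V (\<tau> n j) - V (\<tau> n i))"
    by (rule order_trans[OF norm_sum])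
  moreover have "(\<Sum>l=i..<j. G (\<tau> n (Suc l)) - G (\<tau> n l)) = G (\<tau> n j) - G (\<tau> n i)"
    using ij(1) by (rule sum_Suc_diff')
  ultimately show ?thesis by (simp add: sum_subtractf)
qed

end

section \<open>Convergence of the catching-up algorithm\<close>

text \<open>Young's inequality together with \<open>\<delta>\<^sup>2 \<le> \<epsilon>\<close>. The
  constant is the coefficient that \<epsilon> collects, \<open>4 * 18 * \<rho> + 12 + 2\<close>; it
  exceeds those of \<open>D\<^sup>2\<close> and \<open>D'\<^sup>2\<close>.\<close>

lemma comparison_arith:
  fixes a \<rho> \<delta> \<epsilon> D D' :: real
  assumes a: "a \<le> 2 * (\<delta> * (\<rho> * (D' + 3 * \<delta>)\<^sup>2 + 3 * \<delta>)) + \<delta> * (2 * \<delta> + D) * D'"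
    and \<delta>: "0 \<le> \<delta>" "\<delta> \<le> \<epsilon>" "\<epsilon> \<le> 1" and \<rho>: "0 \<le> \<rho>"
  shows "2 * a \<le> (72 * \<rho> + 14) * \<delta> * (D\<^sup>2 + D'\<^sup>2 + \<epsilon>)"
proof -
  have \<delta>2: "\<delta>\<^sup>2 \<le> \<epsilon>"
    using mult_mono[of \<delta> \<epsilon> \<delta> 1] \<delta> by (simp add: power2_eq_square)
  have "(D' + 3 * \<delta>)\<^sup>2 \<le> 2 * D'\<^sup>2 + 18 * \<delta>\<^sup>2"
    using zero_le_power2[of "D' - 3 * \<delta>"] by (simp add: power2_eq_square algebra_simps)
  then have "(D' + 3 * \<delta>)\<^sup>2 \<le> 2 * D'\<^sup>2 + 18 * \<epsilon>" using \<delta>2 by linarith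
  then have 1: "\<rho> * (D' + 3 * \<delta>)\<^sup>2 \<le> \<rho> * (2 * D'\<^sup>2 + 18 * \<epsilon>)" using \<rho> by (rule mult_left_mono)
  have 2: "2 * \<delta> * D' \<le> \<epsilon> + D'\<^sup>2"
    using zero_le_power2[of "\<delta> - D'"] \<delta>2 by (simp add: power2_eq_square algebra_simps)
  have 3: "2 * (D * D') \<le> D\<^sup>2 + D'\<^sup>2"
    using zero_le_power2[of "D - D'"] by (simp add: power2_eq_square algebra_simps)
  have sum_le: "4 * x + 12 * \<delta> + 2 * y + 2 * z \<le> 4 * x' + 12 * \<epsilon> + 2 * y' + z'"
    if "x \<le> x'" "y \<le> y'" "2 * z \<le> z'" for x x' y y' z z' :: real
    using that \<delta> by linarith
  have "2 * a \<le> \<delta> * (4 * (\<rho> * (D' + 3 * \<delta>)\<^sup>2) + 12 * \<delta> + 2 * (2 * \<delta> * D') + 2 * (D * D'))"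
    using a by (simp add: algebra_simps)
  also have "\<dots> \<le> \<delta> * (4 * (\<rho> * (2 * D'\<^sup>2 + 18 * \<epsilon>)) + 12 * \<epsilon> + 2 * (\<epsilon> + D'\<^sup>2) + (D\<^sup>2 + D'\<^sup>2))"
    by (rule mult_left_mono[OF sum_le[OF 1 2 3] \<delta>(1)])
  also have "\<dots> \<le> \<delta> * ((72 * \<rho> + 14) * (D\<^sup>2 + D'\<^sup>2 + \<epsilon>))"
  proof (rule mult_left_mono[OF _ \<delta>(1)])
    have "0 \<le> \<rho> * D\<^sup>2" "0 \<le> \<rho> * D'\<^sup>2" "0 \<le> D\<^sup>2" "0 \<le> D'\<^sup>2" using \<rho> by auto
    then show "4 * (\<rho> * (2 * D'\<^sup>2 + 18 * \<epsilon>)) + 12 * \<epsilon> + 2 * (\<epsilon> + D'\<^sup>2) + (D\<^sup>2 + D'\<^sup>2)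
        \<le> (72 * \<rho> + 14) * (D\<^sup>2 + D'\<^sup>2 + \<epsilon>)"
      by (simp add: algebra_simps)
  qed
  finally show ?thesis by (simp add: mult_ac)
qed

context sweeping
begin

section \<open>Comparison of discrete solutions on different meshes\<close>

definition "mesh_le \<epsilon> n \<longleftrightarrow> (\<forall>i<2^n. \<Delta> n i \<le> \<epsilon>)"

lemma eventually_mesh_le:
  assumes "0 < \<epsilon>"
  shows "\<forall>\<^sub>F n in sequentially. mesh_le \<epsilon> n"
proof -
  have "uniformly_continuous_on {0..T} V"
    by (rule compact_uniformly_continuous[OF V_continuous]) simp
  then obtain d where d: "d > 0"
    "\<And>x y. x \<in> {0..T} \<Longrightarrow> y \<in> {0..T} \<Longrightarrow> dist y x < d \<Longrightarrow> dist (V y) (V x) < \<epsilon>"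
    using assms unfolding uniformly_continuous_on_def by metis
  have "(\<lambda>n. T * (1/2) ^ n) \<longlonglongrightarrow> T * 0"
    by (intro tendsto_intros LIMSEQ_power_zero) simp
  then have "\<forall>\<^sub>F n in sequentially. T * (1/2) ^ n < d"
    using d(1) by (intro order_tendstoD(2)) auto
  then show ?thesis
  proof eventually_elim
    case (elim n)
    show ?case
      unfolding mesh_le_def
    proof (intro allI impI)
      fix i :: nat assume i: "i < 2 ^ n"
      have "dist (\<tau> n (Suc i)) (\<tau> n i) < d"
        using elim T_pos by (simp add: dist_real_def dyad_Suc power_divide)
      moreover have "\<tau> n i \<in> {0..T}" "\<tau> n (Suc i) \<in> {0..T}" using \<tau>(1,3) i by auto
      ultimately show "\<Delta> n i \<le> \<epsilon>" using d(2) by (fastforce simp: dist_real_def)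
    qed
  qed
qed

text \<open>The constant of \<open>comparison_arith\<close>. It also exceeds
  \<open>2 * \<rho>\<close>, so that \<open>L * \<epsilon> \<le> 1/2\<close> makes a mesh of size
  \<epsilon> good.\<close>

definition "L = 72 * \<rho> + 14"

lemma mesh_le_good:
  assumes "mesh_le \<epsilon> n" "0 \<le> \<epsilon>" "L * \<epsilon> \<le> 1/2"
  shows "good n"
  unfolding good_def
proof (intro allI impI)
  fix i :: nat assume "i < 2 ^ n"
  then have "2 * \<rho> * \<Delta> n i \<le> 2 * \<rho> * \<epsilon>"
    using assms(1) \<rho> by (intro mult_left_mono) (auto simp: mesh_le_def)
  also have "\<dots> \<le> L * \<epsilon>" unfolding L_def using assms(2) \<rho> by (intro mult_right_mono) auto
  finally show "2 * \<rho> * \<Delta> n i < 1" using assms(3) by simp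
qed

lemma eventually_good: "\<forall>\<^sub>F n in sequentially. good n"
proof -
  have L: "L > 0" using \<rho> by (simp add: L_def)
  have "\<forall>\<^sub>F n in sequentially. mesh_le (1 / (2 * L)) n" using L by (intro eventually_mesh_le) simp
  then show ?thesis by eventually_elim (rule mesh_le_good, use L in auto)
qed

text \<open>Two catching-up solutions are compared at the nodes of the coarser mesh, where each is an
  admissible test point in the variational inequality of the other.\<close>

lemma P_compare:
  assumes \<epsilon>: "0 < \<epsilon>" "\<epsilon> \<le> 1" "L * \<epsilon> \<le> 1/2" and n: "mesh_le \<epsilon> n" and e: "good (n + e)" and i: "i \<le> 2 ^ n"
  shows "(norm (P n i - P (n + e) (i * 2 ^ e)))\<^sup>2 \<le> \<epsilon> * exp (3 * L * V T)"
proof -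
  have L: "L > 0" using \<rho> by (simp add: L_def)
  have n': "good n" using mesh_le_good[OF n] \<epsilon> by simp
  define E where "E i = (norm (P n i - P (n + e) (i * 2 ^ e)))\<^sup>2" for i
  have "E (Suc i) \<le> E i + L * \<Delta> n i * (E i + E (Suc i) + \<epsilon>)" if i: "i < 2 ^ n" for i
  proof -
    define I J where "I = i * 2 ^ e" and "J = Suc i * 2 ^ e"
    define p p' q q' where "p = P n i" and "p' = P n (Suc i)" and "q = P (n + e) I" and "q' = P (n + e) J"
    define \<delta> D D' where "\<delta> = \<Delta> n i" and "D = norm (p - q)" and "D' = norm (p' - q')"
    have IJ: "I \<le> J" by (simp add: I_def J_def)
    have "Suc i * 2 ^ e \<le> 2 ^ n * 2 ^ e" using i by (intro mult_right_mono) auto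
    then have J: "J \<le> 2 ^ (n + e)" by (simp add: J_def power_add)
    have \<tau>IJ: "\<tau> (n + e) I = \<tau> n i" "\<tau> (n + e) J = \<tau> n (Suc i)"
      unfolding I_def J_def by (rule dyad_refine)+
    have ts: "0 \<le> \<tau> n i" "\<tau> n i \<le> \<tau> n (Suc i)" "\<tau> n (Suc i) \<le> T" using \<tau> i by auto
    have q'C: "q' \<in> C (\<tau> n (Suc i))" using P_in[OF e J] \<tau>IJ by (simp add: q'_def)
    have p'C: "p' \<in> C (\<tau> n (Suc i))" using P_in[OF n', of "Suc i"] i by (simp add: p'_def)
    have \<delta>: "0 \<le> \<delta>" "\<delta> \<le> \<epsilon>"
      using V_mono[OF ts] n i by (auto simp: \<delta>_def mesh_le_def)
    \<comment> \<open>The coarse normal is tested at the fine iterate \<open>q'\<close>, below the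
      sum of the fine normals at the coarse iterate \<open>p'\<close>; both lie in the set at time
      \<open>\<tau> n (Suc i)\<close>.\<close>
    have "(\<Sum>l=i..<Suc i. N n l) \<bullet> (q' - P n (Suc i)) \<le> \<delta> * (\<rho> * (norm (q' - P n (Suc i)) + 3 * \<delta>)\<^sup>2 + 3 * \<delta>)"
      by (rule discrete_variational_inequality[OF n' _ _ _ _ ts(3) q'C])
        (use i \<tau>_less_Suc in \<open>auto simp: \<delta>_def\<close>)
    then have A: "(- (p' - p) - F n i p) \<bullet> (q' - p') \<le> \<delta> * (\<rho> * (D' + 3 * \<delta>)\<^sup>2 + 3 * \<delta>)"
      using N_telescope[of i "Suc i" n] by (simp add: p_def p'_def D'_def norm_minus_commute)
    define S where "S = (\<Sum>l=I..<J. F (n + e) l (P (n + e) l))"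
    have "(\<Sum>l=I..<J. N (n + e) l) \<bullet> (p' - P (n + e) J) \<le> \<delta> * (\<rho> * (norm (p' - P (n + e) J) + 3 * \<delta>)\<^sup>2 + 3 * \<delta>)"
      by (rule discrete_variational_inequality[OF e IJ J _ _ ts(3) p'C])
        (use \<tau>_less_Suc in \<open>auto simp: \<delta>_def \<tau>IJ\<close>)
    then have B: "(- (q' - q) - S) \<bullet> (p' - q') \<le> \<delta> * (\<rho> * (D' + 3 * \<delta>)\<^sup>2 + 3 * \<delta>)"
      using N_telescope[OF IJ, of "n + e"] by (simp add: q_def q'_def D'_def S_def)
    have pR: "norm p \<le> R" using P_R[OF n'] i by (simp add: p_def)
    have "norm (S - F n i p) \<le> (2 * \<delta> + D) * \<delta>"
    proof -
      have "norm (g t p) \<le> (1 + norm p) * c t" if "t \<in> {0..T}" for t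
        using growth[OF that] by (simp add: mult.commute)
      then obtain G :: "real \<Rightarrow> 'b" where
        G: "\<And>s t. 0 \<le> s \<Longrightarrow> s \<le> t \<Longrightarrow> t \<le> T \<Longrightarrow> has_weak_integral (\<lambda>s. g s p) (G t - G s) s t"
        by (rule primitive_exists[OF g_meas]) (assumption, rule that)
      have Fp: "F n i p = G (\<tau> n (Suc i)) - G (\<tau> n i)"
        by (rule has_weak_integral_unique[OF F[OF i] G[OF ts]])
      have "norm (g s (P (n + e) l) - g s p) \<le> (2 * \<delta> + D) * m s"
        if l: "I \<le> l" "l < J" and s: "\<tau> (n + e) l \<le> s" "s \<le> \<tau> (n + e) (Suc l)" for l s
      proof -
        have sT: "s \<in> {0..T}"
          using s \<tau>(1)[of "n + e" l] \<tau>(3)[of "Suc l" "n + e"] l J by auto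
        have "norm (P (n + e) l - q) \<le> 2 * (V (\<tau> (n + e) l) - V (\<tau> (n + e) I))"
          unfolding q_def by (rule P_diff[OF e l(1)]) (use l J in simp)
        also have "\<dots> \<le> 2 * \<delta>"
          using V_mono[of "\<tau> (n + e) l" "\<tau> (n + e) J"] \<tau>(1)[of "n + e" l] \<tau>(2)[of l J "n + e"] l ts
          by (simp add: \<delta>_def \<tau>IJ)
        finally have "norm (P (n + e) l - p) \<le> 2 * \<delta> + D"
          using norm_triangle_ineq[of "P (n + e) l - q" "q - p"] by (simp add: D_def norm_minus_commute)
        then have "m s * norm (P (n + e) l - p) \<le> m s * (2 * \<delta> + D)"
          using m_bounds(1)[OF sT] by (intro mult_left_mono) auto
        then show ?thesis
          using lip_R[OF sT P_R[OF e, of l] pR] l J by (simp add: mult.commute)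
      qed
      from F_sum[OF e IJ J G this] show ?thesis by (simp add: S_def Fp \<tau>IJ \<delta>_def)
    qed
    then have "norm (S - F n i p) * D' \<le> ((2 * \<delta> + D) * \<delta>) * D'"
      by (rule mult_right_mono) (simp add: D'_def)
    then have Cs: "(S - F n i p) \<bullet> (p' - q') \<le> \<delta> * (2 * \<delta> + D) * D'"
      using norm_cauchy_schwarz[of "S - F n i p" "p' - q'"] by (simp add: D'_def mult_ac)
    \<comment> \<open>The two tested inequalities add up to this product except for the difference
      of the drifts.\<close>
    have "((p' - p) - (q' - q)) \<bullet> (p' - q')
        = (- (p' - p) - F n i p) \<bullet> (q' - p') + (- (q' - q) - S) \<bullet> (p' - q') + (S - F n i p) \<bullet> (p' - q')"
      by (simp add: inner_diff_left inner_diff_right inner_minus_left algebra_simps)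
    also have "\<dots> \<le> 2 * (\<delta> * (\<rho> * (D' + 3 * \<delta>)\<^sup>2 + 3 * \<delta>)) + \<delta> * (2 * \<delta> + D) * D'"
      using A B Cs by linarith
    finally have "2 * (((p' - p) - (q' - q)) \<bullet> (p' - q')) \<le> L * \<delta> * (D\<^sup>2 + D'\<^sup>2 + \<epsilon>)"
      unfolding L_def by (rule comparison_arith[OF _ \<delta> \<epsilon>(2) \<rho>])
    then have "D'\<^sup>2 \<le> D\<^sup>2 + L * \<delta> * (D\<^sup>2 + D'\<^sup>2 + \<epsilon>)"
      using norm_implicit_step[of p' q' p q] by (simp add: D_def D'_def)
    then show ?thesis by (simp add: E_def D_def D'_def p_def p'_def q_def q'_def \<delta>_def I_def J_def)
  qed
  then have "E i + \<epsilon> \<le> (E 0 + \<epsilon>) * exp (3 * L * (V (\<tau> n i) - V (\<tau> n 0)))"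
  proof (rule implicit_discrete_gronwall[where N = "2 ^ n" and v = "\<lambda>i. V (\<tau> n i)", rotated 5])
    show "L * \<Delta> n i \<le> 1/2" if "i < 2 ^ n" for i
    proof -
      have "\<Delta> n i \<le> \<epsilon>" using n that unfolding mesh_le_def by blast
      then have "L * \<Delta> n i \<le> L * \<epsilon>" using L by (intro mult_left_mono) auto
      then show ?thesis using \<epsilon>(3) by linarith
    qed
    show "V (\<tau> n i) \<le> V (\<tau> n (Suc i))" if "i < 2 ^ n" for i
      using V_dyad_less[OF that] by simp
  qed (use L \<epsilon> i in \<open>auto simp: E_def\<close>)
  also have "\<dots> \<le> \<epsilon> * exp (3 * L * V T)"
    using V_mono[of "\<tau> n i" T] \<tau>(1,3) i \<epsilon> L by (simp add: E_def)
  finally show ?thesis using \<epsilon> by (simp add: E_def)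
qed

section \<open>Step functions of the scheme and their uniform limit\<close>

definition "w n t = P n (cell T n t)"

lemma cell_in: "t \<in> {0..T} \<Longrightarrow> cell T n t \<le> 2 ^ n" "t \<in> {0..T} \<Longrightarrow> \<tau> n (cell T n t) \<le> t"
  using cell_le[OF T_pos] cell_bounds[OF T_pos] by auto

lemma mesh_le_cell:
  assumes n: "mesh_le \<epsilon> n" "0 < \<epsilon>" and t: "t \<in> {0..T}"
  shows "V t - V (\<tau> n (cell T n t)) \<le> \<epsilon>"
proof (cases "t = T")
  case True
  then have "cell T n t = 2 ^ n" using cell_dyad[OF T_pos, of n "2 ^ n"] by simp
  then show ?thesis using True n(2) by simp
next
  case False
  define i where "i = cell T n t"
  have i: "i < 2 ^ n" "t < \<tau> n (Suc i)"
    using cell_less[OF T_pos] cell_bounds[OF T_pos] t False by (auto simp: i_def)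
  have "V t \<le> V (\<tau> n (Suc i))" using t i \<tau>(3)[of "Suc i" n] by (intro V_mono) auto
  then show ?thesis using n(1) i(1) by (fastforce simp: mesh_le_def i_def[symmetric])
qed

text \<open>\<open>P_compare\<close> bounds the distance at the last coarse node before
  \<open>t\<close>. Since then the coarse step function has been constant, and the fine one has
  moved by at most \<open>2 * \<epsilon>\<close>.\<close>

lemma w_compare:
  assumes \<epsilon>: "0 < \<epsilon>" "\<epsilon> \<le> 1" "L * \<epsilon> \<le> 1/2" and n: "mesh_le \<epsilon> n" and N: "good n'" "n \<le> n'" and t: "t \<in> {0..T}"
  shows "norm (w n t - w n' t) \<le> sqrt (\<epsilon> * exp (3 * L * V T)) + 2 * \<epsilon>"
proof -
  obtain e where Ne: "n' = n + e" using N(2) le_Suc_ex by blast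
  define i j where "i = cell T n t" and "j = cell T n' t"
  have i: "i \<le> 2 ^ n" "\<tau> n i \<le> t" and j: "j \<le> 2 ^ n'" "\<tau> n' j \<le> t"
    using cell_in[OF t] by (auto simp: i_def j_def)
  have \<tau>i: "\<tau> n' (i * 2 ^ e) = \<tau> n i" unfolding Ne by (rule dyad_refine)
  have ij: "i * 2 ^ e \<le> j"
    using cell_mono[OF T_pos i(2), of n'] cell_dyad[OF T_pos, of n' "i * 2 ^ e"] by (simp add: \<tau>i j_def)
  have "sqrt ((norm (P n i - P n' (i * 2 ^ e)))\<^sup>2) \<le> sqrt (\<epsilon> * exp (3 * L * V T))"
    unfolding real_sqrt_le_iff Ne by (rule P_compare[OF \<epsilon> n _ i(1)]) (use N Ne in simp)
  then have 1: "norm (P n i - P n' (i * 2 ^ e)) \<le> sqrt (\<epsilon> * exp (3 * L * V T))" by simp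
  have "norm (P n' j - P n' (i * 2 ^ e)) \<le> 2 * (V (\<tau> n' j) - V (\<tau> n' (i * 2 ^ e)))"
    by (rule P_diff[OF N(1) ij j(1)])
  also have "\<dots> \<le> 2 * (V t - V (\<tau> n i))"
    using V_mono[OF \<tau>(1) j(2)] t by (simp add: \<tau>i)
  also have "\<dots> \<le> 2 * \<epsilon>" using mesh_le_cell[OF n \<epsilon>(1) t] by (simp add: i_def)
  finally have "norm (P n' j - P n' (i * 2 ^ e)) \<le> 2 * \<epsilon>" .
  then show ?thesis
    using 1 norm_triangle_ineq4[of "P n i - P n' (i * 2 ^ e)" "P n' j - P n' (i * 2 ^ e)"]
    by (simp add: w_def i_def j_def)
qed

lemma w_uniform_limit:
  obtains u where "uniform_limit {0..T} w u sequentially"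
proof -
  have L: "L > 0" using \<rho> by (simp add: L_def)
  have "uniformly_Cauchy_on {0..T} w"
    unfolding uniformly_Cauchy_on_def
  proof (intro allI impI)
    fix e :: real assume e: "e > 0"
    let ?X = "exp (3 * L * V T)"
    \<comment> \<open>The last two entries bound the two terms of \<open>w_compare\<close> by
      \<open>e / 4\<close> each; the first two meet its hypotheses.\<close>
    define \<epsilon> where "\<epsilon> = min (min 1 (1 / (2 * L))) (min (e / 8) ((e / 4)\<^sup>2 / ?X))"
    have \<epsilon>0: "0 < \<epsilon>" using e L by (auto simp: \<epsilon>_def)
    have "\<epsilon> \<le> 1" "\<epsilon> \<le> 1 / (2 * L)" "\<epsilon> \<le> e / 8" "\<epsilon> \<le> (e / 4)\<^sup>2 / ?X"
      unfolding \<epsilon>_def by linarith+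
    then have \<epsilon>: "\<epsilon> \<le> 1" "L * \<epsilon> \<le> 1/2" "\<epsilon> \<le> e / 8" "\<epsilon> * ?X \<le> (e / 4)\<^sup>2"
      using L by (auto simp: field_simps)
    have "sqrt (\<epsilon> * ?X) \<le> e / 4" using real_sqrt_le_mono[OF \<epsilon>(4)] e by simp
    then have small: "sqrt (\<epsilon> * ?X) + 2 * \<epsilon> < e" using \<epsilon>(3) e by simp
    obtain n0 where n0: "\<And>n. n0 \<le> n \<Longrightarrow> mesh_le \<epsilon> n"
      using eventually_mesh_le[OF \<epsilon>0] by (auto simp: eventually_sequentially)
    have *: "dist (w n t) (w N t) < e" if "n0 \<le> n" "n \<le> N" "t \<in> {0..T}" for n N t
    proof -
      have "good N" by (rule mesh_le_good[OF n0]) (use that \<epsilon> \<epsilon>0 in auto)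
      from w_compare[OF \<epsilon>0 \<epsilon>(1,2) n0[OF that(1)] this that(2,3)] small show ?thesis by (simp add: dist_norm)
    qed
    show "\<exists>M. \<forall>x\<in>{0..T}. \<forall>m\<ge>M. \<forall>n\<ge>M. dist (w m x) (w n x) < e"
    proof (intro exI[of _ n0] ballI allI impI)
      fix t m n assume "t \<in> {0..T}" "n0 \<le> m" "n0 \<le> n"
      then show "dist (w m t) (w n t) < e"
        using *[of m n t] *[of n m t] by (cases "m \<le> n") (auto simp: dist_commute)
    qed
  qed
  then have "uniformly_convergent_on {0..T} w" by (rule Cauchy_uniformly_convergent)
  then show thesis using that unfolding uniformly_convergent_on_def by blast
qed

section \<open>Properties that pass to the limit\<close>

context
  fixes u :: "real \<Rightarrow> 'b"
  assumes u: "uniform_limit {0..T} w u sequentially"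
begin

lemma w_tendsto: "t \<in> {0..T} \<Longrightarrow> (\<lambda>n. w n t) \<longlonglongrightarrow> u t"
  by (rule tendsto_uniform_limitI[OF u])

lemma u_lip:
  assumes st: "0 \<le> s" "s \<le> t" "t \<le> T"
  shows "norm (u t - u s) \<le> 2 * (V t - V s)"
proof (rule tendsto_le[OF trivial_limit_sequentially])
  show "(\<lambda>n. 2 * (V (\<tau> n (cell T n t)) - V (\<tau> n (cell T n s)))) \<longlonglongrightarrow> 2 * (V t - V s)"
    by (intro tendsto_intros V_tendsto) (use st in auto)
  show "(\<lambda>n. norm (w n t - w n s)) \<longlonglongrightarrow> norm (u t - u s)"
    by (intro tendsto_intros w_tendsto) (use st in auto)
  show "\<forall>\<^sub>F n in sequentially. norm (w n t - w n s) \<le> 2 * (V (\<tau> n (cell T n t)) - V (\<tau> n (cell T n s)))"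
    using eventually_good
  proof eventually_elim
    case (elim n)
    show ?case
      unfolding w_def by (rule P_diff[OF elim cell_mono[OF T_pos st(2)] cell_in(1)]) (use st in auto)
  qed
qed

lemma u_R: "t \<in> {0..T} \<Longrightarrow> norm (u t) \<le> R"
proof (rule tendsto_upperbound[OF tendsto_norm[OF w_tendsto]])
  assume t: "t \<in> {0..T}"
  show "\<forall>\<^sub>F n in sequentially. norm (w n t) \<le> R"
    using eventually_good by eventually_elim (unfold w_def, rule P_R[OF _ cell_in(1)[OF t]])
qed auto

lemma u_0: "u 0 = z0"
proof (rule LIMSEQ_unique[OF w_tendsto])
  have "w n 0 = z0" for n by (simp add: w_def cell_def)
  then show "(\<lambda>n. w n 0) \<longlonglongrightarrow> z0" by simp
qed (use T_pos in simp)

text \<open>The approximations lie in the set of the last node before \<open>t\<close>. The motion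
  from that node to \<open>t\<close> is bounded by an increment of \<open>V\<close> that tends to
  0.\<close>

lemma u_in:
  assumes t: "t \<in> {0..T}"
  shows "u t \<in> C t"
proof -
  have "infdist (u t) (C t) \<le> V t - V t"
  proof (rule tendsto_le[OF trivial_limit_sequentially])
    show "(\<lambda>n. V t - V (\<tau> n (cell T n t))) \<longlonglongrightarrow> V t - V t"
      by (intro tendsto_intros V_tendsto) (use t in auto)
    show "(\<lambda>n. infdist (w n t) (C t)) \<longlonglongrightarrow> infdist (u t) (C t)"
      by (intro tendsto_infdist w_tendsto t)
    show "\<forall>\<^sub>F n in sequentially. infdist (w n t) (C t) \<le> V t - V (\<tau> n (cell T n t))"
      using eventually_good
    proof eventually_elim
      case (elim n)
      let ?s = "\<tau> n (cell T n t)"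
      have s: "0 \<le> ?s" "?s \<le> t" "t \<le> T" using \<tau>(1) cell_in(2)[OF t] t by auto
      have "w n t \<in> C ?s" unfolding w_def by (rule P_in[OF elim cell_in(1)[OF t]])
      then have "infdist (w n t) (C t) \<le> integral {?s..t} c"
        using move[OF s, of "w n t"] by simp
      also have "\<dots> \<le> V t - V ?s"
        using c_less_V[of ?s t] s by (cases "?s = t") auto
      finally show ?case .
    qed
  qed
  then have "infdist (u t) (C t) = 0" using infdist_nonneg[of "u t" "C t"] by simp
  then show ?thesis using in_closed_iff_infdist_zero C(1,2)[OF t] by blast
qed

text \<open>Along a step function \<open>g\<close> is measurable piece by piece, and the Lipschitz
  bound carries this to the limit \<open>u\<close>.\<close>

lemma superposition_strongly_measurable: "strongly_measurable (lebesgue_on {0..T}) (\<lambda>s. g s (u s))"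
proof -
  let ?M = "lebesgue_on {0..T}"
  have M: "complete_measure ?M" by (rule complete_measure_lebesgue_on) simp
  have F: "finite_measure ?M" by (rule finite_measure_lebesgue_on) simp
  \<comment> \<open>The value 0 on meshes that are not good makes the integrable bound hold for
    every \<open>n\<close>.\<close>
  define f where "f n s = (if good n then g s (w n s) else 0)" for n s
  have meas: "strongly_measurable ?M (f n)" for n
  proof (cases "good n")
    case True
    have "strongly_measurable ?M (\<lambda>s. g s (P n (cell T n s)))"
    proof (rule strongly_measurable_piecewise[where f = "\<lambda>i s. g s (P n i)" and I = "{..2 ^ n}"])
      show "simple_function ?M (cell T n)" by (rule simple_function_cell[OF T_pos])
      show "cell T n x \<in> {..2 ^ n}" if "x \<in> space ?M" for x
        using cell_in(1)[of x n] that by simp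
    qed (simp_all add: g_meas)
    then show ?thesis using True by (simp add: f_def[abs_def] w_def)
  next
    case False
    then show ?thesis by (simp add: f_def[abs_def] strongly_measurable_const)
  qed
  have i: "integrable ?M (\<lambda>s. c s * (1 + R))"
    by (rule integrable_lebesgue_on_nonneg)
      (use c R_pos in \<open>auto intro!: integrable_on_mult_left mult_nonneg_nonneg\<close>)
  have bnd: "norm (f n s) \<le> c s * (1 + R)" if "s \<in> space ?M" for n s
  proof -
    have s: "s \<in> {0..T}" using that by simp
    show ?thesis
      using growth_R[OF s P_R] cell_in(1)[OF s] c(2)[OF s] R_pos by (auto simp: f_def w_def)
  qed
  have lim: "(\<lambda>n. f n s) \<longlonglongrightarrow> g s (u s)" if "s \<in> space ?M" for s
  proof -
    have s: "s \<in> {0..T}" using that by simp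
    have "(\<lambda>n. w n s - u s) \<longlonglongrightarrow> 0" using w_tendsto[OF s] by (simp add: LIM_zero)
    then have "(\<lambda>n. m s * norm (w n s - u s)) \<longlonglongrightarrow> 0"
      using tendsto_mult_right_zero tendsto_norm_zero by blast
    moreover have "\<forall>\<^sub>F n in sequentially. norm (f n s - g s (u s)) \<le> m s * norm (w n s - u s)"
      using eventually_good
    proof eventually_elim
      case (elim n)
      then show ?case
        using lip_R[OF s P_R[OF elim cell_in(1)[OF s]] u_R[OF s]] by (simp add: f_def w_def)
    qed
    ultimately have "(\<lambda>n. f n s - g s (u s)) \<longlonglongrightarrow> 0"
      by (rule Lim_null_comparison[rotated])
    then show ?thesis by (simp add: LIM_zero_iff)
  qed
  show ?thesis
    by (rule strongly_measurable_AE_lim[OF M F meas i bnd AE_I2[OF lim]])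
qed

context
  fixes G :: "real \<Rightarrow> 'b"
  assumes G: "\<And>s t. 0 \<le> s \<Longrightarrow> s \<le> t \<Longrightarrow> t \<le> T \<Longrightarrow> has_weak_integral (\<lambda>s. g s (u s)) (G t - G s) s t"
begin

lemma G_lip: "0 \<le> s \<Longrightarrow> s \<le> t \<Longrightarrow> t \<le> T \<Longrightarrow> norm (G t - G s) \<le> V t - V s"
proof -
  assume st: "0 \<le> s" "s \<le> t" "t \<le> T"
  have "norm (G t - G s) \<le> integral {s..t} m"
  proof (rule has_weak_integral_norm_le[OF G[OF st] \<phi>_sub])
    fix x assume "x \<in> {s..t}"
    then have x: "x \<in> {0..T}" using st by simp
    show "norm (g x (u x)) \<le> m x" using growth_R[OF x u_R[OF x]] m_bounds(3)[OF x] by simp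
  qed (use st in auto)
  then show ?thesis using V_diff[OF st] by simp
qed

lemma G_tendsto:
  assumes t: "t \<in> {0..T}"
  shows "(\<lambda>n. G (\<tau> n (cell T n t))) \<longlonglongrightarrow> G t"
proof -
  have "(\<lambda>n. V t - V (\<tau> n (cell T n t))) \<longlonglongrightarrow> V t - V t"
    by (intro tendsto_intros V_tendsto) (use t in auto)
  then have "(\<lambda>n. V t - V (\<tau> n (cell T n t))) \<longlonglongrightarrow> 0" by simp
  moreover have "norm (G (\<tau> n (cell T n t)) - G t) \<le> V t - V (\<tau> n (cell T n t))" for n
    using G_lip[OF \<tau>(1) cell_in(2)[OF t]] t by (simp add: norm_minus_commute)
  ultimately have "(\<lambda>n. G (\<tau> n (cell T n t)) - G t) \<longlonglongrightarrow> 0"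
    by (rule Lim_null_comparison[OF always_eventually[OF allI], rotated])
  then show ?thesis by (simp add: LIM_zero_iff)
qed

lemma F_sum_tendsto:
  assumes st: "0 \<le> s" "s \<le> t" "t \<le> T"
  shows "(\<lambda>n. \<Sum>l=cell T n s..<cell T n t. F n l (P n l)) \<longlonglongrightarrow> G t - G s"
proof -
  define x where "x n = (\<Sum>l=cell T n s..<cell T n t. F n l (P n l))" for n
  define y where "y n = G (\<tau> n (cell T n t)) - G (\<tau> n (cell T n s))" for n
  have V0: "0 \<le> V T" using V_mono[of 0 T] T_pos by simp
  have "(\<lambda>n. x n - y n) \<longlonglongrightarrow> 0"
  proof (rule tendstoI)
    fix \<epsilon> :: real assume \<epsilon>: "\<epsilon> > 0"
    define e where "e = \<epsilon> / (3 * V T + 1)"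
    have e: "e > 0" "3 * e * V T < \<epsilon>" using \<epsilon> V0 by (auto simp: e_def field_simps)
    have "\<forall>\<^sub>F n in sequentially. \<forall>t\<in>{0..T}. dist (w n t) (u t) < e"
      using u e(1) unfolding uniform_limit_iff by blast
    then show "\<forall>\<^sub>F n in sequentially. dist (x n - y n) 0 < \<epsilon>"
      using eventually_good eventually_mesh_le[OF e(1)]
    proof eventually_elim
      case (elim n)
      have ij: "cell T n s \<le> cell T n t" "cell T n t \<le> 2 ^ n"
        using cell_mono[OF T_pos st(2)] cell_in(1)[of t n] st by auto
      have "norm (g \<sigma> (P n l) - g \<sigma> (u \<sigma>)) \<le> (3 * e) * m \<sigma>"
        if l: "cell T n s \<le> l" "l < cell T n t" and \<sigma>: "\<tau> n l \<le> \<sigma>" "\<sigma> \<le> \<tau> n (Suc l)" for l \<sigma>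
      proof -
        have l2: "l < 2 ^ n" using l ij by simp
        have ts: "0 \<le> \<tau> n l" "\<tau> n l \<le> T" "\<tau> n (Suc l) \<le> T"
          using \<tau>(1,3) l2 by auto
        have \<sigma>T: "\<sigma> \<in> {0..T}" using \<sigma> ts by auto
        have "dist (w n (\<tau> n l)) (u (\<tau> n l)) < e" using elim(1) ts by simp
        then have 1: "norm (P n l - u (\<tau> n l)) < e"
          by (simp add: w_def cell_dyad[OF T_pos] dist_norm)
        have "norm (u \<sigma> - u (\<tau> n l)) \<le> 2 * (V \<sigma> - V (\<tau> n l))"
          by (rule u_lip) (use \<sigma> \<sigma>T ts in auto)
        also have "\<dots> \<le> 2 * \<Delta> n l" using V_mono[of \<sigma> "\<tau> n (Suc l)"] \<sigma> \<sigma>T ts by auto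
        also have "\<Delta> n l \<le> e" using elim(3) l2 unfolding mesh_le_def by blast
        finally have "norm (u \<sigma> - u (\<tau> n l)) \<le> 2 * e" by simp
        then have "norm (P n l - u \<sigma>) \<le> 3 * e"
          using 1 norm_triangle_ineq4[of "P n l - u (\<tau> n l)" "u \<sigma> - u (\<tau> n l)"] by simp
        then have "m \<sigma> * norm (P n l - u \<sigma>) \<le> m \<sigma> * (3 * e)"
          using m_bounds(1)[OF \<sigma>T] by (intro mult_left_mono) auto
        then show ?thesis
          using lip_R[OF \<sigma>T P_R[OF elim(2), of l] u_R[OF \<sigma>T]] l2 by (simp add: mult.commute)
      qed
      from F_sum[OF elim(2) ij G this]
      have "norm (x n - y n) \<le> (3 * e) * (V (\<tau> n (cell T n t)) - V (\<tau> n (cell T n s)))"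
        unfolding x_def y_def .
      also have "\<dots> \<le> (3 * e) * V T"
      proof (rule mult_left_mono)
        have "V 0 \<le> V (\<tau> n (cell T n s))"
          by (rule V_mono[OF order_refl \<tau>(1) \<tau>(3)[OF cell_in(1)]]) (use st in auto)
        moreover have "V (\<tau> n (cell T n t)) \<le> V T"
          by (rule V_mono[OF \<tau>(1) \<tau>(3)[OF ij(2)] order_refl])
        ultimately show "V (\<tau> n (cell T n t)) - V (\<tau> n (cell T n s)) \<le> V T" by simp
      qed (use e in simp)
      finally show ?case using e(2) by simp
    qed
  qed
  moreover have "y \<longlonglongrightarrow> G t - G s"
    unfolding y_def[abs_def] by (rule tendsto_diff[OF G_tendsto G_tendsto]) (use st in auto)
  ultimately have "(\<lambda>n. (x n - y n) + y n) \<longlonglongrightarrow> 0 + (G t - G s)" by (rule tendsto_add)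
  then have "x \<longlonglongrightarrow> G t - G s" by simp
  then show ?thesis unfolding x_def[abs_def] .
qed

text \<open>The discrete inequality is taken over the cells between those of \<open>s\<close> and
  \<open>t\<close>. Its variation starts at the node at or before \<open>s\<close>, where
  \<open>V\<close> tends to \<open>V s\<close> by continuity.\<close>

lemma variational_inequality:
  assumes st: "0 \<le> s" "s < t" "t \<le> T" and y: "y \<in> C t"
  shows "(- (u t - u s) - (G t - G s)) \<bullet> (y - u t)
    \<le> (V t - V s) * (\<rho> * (norm (y - u t) + 3 * (V t - V s))\<^sup>2 + 3 * (V t - V s))"
proof (rule tendsto_le[OF trivial_limit_sequentially])
  let ?d = "\<lambda>n. V t - V (\<tau> n (cell T n s))"
  have t: "t \<in> {0..T}" and s: "s \<in> {0..T}" using st by auto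
  show "(\<lambda>n. ?d n * (\<rho> * (norm (y - w n t) + 3 * ?d n)\<^sup>2 + 3 * ?d n)) \<longlonglongrightarrow>
    (V t - V s) * (\<rho> * (norm (y - u t) + 3 * (V t - V s))\<^sup>2 + 3 * (V t - V s))"
    by (intro tendsto_intros V_tendsto w_tendsto) (use st in auto)
  show "(\<lambda>n. (- (w n t - w n s) - (\<Sum>l=cell T n s..<cell T n t. F n l (P n l))) \<bullet> (y - w n t)) \<longlonglongrightarrow>
    (- (u t - u s) - (G t - G s)) \<bullet> (y - u t)"
    by (intro tendsto_intros w_tendsto F_sum_tendsto) (use st in auto)
  show "\<forall>\<^sub>F n in sequentially. (- (w n t - w n s) - (\<Sum>l=cell T n s..<cell T n t. F n l (P n l))) \<bullet> (y - w n t)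
    \<le> ?d n * (\<rho> * (norm (y - w n t) + 3 * ?d n)\<^sup>2 + 3 * ?d n)"
    using eventually_good
  proof eventually_elim
    case (elim n)
    have ij: "cell T n s \<le> cell T n t" using cell_mono[OF T_pos] st by simp
    have "(\<Sum>l=cell T n s..<cell T n t. N n l) \<bullet> (y - P n (cell T n t))
      \<le> ?d n * (\<rho> * (norm (y - P n (cell T n t)) + 3 * ?d n)\<^sup>2 + 3 * ?d n)"
      by (rule discrete_variational_inequality[OF elim ij cell_in(1)[OF t] cell_in(2)[OF t] _ st(3) y refl])
        (use cell_in(2)[OF s, of n] st in simp)
    then show ?case by (simp only: N_telescope[OF ij] w_def)
  qed
qed

end

end

end

section \<open>Solutions of the sweeping process\<close>

context sweeping
begin

theorem sweeping_solution:
  obtains z v :: "real \<Rightarrow> 'b" where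
    "z 0 = z0" "\<And>t. t \<in> {0..T} \<Longrightarrow> z t \<in> C t" "continuous_on {0..T} z"
    "strongly_measurable (lebesgue_on {0..T}) v" "\<And>t. t \<in> {0..T} \<Longrightarrow> norm (v t) \<le> 2 * m t"
    "\<And>s t. 0 \<le> s \<Longrightarrow> s \<le> t \<Longrightarrow> t \<le> T \<Longrightarrow> has_weak_integral v (z t - z s) s t"
    "AE t in lebesgue_on {0..T}. (z has_vector_derivative v t) (at t within {0..T}) \<and>
      (\<exists>\<sigma>. \<forall>y\<in>C t. (- v t - g t (z t)) \<bullet> (y - z t) \<le> \<sigma> * (norm (y - z t))\<^sup>2)"
proof -
  let ?M = "lebesgue_on {0..T}"
  obtain u where u: "uniform_limit {0..T} w u sequentially" by (rule w_uniform_limit)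
  have mR: "norm (g t (u t)) \<le> (1 + R) * c t" "norm (g t (u t)) \<le> m t" if "t \<in> {0..T}" for t
    using growth_R[OF that u_R[OF u that]] m_bounds(3)[OF that] by (simp_all add: mult.commute)
  note hm = superposition_strongly_measurable[OF u]
  obtain G :: "real \<Rightarrow> 'b" where
    G: "\<And>s t. 0 \<le> s \<Longrightarrow> s \<le> t \<Longrightarrow> t \<le> T \<Longrightarrow> has_weak_integral (\<lambda>s. g s (u s)) (G t - G s) s t"
    by (rule primitive_exists[OF hm mR(1)]) (assumption, rule that)
  \<comment> \<open>The factor 2 in \<open>u_lip\<close> is put into the weight to meet the
    hypothesis of the primitive theorem.\<close>
  have 2: "weight T (\<lambda>t. 2 * m t)"
    by unfold_locales (use T_pos \<phi> m_bounds(1) in \<open>force intro: integrable_on_mult_right\<close>)+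
  have u2: "norm (u t - u s) \<le> integral {s..t} (\<lambda>t. 2 * m t)" if "0 \<le> s" "s \<le> t" "t \<le> T" for s t
    using u_lip[OF u that] V_diff[OF that] by simp
  obtain v where v: "strongly_measurable ?M v" "\<And>t. t \<in> {0..T} \<Longrightarrow> norm (v t) \<le> 2 * m t"
    "\<And>s t. 0 \<le> s \<Longrightarrow> s \<le> t \<Longrightarrow> t \<le> T \<Longrightarrow> has_weak_integral v (u t - u s) s t"
    by (rule weight.dominated_increments_imp_primitive[OF 2 u2])
      (assumption, assumption, assumption, rule that)
  have du: "AE t in ?M. (u has_vector_derivative v t) (at t within {0..T})"
    by (rule Lebesgue_differentiation[OF v(1) integrable_on_mult_right[OF \<phi>] v(2,3)])
  have dG: "AE t in ?M. (G has_vector_derivative g t (u t)) (at t within {0..T})"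
    by (rule Lebesgue_differentiation[OF hm \<phi> mR(2) G])
  have mm: "strongly_measurable ?M m"
    using strongly_measurable_iff_borel_measurable[OF complete_measure_lebesgue_on, of "{0..T}" m]
      integrable_imp_measurable[OF \<phi>] by simp
  have mw: "has_weak_integral m (V t - V s) s t" if "0 \<le> s" "s \<le> t" "t \<le> T" for s t
  proof -
    have "(m has_integral V t - V s) {s..t}"
      using integrable_integral[OF \<phi>_sub[OF that(1,3)]] V_diff[OF that] by simp
    then show ?thesis by (simp add: has_weak_integral_def has_integral_mult_left)
  qed
  have dV: "AE t in ?M. (V has_vector_derivative m t) (at t within {0..T})"
    by (rule Lebesgue_differentiation[OF mm \<phi> _ mw]) (use m_bounds(1) in force)
  \<comment> \<open>Left quotients require \<open>0 < t\<close>.\<close>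
  have "AE t in ?M. t \<noteq> 0"
    by (subst AE_lebesgue_on_iff_negligible) (auto intro: negligible_subset[of "{0}"])
  then have "AE t in ?M. (u has_vector_derivative v t) (at t within {0..T}) \<and>
      (\<exists>\<sigma>. \<forall>y\<in>C t. (- v t - g t (u t)) \<bullet> (y - u t) \<le> \<sigma> * (norm (y - u t))\<^sup>2)"
    using du dG dV AE_space
  proof eventually_elim
    case (elim t)
    then have t: "0 < t" "t \<le> T" by auto
    \<comment> \<open>The constant \<open>m t * \<rho>\<close> arises because
      \<open>?d s / (t - s)\<close> tends to \<open>m t\<close> while the remaining occurrences of
      \<open>?d s\<close> tend to 0.\<close>
    have "(- v t - g t (u t)) \<bullet> (y - u t) \<le> (m t * \<rho>) * (norm (y - u t))\<^sup>2" if y: "y \<in> C t" for y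
    proof -
      let ?f = "\<lambda>s. (- ((u t - u s) /\<^sub>R (t - s)) - ((G t - G s) /\<^sub>R (t - s))) \<bullet> (y - u t)"
      let ?d = "\<lambda>s. V t - V s"
      let ?h = "\<lambda>s. (?d s /\<^sub>R (t - s)) * (\<rho> * (norm (y - u t) + 3 * ?d s)\<^sup>2 + 3 * ?d s)"
      have "(V \<longlongrightarrow> V t) (at_left t)"
      proof -
        have "(V \<longlongrightarrow> V t) (at t within {0..T})"
          using V_continuous t by (auto simp: continuous_on_def)
        then have "(V \<longlongrightarrow> V t) (at t within {0..t})"
          by (rule tendsto_within_subset) (use t in auto)
        then show ?thesis using at_within_Icc_at_left[OF t(1)] by simp
      qed
      then have "(?h \<longlongrightarrow> m t * (\<rho> * (norm (y - u t) + 3 * (V t - V t))\<^sup>2 + 3 * (V t - V t))) (at_left t)"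
        by (intro tendsto_intros has_vector_derivative_left_quotient[OF elim(4) t])
      then have h: "(?h \<longlongrightarrow> (m t * \<rho>) * (norm (y - u t))\<^sup>2) (at_left t)" by (simp add: mult.assoc)
      have f: "(?f \<longlongrightarrow> (- v t - g t (u t)) \<bullet> (y - u t)) (at_left t)"
        by (intro tendsto_intros has_vector_derivative_left_quotient[OF _ t] elim(2,3))
      have "\<forall>\<^sub>F s in at_left t. s \<in> {0<..<t}"
        using t by (rule_tac eventually_at_leftI[of 0]) auto
      then have "\<forall>\<^sub>F s in at_left t. ?f s \<le> ?h s"
      proof eventually_elim
        case (elim s)
        have "?f s = ((- (u t - u s) - (G t - G s)) \<bullet> (y - u t)) / (t - s)"
          by (simp add: inner_diff_left inner_minus_left divide_inverse algebra_simps)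
        also have "\<dots> \<le> (?d s * (\<rho> * (norm (y - u t) + 3 * ?d s)\<^sup>2 + 3 * ?d s)) / (t - s)"
          by (rule divide_right_mono[OF variational_inequality[OF u G]]) (use elim t y in auto)
        also have "\<dots> = ?h s" by (simp add: divide_inverse)
        finally show ?case .
      qed
      then show ?thesis by (rule tendsto_le[OF trivial_limit_at_left_real h f])
    qed
    with elim(2) show ?case by blast
  qed
  moreover have "continuous_on {0..T} u"
  proof (rule continuous_onI)
    fix x e :: real assume x: "x \<in> {0..T}" and e: "0 < e"
    obtain d where d: "d > 0" "\<And>y. y \<in> {0..T} \<Longrightarrow> dist y x < d \<Longrightarrow> dist (V y) (V x) < e / 2"
      using V_continuous x e unfolding continuous_on_iff by (metis half_gt_zero)
    have "dist (u y) (u x) \<le> e" if y: "y \<in> {0..T}" "dist y x < d" for y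
    proof -
      have "norm (u y - u x) \<le> 2 * \<bar>V y - V x\<bar>"
      proof (cases "x \<le> y")
        case True
        then show ?thesis using u_lip[OF u, of x y] x y(1) abs_ge_self[of "V y - V x"] by auto
      next
        case False
        then show ?thesis using u_lip[OF u, of y x] x y(1) abs_ge_minus_self[of "V y - V x"]
          by (auto simp: norm_minus_commute)
      qed
      then show ?thesis using d(2)[OF y] by (simp add: dist_norm)
    qed
    then show "\<exists>d>0. \<forall>x'\<in>{0..T}. dist x' x < d \<longrightarrow> dist (u x') (u x) \<le> e" using d(1) by blast
  qed
  ultimately show thesis
    using that[OF u_0[OF u] u_in[OF u] _ v] by blast
qed

end

section \<open>Sets in the product space that constrain only the velocity\<close>

lemma norm_snd_le': "norm (snd z) \<le> norm z"
  by (cases z) (simp add: norm_snd_le)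

lemma norm_fst_le': "norm (fst z) \<le> norm z"
  by (cases z) (simp add: norm_fst_le)

lemma infdist_UNIV_Times:
  fixes w :: "'a::real_inner \<times> 'b::real_inner"
  assumes "S \<noteq> {}"
  shows "infdist w (UNIV \<times> S) = infdist (snd w) S"
proof (rule antisym)
  have ne: "(UNIV :: 'a set) \<times> S \<noteq> {}" using assms by auto
  show "infdist w (UNIV \<times> S) \<le> infdist (snd w) S"
    unfolding infdist_notempty[OF assms]
  proof (rule cINF_greatest[OF assms])
    fix y assume "y \<in> S"
    then have "infdist w (UNIV \<times> S) \<le> dist w (fst w, y)" by (intro infdist_le) auto
    then show "infdist w (UNIV \<times> S) \<le> dist (snd w) y" by (simp add: dist_prod_def)
  qed
  show "infdist (snd w) S \<le> infdist w (UNIV \<times> S)"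
    unfolding infdist_notempty[OF ne]
  proof (rule cINF_greatest[OF ne])
    fix p assume "p \<in> (UNIV :: 'a set) \<times> S"
    then have "infdist (snd w) S \<le> dist (snd w) (snd p)" by (intro infdist_le) auto
    also have "\<dots> \<le> dist w p" by (rule dist_snd_le)
    finally show "infdist (snd w) S \<le> dist w p" .
  qed
qed

text \<open>A nearest point shares the first component of \<open>w\<close>, so the normal is purely
  in the second factor and the inequality for \<open>S\<close> applies; passing to product norms
  only enlarges the right-hand side.\<close>

lemma hypomonotone_normals_UNIV_Times:
  fixes S :: "'b::real_inner set"
  assumes S: "hypomonotone_normals \<rho> S" "S \<noteq> {}" and \<rho>: "0 \<le> \<rho>"
  shows "hypomonotone_normals \<rho> ((UNIV :: 'a::real_inner set) \<times> S)"
  unfolding hypomonotone_normals_def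
proof (intro allI ballI impI)
  fix w p y :: "'a \<times> 'b"
  assume p: "p \<in> UNIV \<times> S" "dist w p = infdist w (UNIV \<times> S)" and y: "y \<in> UNIV \<times> S"
  have "infdist (snd w) S \<le> dist (snd w) (snd p)" using p(1) by (intro infdist_le) auto
  then have "(dist w p)\<^sup>2 \<le> (dist (snd w) (snd p))\<^sup>2"
    unfolding p(2) infdist_UNIV_Times[OF S(2)] by (intro power_mono) (auto simp: infdist_nonneg)
  then have 1: "fst w = fst p" by (simp add: dist_prod_def)
  then have 2: "dist (snd w) (snd p) = infdist (snd w) S"
    using p(2) unfolding infdist_UNIV_Times[OF S(2)] by (simp add: dist_prod_def)
  have "(w - p) \<bullet> (y - p) = (snd w - snd p) \<bullet> (snd y - snd p)"
    using 1 by (simp add: inner_prod_def)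
  also have "\<dots> \<le> \<rho> * norm (snd w - snd p) * (norm (snd y - snd p))\<^sup>2"
    using S(1) p(1) y 2 unfolding hypomonotone_normals_def by auto
  also have "\<dots> \<le> \<rho> * norm (w - p) * (norm (y - p))\<^sup>2"
    using norm_snd_le'[of "w - p"] norm_snd_le'[of "y - p"] \<rho>
    by (intro mult_mono mult_left_mono power_mono) auto
  finally show "(w - p) \<bullet> (y - p) \<le> \<rho> * norm (w - p) * (norm (y - p))\<^sup>2" .
qed

section \<open>Absolute continuity and derivatives from integral representations\<close>

lemma absolutely_continuous_upto_dominated:
  fixes v :: "real \<Rightarrow> 'b::{real_inner, complete_space}"
  assumes v: "strongly_measurable (lebesgue_on {0..T}) v" and \<phi>: "\<phi> integrable_on {0..T}"
    and le: "\<And>t. t \<in> {0..T} \<Longrightarrow> norm (v t) \<le> \<phi> t"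
    and u: "\<And>t. 0 \<le> t \<Longrightarrow> t \<le> T \<Longrightarrow> has_weak_integral v (u t - u 0) 0 t" and T: "0 \<le> T"
  shows "absolutely_continuous_upto T u"
proof -
  have *: "has_strong_bochner_integral (lebesgue_on {0..t}) v (u t - u 0)" if t: "t \<in> {0..T}" for t
  proof -
    have m: "strongly_measurable (lebesgue_on {0..t}) v"
      by (rule strongly_measurable_lebesgue_on_subset[OF v]) (use t in auto)
    have i: "\<phi> integrable_on {0..t}" by (rule integrable_subinterval_real[OF \<phi>]) (use t in auto)
    obtain y where y: "has_strong_bochner_integral (lebesgue_on {0..t}) v y" "has_weak_integral v y 0 t"
      by (rule strong_bochner_integral_exists[OF m i le]) (use t in auto)
    have "y = u t - u 0" by (rule has_weak_integral_unique[OF y(2) u]) (use t in auto)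
    with y(1) show ?thesis by simp
  qed
  moreover have "strongly_integrable (lebesgue_on {0..T}) v"
    unfolding strongly_integrable_def using *[of T] T by auto
  ultimately show ?thesis unfolding absolutely_continuous_upto_def by blast
qed

lemma absolutely_continuous_upto_real_bound:
  fixes a :: "real \<Rightarrow> real"
  assumes "absolutely_continuous_upto T a"
  obtains b where "b integrable_on {0..T}" "\<And>t. 0 \<le> b t"
    "\<And>s t. 0 \<le> s \<Longrightarrow> s \<le> t \<Longrightarrow> t \<le> T \<Longrightarrow> \<bar>a t - a s\<bar> \<le> integral {s..t} b"
proof -
  obtain v where v: "strongly_integrable (lebesgue_on {0..T}) v"
    "\<And>t. t \<in> {0..T} \<Longrightarrow> has_strong_bochner_integral (lebesgue_on {0..t}) v (a t - a 0)"
    using assms unfolding absolutely_continuous_upto_def by blast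
  obtain y where "has_strong_bochner_integral (lebesgue_on {0..T}) v y"
    using v(1) unfolding strongly_integrable_def by blast
  then have "has_bochner_integral (lebesgue_on {0..T}) v y"
    using has_strong_bochner_integral_iff_has_bochner_integral[OF complete_measure_lebesgue_on, of "{0..T}" v y]
    by simp
  then have "integrable (lebesgue_on {0..T}) (\<lambda>t. \<bar>v t\<bar>)"
    by (intro integrable_abs) (rule integrable.intros)
  then have i: "(\<lambda>t. \<bar>v t\<bar>) integrable_on {0..T}" by (rule integrable_on_lebesgue_on) simp
  have "has_weak_integral v (a t - a 0) 0 t" if "0 \<le> t" "t \<le> T" for t
    by (rule has_weak_integral_strong[OF v(2)]) (use that in simp)
  note w = has_weak_integral_increment[OF this]
  show thesis
  proof (rule that[OF i])
    fix s t assume st: "0 \<le> s" "s \<le> t" "t \<le> T"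
    have "(\<lambda>t. \<bar>v t\<bar>) integrable_on {s..t}"
      by (rule integrable_subinterval_real[OF i]) (use st in auto)
    from has_weak_integral_norm_le[OF w[OF _ _ st] this]
    show "\<bar>a t - a s\<bar> \<le> integral {s..t} (\<lambda>t. \<bar>v t\<bar>)" by simp
  qed simp
qed

text \<open>Continuity of the integrand gives the derivative at every time, endpoints included, as a
  solution of class C1 requires.\<close>

lemma has_vector_derivative_continuous_integrand:
  fixes w x :: "real \<Rightarrow> 'b::real_inner"
  assumes w: "continuous_on {0..T} w"
    and x: "\<And>s t. 0 \<le> s \<Longrightarrow> s \<le> t \<Longrightarrow> t \<le> T \<Longrightarrow> has_weak_integral w (x t - x s) s t"
    and t: "t \<in> {0..T}"
  shows "(x has_vector_derivative w t) (at t within {0..T})"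
  unfolding has_vector_derivative_def has_derivative_within_alt
proof (intro conjI allI impI)
  show "bounded_linear (\<lambda>h. h *\<^sub>R w t)" by (rule bounded_linear_scaleR_left)
  fix e :: real assume e: "e > 0"
  then obtain d where d: "d > 0" "\<And>s. s \<in> {0..T} \<Longrightarrow> dist s t < d \<Longrightarrow> dist (w s) (w t) < e"
    using w t unfolding continuous_on_iff by metis
  have key: "norm (x b - x a - (b - a) *\<^sub>R w t) \<le> e * (b - a)"
    if ab: "0 \<le> a" "a \<le> b" "b \<le> T" "\<And>s. s \<in> {a..b} \<Longrightarrow> dist s t < d" for a b
  proof -
    have "norm (x b - x a - (b - a) *\<^sub>R w t) \<le> integral {a..b} (\<lambda>_. e)"
    proof (rule has_weak_integral_norm_le[OF has_weak_integral_diff[OF x[OF ab(1-3)] has_weak_integral_const[OF ab(2)]]])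
      show "norm (w s - w t) \<le> e" if "s \<in> {a..b}" for s
        using d(2)[of s] ab that by (simp add: dist_norm less_imp_le)
    qed (rule integrable_const_ivl)
    then show ?thesis using ab by (simp add: mult.commute)
  qed
  show "\<exists>d>0. \<forall>y\<in>{0..T}. norm (y - t) < d \<longrightarrow> norm (x y - x t - (y - t) *\<^sub>R w t) \<le> e * norm (y - t)"
  proof (intro exI[of _ d] conjI ballI impI d(1))
    fix y assume y: "y \<in> {0..T}" "norm (y - t) < d"
    show "norm (x y - x t - (y - t) *\<^sub>R w t) \<le> e * norm (y - t)"
    proof (cases "t \<le> y")
      case True
      then show ?thesis using key[of t y] y t by (auto simp: dist_real_def)
    next
      case False
      have "norm (x y - x t - (y - t) *\<^sub>R w t) = norm (- (x t - x y - (t - y) *\<^sub>R w t))"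
        by (simp add: algebra_simps)
      then show ?thesis using key[of y t] y t False unfolding norm_minus_cancel
        by (auto simp: dist_real_def)
    qed
  qed
qed

theorem theorem3p1:
  fixes T :: real
    and f :: "real \<Rightarrow> 'h \<Rightarrow> 'h \<Rightarrow> 'h::{real_inner, complete_space}"
    and r :: ereal
    and K :: "real \<Rightarrow> 'h set"
    and x0 u0 :: 'h
  assumes "T > 0"
    and "\<And>x u. strongly_measurable (lebesgue_on {0..T}) (\<lambda>t. f t x u)"
    and "\<And>\<eta>. \<eta> > 0 \<Longrightarrow>
      \<exists>k :: real \<Rightarrow> real. integrable (lebesgue_on {0..T}) k \<and> (\<forall>t\<in>{0..T}. k t \<ge> 0) \<and>
        (\<forall>t\<in>{0..T}. \<forall>x\<in>cball 0 \<eta>. \<forall>y\<in>cball 0 \<eta>. \<forall>u\<in>cball 0 \<eta>. \<forall>v\<in>cball 0 \<eta>.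
          norm (f t x u - f t y v) \<le> k t * (norm (x - y) + norm (u - v)))"
    and "\<exists>c :: real \<Rightarrow> real. integrable (lebesgue_on {0..T}) c \<and> (\<forall>t\<in>{0..T}. c t \<ge> 0) \<and>
        (\<forall>t\<in>{0..T}. \<forall>x u. norm (f t x u) \<le> c t * (1 + norm x + norm u))"
    and "r > 0"
    and "\<And>t. t \<in> {0..T} \<Longrightarrow> K t \<noteq> {} \<and> closed (K t) \<and> prox_regular r (K t)"
    and "\<exists>a :: real \<Rightarrow> real. absolutely_continuous_upto T a \<and>
        (\<forall>t\<in>{0..T}. \<forall>s\<in>{0..T}. \<forall>u. \<bar>infdist u (K t) - infdist u (K s)\<bar> \<le> \<bar>a t - a s\<bar>)"
    and "u0 \<in> K 0"
  shows "\<exists>x x' :: real \<Rightarrow> 'h.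
      (\<forall>t\<in>{0..T}. (x has_vector_derivative x' t) (at t within {0..T})) \<and>
      continuous_on {0..T} x' \<and>
      absolutely_continuous_upto T x \<and>
      absolutely_continuous_upto T x' \<and>
      (AE t in lebesgue_on {0..T}. \<exists>x''.
         (x' has_vector_derivative x'') (at t within {0..T}) \<and>
         - x'' \<in> (\<lambda>\<xi>. \<xi> + f t (x t) (x' t)) ` prox_normal_cone (K t) (x' t)) \<and>
      (\<forall>t\<in>{0..T}. x' t \<in> K t) \<and>
      x 0 = x0 \<and> x' 0 = u0"
proof -
  let ?M = "lebesgue_on {0..T}"
  define \<rho> where "\<rho> = real_of_ereal (1 / (2 * r))"
  have \<rho>: "0 \<le> \<rho>"
    using assms(5) unfolding \<rho>_def by (intro real_of_ereal_pos) simp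
  obtain c0 where c0: "integrable ?M c0" "\<And>t. t \<in> {0..T} \<Longrightarrow> 0 \<le> c0 t"
    "\<And>t x u. t \<in> {0..T} \<Longrightarrow> norm (f t x u) \<le> c0 t * (1 + norm x + norm u)"
    using assms(4) by blast
  obtain a where a: "absolutely_continuous_upto T a"
    "\<And>t s u. t \<in> {0..T} \<Longrightarrow> s \<in> {0..T} \<Longrightarrow> \<bar>infdist u (K t) - infdist u (K s)\<bar> \<le> \<bar>a t - a s\<bar>"
    using assms(7) by blast
  obtain b where b: "b integrable_on {0..T}" "\<And>t. 0 \<le> b t"
    "\<And>s t. 0 \<le> s \<Longrightarrow> s \<le> t \<Longrightarrow> t \<le> T \<Longrightarrow> \<bar>a t - a s\<bar> \<le> integral {s..t} b"
    using absolutely_continuous_upto_real_bound[OF a(1)] by blast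
  \<comment> \<open>The 1 pays for the component \<open>- snd z\<close>, the factor 2 for bounding
    both components by \<open>norm z\<close>, and \<open>b\<close> for the motion of the
    sets.\<close>
  define c where "c t = 1 + 2 * c0 t + b t" for t
  have c0i: "c0 integrable_on {0..T}" using c0(1) by (rule integrable_on_lebesgue_on) simp
  have c: "c integrable_on {0..T}"
    unfolding c_def[abs_def]
    by (intro integrable_add integrable_on_mult_right integrable_const_ivl c0i b(1))
  define z0 where "z0 = (x0, u0)"
  \<comment> \<open>The radius in the locale assumption \<open>lip\<close>. It involves only
    \<open>c\<close> and the initial data, so the Lipschitz function can now be chosen for
    it.\<close>
  define \<eta> where "\<eta> = (1 + norm z0) * exp (3 * integral {0..T} c)"
  have "\<eta> > 0" unfolding \<eta>_def by (simp add: add_pos_nonneg)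
  from assms(3)[OF this] obtain k0 :: "real \<Rightarrow> real" where k0: "integrable ?M k0"
    "\<And>t. t \<in> {0..T} \<Longrightarrow> 0 \<le> k0 t"
    "\<And>t x y u v. t \<in> {0..T} \<Longrightarrow> x \<in> cball 0 \<eta> \<Longrightarrow> y \<in> cball 0 \<eta> \<Longrightarrow> u \<in> cball 0 \<eta> \<Longrightarrow> v \<in> cball 0 \<eta> \<Longrightarrow>
      norm (f t x u - f t y v) \<le> k0 t * (norm (x - y) + norm (u - v))"
    by blast
  define k where "k t = 1 + 2 * k0 t" for t
  have k0i: "k0 integrable_on {0..T}" using k0(1) by (rule integrable_on_lebesgue_on) simp
  have k: "k integrable_on {0..T}"
    unfolding k_def[abs_def]
    by (intro integrable_add integrable_on_mult_right integrable_const_ivl k0i)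
  define g where "g t z = (- snd z, f t (fst z) (snd z))" for t and z :: "'h \<times> 'h"
  define C where "C t = (UNIV :: 'h set) \<times> K t" for t
  interpret S: sweeping T \<rho> c k g C z0
  proof
    show "0 < T" "0 \<le> \<rho>" "c integrable_on {0..T}" "k integrable_on {0..T}" by fact+
    show "z0 \<in> C 0" using assms(8) by (simp add: z0_def C_def)
    fix t assume t: "t \<in> {0..T}"
    show "0 \<le> c t" "0 \<le> k t" using c0(2)[OF t] b(2)[of t] k0(2)[OF t] by (simp_all add: c_def k_def)
    have K: "K t \<noteq> {}" "closed (K t)" "prox_regular r (K t)" using assms(6)[OF t] by auto
    show "C t \<noteq> {}" "closed (C t)" using K by (auto simp: C_def intro: closed_Times)
    show "hypomonotone_normals \<rho> (C t)"
      unfolding C_def \<rho>_def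
      by (rule hypomonotone_normals_UNIV_Times[OF prox_regular_imp_hypomonotone_normals])
        (use K \<rho> in \<open>simp_all add: \<rho>_def\<close>)
    fix z :: "'h \<times> 'h"
    have n: "norm (fst z) \<le> norm z" "norm (snd z) \<le> norm z" by (rule norm_fst_le' norm_snd_le')+
    have "norm (g t z) \<le> norm (snd z) + norm (f t (fst z) (snd z))"
      unfolding g_def using norm_Pair_le[of "- snd z"] by simp
    also have "\<dots> \<le> norm z + c0 t * (1 + 2 * norm z)"
      using n c0(3)[OF t, of "fst z" "snd z"]
        mult_left_mono[of "1 + norm (fst z) + norm (snd z)" "1 + 2 * norm z" "c0 t"] c0(2)[OF t] by simp
    also have "\<dots> \<le> c t * (1 + norm z)"
      using c0(2)[OF t] b(2)[of t] mult_nonneg_nonneg[of "b t" "norm z"] by (simp add: c_def algebra_simps)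
    finally show "norm (g t z) \<le> c t * (1 + norm z)" .
    fix z' :: "'h \<times> 'h"
    assume z: "norm z \<le> (1 + norm z0) * exp (3 * integral {0..T} c)"
      "norm z' \<le> (1 + norm z0) * exp (3 * integral {0..T} c)"
    have d: "norm (fst z - fst z') \<le> norm (z - z')" "norm (snd z - snd z') \<le> norm (z - z')"
      using norm_fst_le'[of "z - z'"] norm_snd_le'[of "z - z'"] by simp_all
    have "g t z - g t z' = (- (snd z - snd z'), f t (fst z) (snd z) - f t (fst z') (snd z'))"
      by (simp add: g_def)
    then have "norm (g t z - g t z') \<le> norm (snd z - snd z') + norm (f t (fst z) (snd z) - f t (fst z') (snd z'))"
      using norm_Pair_le[of "- (snd z - snd z')"] by (simp only: norm_minus_cancel)
    also have "\<dots> \<le> norm (z - z') + k0 t * (norm (fst z - fst z') + norm (snd z - snd z'))"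
      by (intro add_mono d(2) k0(3)[OF t])
        (use z n norm_fst_le'[of z'] norm_snd_le'[of z'] in \<open>auto simp: \<eta>_def\<close>)
    also have "\<dots> \<le> norm (z - z') + k0 t * (2 * norm (z - z'))"
      using d k0(2)[OF t] by (intro add_left_mono mult_left_mono) auto
    finally show "norm (g t z - g t z') \<le> k t * norm (z - z')" by (simp add: k_def algebra_simps)
  next
    fix z :: "'h \<times> 'h"
    show "strongly_measurable ?M (\<lambda>t. g t z)"
      unfolding g_def
      by (rule strongly_measurable_compose[OF assms(2), where h = "\<lambda>y. (- snd z, y)"]) (intro tendsto_intros)
  next
    fix s t :: real and z :: "'h \<times> 'h"
    assume st: "0 \<le> s" "s \<le> t" "t \<le> T"
    then have K: "K s \<noteq> {}" "K t \<noteq> {}" using assms(6) by auto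
    have "\<bar>infdist z (C s) - infdist z (C t)\<bar> \<le> \<bar>a t - a s\<bar>"
      using a(2)[of s t "snd z"] st K by (simp add: C_def infdist_UNIV_Times abs_minus_commute)
    also have "\<dots> \<le> integral {s..t} b" using st by (rule b(3))
    also have "\<dots> \<le> integral {s..t} c"
    proof (rule integral_le)
      show "b integrable_on {s..t}" "c integrable_on {s..t}"
        using b(1) c st by (auto intro: integrable_subinterval_real)
      show "b x \<le> c x" if "x \<in> {s..t}" for x using c0(2)[of x] st that by (simp add: c_def)
    qed
    finally show "\<bar>infdist z (C s) - infdist z (C t)\<bar> \<le> integral {s..t} c" .
  qed
  obtain z v where z: "z 0 = z0" "\<And>t. t \<in> {0..T} \<Longrightarrow> z t \<in> C t" "continuous_on {0..T} z"
    and v: "strongly_measurable ?M v" "\<And>t. t \<in> {0..T} \<Longrightarrow> norm (v t) \<le> 2 * S.m t"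
      "\<And>s t. 0 \<le> s \<Longrightarrow> s \<le> t \<Longrightarrow> t \<le> T \<Longrightarrow> has_weak_integral v (z t - z s) s t"
    and AE: "AE t in ?M. (z has_vector_derivative v t) (at t within {0..T}) \<and>
      (\<exists>\<sigma>. \<forall>y\<in>C t. (- v t - g t (z t)) \<bullet> (y - z t) \<le> \<sigma> * (norm (y - z t))\<^sup>2)"
    by (rule S.sweeping_solution) (rule that)
  define x where "x t = fst (z t)" for t
  define x' where "x' t = snd (z t)" for t
  have m: "(\<lambda>t. 2 * S.m t) integrable_on {0..T}" by (rule integrable_on_mult_right[OF S.\<phi>])
  have w1: "has_weak_integral (\<lambda>t. fst (v t)) (x t - x s) s t" if "0 \<le> s" "s \<le> t" "t \<le> T" for s t
    unfolding has_weak_integral_def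
  proof
    fix y
    show "((\<lambda>s. fst (v s) \<bullet> y) has_integral (x t - x s) \<bullet> y) {s..t}"
      using has_weak_integralD[OF v(3)[OF that], of "(y, 0)"] by (simp add: inner_prod_def x_def)
  qed
  have w2: "has_weak_integral (\<lambda>t. snd (v t)) (x' t - x' s) s t" if "0 \<le> s" "s \<le> t" "t \<le> T" for s t
    unfolding has_weak_integral_def
  proof
    fix y
    show "((\<lambda>s. snd (v s) \<bullet> y) has_integral (x' t - x' s) \<bullet> y) {s..t}"
      using has_weak_integralD[OF v(3)[OF that], of "(0, y)"] by (simp add: inner_prod_def x'_def)
  qed
  \<comment> \<open>The first component of a test point is free. A step
    \<open>\<alpha> *\<^sub>R \<xi>\<close> gives \<open>\<alpha> * (norm \<xi>)\<^sup>2 \<le>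
    \<sigma> * (\<alpha> * norm \<xi>)\<^sup>2\<close>, and \<alpha> with
    \<open>\<sigma> * \<alpha> < 1\<close> forces \<open>\<xi> = 0\<close>.\<close>
  have fst_v: "AE t in ?M. fst (v t) = x' t"
    using AE AE_space
  proof eventually_elim
    case (elim t)
    then have t: "t \<in> {0..T}" by simp
    obtain \<sigma> where \<sigma>: "\<And>y. y \<in> C t \<Longrightarrow> (- v t - g t (z t)) \<bullet> (y - z t) \<le> \<sigma> * (norm (y - z t))\<^sup>2"
      using elim(1) by blast
    define \<xi> where "\<xi> = x' t - fst (v t)"
    define \<alpha> where "\<alpha> = 1 / (\<bar>\<sigma>\<bar> + 1)"
    have \<alpha>: "0 < \<alpha>" "\<sigma> * \<alpha> < 1" by (auto simp: \<alpha>_def field_simps)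
    have "(fst (z t) + \<alpha> *\<^sub>R \<xi>, snd (z t)) \<in> C t"
      using z(2)[OF t] by (auto simp: C_def)
    from \<sigma>[OF this] have "\<alpha> * (norm \<xi>)\<^sup>2 \<le> \<sigma> * (\<alpha> * norm \<xi>)\<^sup>2"
      using \<alpha>(1) by (simp add: inner_prod_def norm_prod_def g_def \<xi>_def x'_def power2_norm_eq_inner
          flip: power_mult_distrib)
    then have "\<alpha> * (norm \<xi>)\<^sup>2 * (1 - \<sigma> * \<alpha>) \<le> 0"
      by (simp add: power2_eq_square algebra_simps)
    then have "(norm \<xi>)\<^sup>2 \<le> 0" using \<alpha> by (simp add: mult_le_0_iff)
    then show ?case by (simp add: \<xi>_def)
  qed
  have cx': "continuous_on {0..T} x'" unfolding x'_def[abs_def] by (intro continuous_intros z(3))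
  \<comment> \<open>Replacing \<open>fst (v t)\<close> by the continuous \<open>x'\<close> under the
    integral upgrades the derivative of \<open>x\<close> from almost every to every time.\<close>
  have w3: "has_weak_integral x' (x t - x s) s t" if st: "0 \<le> s" "s \<le> t" "t \<le> T" for s t
    unfolding has_weak_integral_def
  proof
    fix y
    have neg: "negligible {t \<in> {0..T}. \<not> fst (v t) = x' t}"
      using fst_v AE_lebesgue_on_iff_negligible[of "{0..T}" "\<lambda>t. fst (v t) = x' t"] by simp
    show "((\<lambda>s. x' s \<bullet> y) has_integral (x t - x s) \<bullet> y) {s..t}"
      by (rule has_integral_spike[OF neg _ has_weak_integralD[OF w1[OF st]]]) (use st in auto)
  qed
  have dx: "(x has_vector_derivative x' t) (at t within {0..T})" if "t \<in> {0..T}" for t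
    by (rule has_vector_derivative_continuous_integrand[OF cx' w3 that])
  have ac1: "absolutely_continuous_upto T x"
  proof (rule absolutely_continuous_upto_dominated[OF _ m])
    show "strongly_measurable ?M (\<lambda>t. fst (v t))"
      by (rule strongly_measurable_compose[OF v(1)]) (rule tendsto_fst)
    show "norm (fst (v t)) \<le> 2 * S.m t" if "t \<in> {0..T}" for t
      using norm_fst_le'[of "v t"] v(2)[OF that] by simp
  qed (use w1 assms(1) in auto)
  have ac2: "absolutely_continuous_upto T x'"
  proof (rule absolutely_continuous_upto_dominated[OF _ m])
    show "strongly_measurable ?M (\<lambda>t. snd (v t))"
      by (rule strongly_measurable_compose[OF v(1)]) (rule tendsto_snd)
    show "norm (snd (v t)) \<le> 2 * S.m t" if "t \<in> {0..T}" for t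
      using norm_snd_le'[of "v t"] v(2)[OF that] by simp
  qed (use w2 assms(1) in auto)
  have incl: "AE t in ?M. \<exists>x''. (x' has_vector_derivative x'') (at t within {0..T}) \<and>
      - x'' \<in> (\<lambda>\<xi>. \<xi> + f t (x t) (x' t)) ` prox_normal_cone (K t) (x' t)"
    using AE AE_space
  proof eventually_elim
    case (elim t)
    then have t: "t \<in> {0..T}" by simp
    obtain \<sigma> where \<sigma>: "\<And>y. y \<in> C t \<Longrightarrow> (- v t - g t (z t)) \<bullet> (y - z t) \<le> \<sigma> * (norm (y - z t))\<^sup>2"
      using elim(1) by blast
    have d: "(x' has_vector_derivative snd (v t)) (at t within {0..T})"
      unfolding x'_def[abs_def]
      by (rule bounded_linear.has_vector_derivative[OF bounded_linear_snd conjunct1[OF elim(1)]])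
    have "- snd (v t) - f t (x t) (x' t) \<in> prox_normal_cone (K t) (x' t)"
    proof (rule prox_normal_coneI)
      show "x' t \<in> K t" using z(2)[OF t] by (auto simp: C_def x'_def)
      fix y assume "y \<in> K t"
      \<comment> \<open>With the first component of the test point unchanged, only the velocity
        terms survive on both sides.\<close>
      then have "(fst (z t), y) \<in> C t" by (simp add: C_def)
      from \<sigma>[OF this] show "(- snd (v t) - f t (x t) (x' t)) \<bullet> (y - x' t) \<le> \<sigma> * (norm (y - x' t))\<^sup>2"
        by (simp add: inner_prod_def norm_prod_def g_def x_def x'_def)
    qed
    then have "- snd (v t) \<in> (\<lambda>\<xi>. \<xi> + f t (x t) (x' t)) ` prox_normal_cone (K t) (x' t)"
      by (intro image_eqI[of _ _ "- snd (v t) - f t (x t) (x' t)"]) simp_all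
    with d show ?case by blast
  qed
  have "x' t \<in> K t" if "t \<in> {0..T}" for t
    using z(2)[OF that] by (auto simp: C_def x'_def)
  moreover have "x 0 = x0" "x' 0 = u0" using z(1) by (simp_all add: x_def x'_def z0_def)
  ultimately show ?thesis
    using dx cx' ac1 ac2 incl by (intro exI[of _ x] exI[of _ x'] conjI ballI) auto
qed

end
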